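(* Let $\theta$ be a nonconstant inner function, let $u,v\in H^2$ with $\|u\|=1$, $S^*v\ne0$ and $\theta\mid u$ (i.e. $u\in\theta H^2$), and let $R_1f=T_{\overline{\theta}}f+\langle f,u\rangle v$ on $H^2$. Assume $1+\langle\theta v,u\rangle=0$, so that $M=\ker R_1=K_\theta\oplus\operatorname{span}\{\theta v\}$ is a nearly $S^*$-invariant subspace with defect $1$ (defect space $\operatorname{span}\{\theta S^*v\}$). Let $$f_0=P_M1=1-\overline{\theta(0)}\,\theta+\overline{\theta(0)}\,\overline{v(0)}\,\|v\|^{-2}\,\theta v .$$ Then $$M=\Big\{f : f=k_0-\Big(k_0\overline{\theta(0)}+k_1\frac{v(0)}{\|S^*v\|}\Big)\theta+\Big(k_0\frac{\overline{\theta(0)v(0)}}{\|v\|^2}+\|S^*v\|^{-1}k_1\Big)\theta v,\ (k_0,k_1)\in K\Big\},$$ where $K$ is the $S^*\oplus S^*$-invariant subspace consisting of all $(k_0,k_1)\in H^2\times H^2$ such that $$k_0-\Big(k_0\overline{\theta(0)}+k_1\frac{v(0)}{\|S^*v\|}\Big)\theta\in K_\theta\quad\text{and}\quad k_0\frac{\overline{\theta(0)v(0)}}{\|v\|^2}+\|S^*v\|^{-1}k_1\in\mathbb{C}.$$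
   Context: $H^2$ is the Hardy space of the unit disc $\mathbb{D}$, identified via boundary values with a closed subspace of $L^2(\mathbb{T})$; $P:L^2(\mathbb{T})\to H^2$ is the orthogonal projection, $P_M$ the orthogonal projection onto $M$; the Toeplitz operator is $T_gf=P(gf)$. The backward shift is $S^*f(z)=(f(z)-f(0))/z$. An inner function is a bounded analytic function on $\mathbb{D}$ with unimodular boundary values a.e.; $K_\theta=H^2\ominus\theta H^2$ is the model space. $\mathbb{C}$ denotes the constant functions. A subspace $K\subset H^2\times H^2$ is $S^*\oplus S^*$-invariant if $(k_0,k_1)\in K$ implies $(S^*k_0,S^*k_1)\in K$. A subspace $M\subset H^2$ is nearly $S^*$-invariant with defect $m$ if there is an $m$-dimensional subspace $F$ (the defect space) such that $S^*f\in M+F$ whenever $f\in M$ and $f(0)=0$. *)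

theory Defs
  imports "HOL-Complex_Analysis.Complex_Analysis" "HOL-Library.Function_Algebras"
begin

text \<open>
  A function on the open unit disc is represented by the function on \<open>complex\<close> that extends it
  by \<open>0\<close>, so that equality of functions is equality on the disc.  Sums and products
  of functions are the pointwise ones of \<open>Function_Algebras\<close>; beware that its \<open>1\<close> is not
  the constant \<open>1\<close> on the disc, for which \<open>disc_const 1\<close> is used.
\<close>

definition fscale :: "complex \<Rightarrow> (complex \<Rightarrow> complex) \<Rightarrow> complex \<Rightarrow> complex"  (infixr "*\<^sub>F" 75)
  where "c *\<^sub>F f = (\<lambda>z. c * f z)"

definition fscale2 ::
  "complex \<Rightarrow> (complex \<Rightarrow> complex) \<times> (complex \<Rightarrow> complex) \<Rightarrow> (complex \<Rightarrow> complex) \<times> (complex \<Rightarrow> complex)"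
  where "fscale2 c k = (c *\<^sub>F fst k, c *\<^sub>F snd k)"

global_interpretation cfun: vector_space fscale
  by unfold_locales (auto simp: fscale_def fun_eq_iff algebra_simps)

global_interpretation cfun2: vector_space fscale2
  by unfold_locales (auto simp: fscale2_def fscale_def fun_eq_iff algebra_simps)

definition disc_const :: "complex \<Rightarrow> complex \<Rightarrow> complex"
  where "disc_const c = (\<lambda>z. if z \<in> ball 0 1 then c else 0)"

text \<open>Normalised arc length measure on the unit circle.\<close>

definition circle :: "complex measure"
  where "circle = distr (uniform_measure lborel {0..2*pi}) borel cis"

definition L2_inner :: "(complex \<Rightarrow> complex) \<Rightarrow> (complex \<Rightarrow> complex) \<Rightarrow> complex"
  where "L2_inner f g = (\<integral>\<zeta>. f \<zeta> * cnj (g \<zeta>) \<partial>circle)"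

definition H2 :: "(complex \<Rightarrow> complex) set"
  where "H2 = {f. f holomorphic_on ball 0 1 \<and> (\<forall>z. z \<notin> ball 0 1 \<longrightarrow> f z = 0) \<and>
    bdd_above ((\<lambda>r. \<integral>\<zeta>. (cmod (f (of_real r * \<zeta>)))\<^sup>2 \<partial>circle) ` {0..<1})}"

text \<open>
  Radial boundary values.  For \<open>f \<in> H2\<close> the limit exists almost everywhere (Fatou), and
  \<open>bdry\<close> is the embedding of \<open>H2\<close> into \<open>L\<^sup>2\<close> of the circle.
\<close>

definition bdry :: "(complex \<Rightarrow> complex) \<Rightarrow> complex \<Rightarrow> complex"
  where "bdry f \<zeta> = Lim (at_left 1) (\<lambda>r::real. f (of_real r * \<zeta>))"

definition H2_inner :: "(complex \<Rightarrow> complex) \<Rightarrow> (complex \<Rightarrow> complex) \<Rightarrow> complex"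
  where "H2_inner f g = L2_inner (bdry f) (bdry g)"

definition H2_norm :: "(complex \<Rightarrow> complex) \<Rightarrow> real"
  where "H2_norm f = sqrt (Re (H2_inner f f))"

text \<open>
  Orthogonal projection of a square-integrable function \<open>g\<close> on the circle onto a closed
  subspace \<open>M\<close> of \<open>H2\<close>; the result is given as a function on the disc.  The projection
  onto \<open>M\<close> of a function \<open>f \<in> H2\<close> is \<open>proj M (bdry f)\<close>.
\<close>

definition proj :: "(complex \<Rightarrow> complex) set \<Rightarrow> (complex \<Rightarrow> complex) \<Rightarrow> complex \<Rightarrow> complex"
  where "proj M g = (THE h. h \<in> M \<and> (\<forall>k\<in>M. L2_inner (g - bdry h) (bdry k) = 0))"

definition toeplitz :: "(complex \<Rightarrow> complex) \<Rightarrow> (complex \<Rightarrow> complex) \<Rightarrow> complex \<Rightarrow> complex"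
  where "toeplitz g f = proj H2 (g * bdry f)"

text \<open>The value at \<open>0\<close> is the removable singularity of \<open>(f z - f 0) / z\<close>.\<close>

definition backshift :: "(complex \<Rightarrow> complex) \<Rightarrow> complex \<Rightarrow> complex"
  where "backshift f = (\<lambda>z. if z = 0 then deriv f 0
     else if z \<in> ball 0 1 then (f z - f 0) / z else 0)"

definition inner_function :: "(complex \<Rightarrow> complex) \<Rightarrow> bool"
  where "inner_function \<theta> \<longleftrightarrow>
     \<theta> holomorphic_on ball 0 1 \<and> (\<forall>z. z \<notin> ball 0 1 \<longrightarrow> \<theta> z = 0) \<and> bounded (\<theta> ` ball 0 1) \<and>
     (AE \<zeta> in circle. \<exists>w. ((\<lambda>r::real. \<theta> (of_real r * \<zeta>)) \<longlongrightarrow> w) (at_left 1) \<and> cmod w = 1)"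

definition model_space :: "(complex \<Rightarrow> complex) \<Rightarrow> (complex \<Rightarrow> complex) set"
  where "model_space \<theta> = {f \<in> H2. \<forall>g\<in>H2. H2_inner f (\<theta> * g) = 0}"

definition closed_subspace_H2 :: "(complex \<Rightarrow> complex) set \<Rightarrow> bool"
  where "closed_subspace_H2 M \<longleftrightarrow> M \<subseteq> H2 \<and> cfun.subspace M \<and>
     (\<forall>X f. (\<forall>n. X n \<in> M) \<and> f \<in> H2 \<and> (\<lambda>n::nat. H2_norm (X n - f)) \<longlonglongrightarrow> 0 \<longrightarrow> f \<in> M)"

definition closed_subspace_H2xH2 :: "((complex \<Rightarrow> complex) \<times> (complex \<Rightarrow> complex)) set \<Rightarrow> bool"
  where "closed_subspace_H2xH2 K \<longleftrightarrow> K \<subseteq> H2 \<times> H2 \<and> cfun2.subspace K \<and>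
     (\<forall>X Y f g. (\<forall>n. (X n, Y n) \<in> K) \<and> f \<in> H2 \<and> g \<in> H2 \<and>
        (\<lambda>n::nat. H2_norm (X n - f)) \<longlonglongrightarrow> 0 \<and> (\<lambda>n. H2_norm (Y n - g)) \<longlonglongrightarrow> 0 \<longrightarrow> (f, g) \<in> K)"

definition invariant_SS :: "((complex \<Rightarrow> complex) \<times> (complex \<Rightarrow> complex)) set \<Rightarrow> bool"
  where "invariant_SS K \<longleftrightarrow> (\<forall>k0 k1. (k0, k1) \<in> K \<longrightarrow> (backshift k0, backshift k1) \<in> K)"

definition defect_space :: "nat \<Rightarrow> (complex \<Rightarrow> complex) set \<Rightarrow> (complex \<Rightarrow> complex) set \<Rightarrow> bool"
  where "defect_space m M F \<longleftrightarrow> F \<subseteq> H2 \<and>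
     (\<exists>B. finite B \<and> card B = m \<and> cfun.independent B \<and> F = cfun.span B) \<and>
     (\<forall>f\<in>M. f 0 = 0 \<longrightarrow> (\<exists>g\<in>M. \<exists>h\<in>F. backshift f = g + h))"

definition nearly_invariant :: "nat \<Rightarrow> (complex \<Rightarrow> complex) set \<Rightarrow> bool"
  where "nearly_invariant m M \<longleftrightarrow> closed_subspace_H2 M \<and> (\<exists>F. defect_space m M F)"

end

theory Submission
  imports Defs
begin

text \<open>
  For \<open>f\<close> in \<open>H2\<close> the equation \<open>R1 f = 0\<close> says that \<open>\<langle>f, \<theta> k\<rangle> + \<langle>f, u\<rangle> \<langle>v, k\<rangle> = 0\<close> for all \<open>k\<close> in \<open>H2\<close>
  (\<open>rank_one_kernel_iff\<close>).  Multiplication by \<open>\<theta>\<close> is isometric, so with \<open>c = - \<langle>f, u\<rangle>\<close> this means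
  that \<open>f - c \<theta> v\<close> is orthogonal to \<open>\<theta> H2\<close>, that is, lies in the model space.  Conversely \<open>u\<close> is
  orthogonal to the model space because \<open>\<theta>\<close> divides it, and \<open>\<langle>\<theta> v, u\<rangle> = -1\<close> makes \<open>c\<close> and \<open>- \<langle>f, u\<rangle>\<close>
  agree for every \<open>f = g + c \<theta> v\<close>.  Hence \<open>M\<close> is the orthogonal sum of the model space and the
  line of \<open>\<theta> v\<close>.  The backward shift is the adjoint of multiplication by \<open>z\<close>, which commutes with
  multiplication by \<open>\<theta>\<close>; so it preserves the model space, and
  \<open>S\<^sup>*(\<theta> v) = \<theta> S\<^sup>*v + v(0) S\<^sup>*\<theta>\<close> with \<open>S\<^sup>*\<theta>\<close> in the model space.  This gives the defect space, and
  the projection of \<open>1\<close> is computed on the two orthogonal summands.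

  For the description of \<open>M\<close> by \<open>K\<close>, prescribe the model space component \<open>g\<close> and the constant \<open>c\<close>
  and solve for the pair: eliminating \<open>k1\<close> leaves
  \<open>k0 = (g + v(0) c \<theta>) / (1 - cnj \<theta>(0) t \<theta>)\<close> with \<open>t = 1 - \<bar>v(0)\<bar>\<^sup>2 / \<parallel>v\<parallel>\<^sup>2\<close>.  Since \<open>0 \<le> t \<le> 1\<close>,
  \<open>\<bar>\<theta>\<bar> \<le> 1\<close> and \<open>\<bar>\<theta>(0)\<bar> < 1\<close>, the denominator is bounded away from \<open>0\<close>, so \<open>k0\<close> lies in \<open>H2\<close>.
  The set \<open>K\<close> itself is cut out by equations that are continuous in the pair
  (\<open>model_pairs_iff\<close>), and the equation tested on \<open>k\<close> for the shifted pair is the equation tested on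
  \<open>z k\<close> for the original pair, whence closedness and invariance.

  All this rests on the Hilbert space structure of \<open>H2\<close>, whose inner product is defined through
  radial boundary values.  Their existence is Fatou's theorem, obtained from an \<open>L\<^sup>2\<close> bound for the
  radial maximal function (\<open>nn_integral_radial_max\<close>).  The supremum over radii is linearised: a
  measurable choice \<open>r(x)\<close> of radii gives an integral operator \<open>T\<close> with kernel \<open>P\<^bsub>r(x)\<^esub>(x cnj y)\<close>,
  \<open>P\<close> being the Poisson kernel.  By the semigroup law the kernel of \<open>T T\<^sup>*\<close> is
  \<open>P\<^bsub>r(x) r(x')\<^esub>(x cnj x')\<close>, and \<open>P\<^bsub>r s\<^esub> \<le> 16 (P\<^bsub>r\<^esub> + P\<^bsub>s\<^esub>)\<close> bounds it by \<open>16\<close> times the sum of the kernels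
  of \<open>T\<close> and \<open>T\<^sup>*\<close>.  Therefore \<open>\<parallel>T\<parallel>\<^sup>2 \<le> 32 \<parallel>T\<parallel>\<close>, so \<open>\<parallel>T\<parallel> \<le> 32\<close> whatever the choice of radii
  (\<open>sel_poisson_adjoint_bound\<close>).  Applied to the tails of a power series this gives radial limits
  almost everywhere, and applied to the whole series it gives the dominating function that lets
  inner products be computed on smaller circles.
\<close>

section \<open>Normalised arc length on the unit circle\<close>

lemma cis_borel [measurable]: "cis \<in> borel_measurable borel"
  by (intro borel_measurable_continuous_onI continuous_intros)

lemma cnj_borel [measurable]: "cnj \<in> borel_measurable borel"
  by (intro borel_measurable_continuous_onI continuous_intros)

lemma cis_uniform [measurable]: "cis \<in> borel_measurable (uniform_measure lborel A)"
  using cis_borel by (simp cong: measurable_cong_sets)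

lemma finite_measure_circle: "finite_measure circle"
  unfolding circle_def
  by (intro finite_measure.finite_measure_distr finite_measureI)
     (auto simp: emeasure_uniform_measure_1)

interpretation circle: finite_measure circle
  by (rule finite_measure_circle)

interpretation circle2: pair_sigma_finite circle circle ..

lemma space_circle [simp]: "space circle = UNIV"
  and sets_circle [simp, measurable_cong]: "sets circle = sets borel"
  by (simp_all add: circle_def)

lemma integral_circle:
  fixes f :: "complex \<Rightarrow> 'a::{banach, second_countable_topology}"
  assumes [measurable]: "f \<in> borel_measurable borel"
  shows "(\<integral>\<zeta>. f \<zeta> \<partial>circle) = (\<integral>t. indicator {0..2*pi} t *\<^sub>R f (cis t) \<partial>lborel) /\<^sub>R (2*pi)"
proof -
  have "(\<integral>\<zeta>. f \<zeta> \<partial>circle) = (\<integral>t. f (cis t) \<partial>uniform_measure lborel {0..2*pi})"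
    unfolding circle_def by (rule integral_distr) measurable
  also have "uniform_measure lborel {0..2*pi}
      = density lborel (\<lambda>t. ennreal (indicator {0..2*pi} t / (2*pi)))"
    unfolding uniform_measure_def
    by (intro arg_cong2[where f=density] refl ext)
       (auto simp: indicator_def divide_ennreal simp flip: ennreal_1)
  also have "(\<integral>t. f (cis t) \<partial>\<dots>) = (\<integral>t. (indicator {0..2*pi} t / (2*pi)) *\<^sub>R f (cis t) \<partial>lborel)"
    by (subst integral_density) auto
  also have "\<dots> = (\<integral>t. inverse (2*pi) *\<^sub>R (indicator {0..2*pi} t *\<^sub>R f (cis t)) \<partial>lborel)"
    by (intro Bochner_Integration.integral_cong) (auto simp: field_simps)
  also have "\<dots> = inverse (2*pi) *\<^sub>R (\<integral>t. indicator {0..2*pi} t *\<^sub>R f (cis t) \<partial>lborel)"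
    by (rule integral_scaleR_right)
  finally show ?thesis .
qed

lemma AE_circle_norm: "AE \<zeta> in circle. cmod \<zeta> = 1"
  unfolding circle_def by (subst AE_distr_iff) auto

lemma integral_circle_const [simp]:
  fixes c :: "'a::{banach, second_countable_topology}"
  shows "(\<integral>\<zeta>. c \<partial>circle) = c"
  by (subst integral_circle) auto

lemma measure_circle [simp]: "measure circle UNIV = 1"
  using integral_circle_const[of "1::real"] by simp

lemma integral_powers:
  "(\<integral>\<zeta>. \<zeta> ^ m * cnj (\<zeta> ^ n) \<partial>circle) = (if m = n then 1 else 0)"
proof -
  let ?k = "real m - real n"
  have "(\<integral>\<zeta>. \<zeta> ^ m * cnj (\<zeta> ^ n) \<partial>circle)
     = (\<integral>t. indicator {0..2*pi} t *\<^sub>R cis (?k * t) \<partial>lborel) /\<^sub>R (2*pi)"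
  proof -
    have "cis t ^ m * cnj (cis t ^ n) = cis (?k * t)" for t
      by (simp only: Complex.DeMoivre cis_cnj cis_mult) (simp add: left_diff_distrib)
    then show ?thesis by (subst integral_circle) simp_all
  qed
  also have "\<dots> = (if m = n then 1 else 0)"
  proof (cases "m = n")
    case False
    have "(\<integral>t. indicator {0..2*pi} t *\<^sub>R cis (?k * t) \<partial>lborel)
       = cis (?k * (2*pi)) / (\<i> * ?k) - cis (?k * 0) / (\<i> * ?k)"
    proof (rule integral_FTC_Icc)
      fix t
      have "((\<lambda>z. exp (\<i> * ?k * z) / (\<i> * ?k)) has_field_derivative exp (\<i> * ?k * t)) (at (of_real t))"
        using False by (auto intro!: derivative_eq_intros)
      from has_vector_derivative_real_field[OF this]
      show "((\<lambda>t. cis (?k * t) / (\<i> * ?k)) has_vector_derivative cis (?k * t)) (at t within {0..2*pi})"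
        by (simp add: cis_conv_exp mult_ac)
    qed (auto intro!: continuous_intros)
    moreover have "cis (?k * (2*pi)) = 1"
      using cis_multiple_2pi[of ?k] by (simp add: mult.commute)
    ultimately show ?thesis using False by simp
  qed auto
  finally show ?thesis .
qed

text \<open>
  Measurability is required with respect to all Borel sets of the plane, as \<open>circle\<close> is a measure on
  the whole plane that is concentrated on the unit circle.
\<close>

definition sq_integrable :: "(complex \<Rightarrow> complex) \<Rightarrow> bool" where
  "sq_integrable g \<longleftrightarrow> g \<in> borel_measurable borel \<and> integrable circle (\<lambda>\<zeta>. (cmod (g \<zeta>))\<^sup>2)"

lemma mult_le_sum_squares:
  fixes x y :: real
  assumes "0 \<le> x" "0 \<le> y"
  shows "x * y \<le> x\<^sup>2 + y\<^sup>2"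
proof -
  have "2 * (x * y) \<le> x\<^sup>2 + y\<^sup>2" using sum_squares_bound[of x y] by (simp only: mult.assoc)
  moreover have "0 \<le> x * y" using assms by simp
  ultimately show ?thesis by linarith
qed

lemma cmod_add_square_le: "(cmod (a + b))\<^sup>2 \<le> 2 * (cmod a)\<^sup>2 + 2 * (cmod b)\<^sup>2"
proof -
  have "(cmod (a + b))\<^sup>2 \<le> (cmod a + cmod b)\<^sup>2"
    by (intro power_mono norm_triangle_ineq) auto
  also have "\<dots> \<le> 2 * (cmod a)\<^sup>2 + 2 * (cmod b)\<^sup>2"
    using sum_squares_bound[of "cmod a" "cmod b"] by (simp add: power2_sum)
  finally show ?thesis .
qed

lemma integrable_mult_of_square:
  fixes f g :: "complex \<Rightarrow> 'a::{real_normed_algebra, banach, second_countable_topology}"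
  assumes [measurable]: "f \<in> borel_measurable borel" "g \<in> borel_measurable borel"
    and f: "integrable circle (\<lambda>\<zeta>. (norm (f \<zeta>))\<^sup>2)" and g: "integrable circle (\<lambda>\<zeta>. (norm (g \<zeta>))\<^sup>2)"
  shows "integrable circle (\<lambda>\<zeta>. f \<zeta> * g \<zeta>)"
proof (rule Bochner_Integration.integrable_bound)
  show "integrable circle (\<lambda>\<zeta>. (norm (f \<zeta>))\<^sup>2 + (norm (g \<zeta>))\<^sup>2)"
    using f g by simp
  show "AE \<zeta> in circle. norm (f \<zeta> * g \<zeta>) \<le> norm ((norm (f \<zeta>))\<^sup>2 + (norm (g \<zeta>))\<^sup>2)"
  proof (rule AE_I2)
    fix \<zeta>
    have "norm (f \<zeta> * g \<zeta>) \<le> norm (f \<zeta>) * norm (g \<zeta>)" by (rule norm_mult_ineq)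
    also have "\<dots> \<le> (norm (f \<zeta>))\<^sup>2 + (norm (g \<zeta>))\<^sup>2"
      by (rule mult_le_sum_squares) simp_all
    finally show "norm (f \<zeta> * g \<zeta>) \<le> norm ((norm (f \<zeta>))\<^sup>2 + (norm (g \<zeta>))\<^sup>2)" by simp
  qed
qed measurable

text \<open>
  Nonnegativity allows the integral of the product to be computed in \<open>ennreal\<close>, where the inequality
  is known.
\<close>

lemma Cauchy_Schwarz_circle:
  fixes f g :: "complex \<Rightarrow> real"
  assumes [measurable]: "f \<in> borel_measurable borel" "g \<in> borel_measurable borel"
    and f: "integrable circle (\<lambda>\<zeta>. (f \<zeta>)\<^sup>2)" and g: "integrable circle (\<lambda>\<zeta>. (g \<zeta>)\<^sup>2)"
    and nn: "\<And>\<zeta>. f \<zeta> \<ge> 0" "\<And>\<zeta>. g \<zeta> \<ge> 0"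
  shows "(\<integral>\<zeta>. f \<zeta> * g \<zeta> \<partial>circle)\<^sup>2 \<le> (\<integral>\<zeta>. (f \<zeta>)\<^sup>2 \<partial>circle) * (\<integral>\<zeta>. (g \<zeta>)\<^sup>2 \<partial>circle)"
proof -
  have fg: "integrable circle (\<lambda>\<zeta>. f \<zeta> * g \<zeta>)"
    using integrable_mult_of_square[of f g] f g by simp
  have "ennreal ((\<integral>\<zeta>. f \<zeta> * g \<zeta> \<partial>circle)\<^sup>2) = (\<integral>\<^sup>+\<zeta>. ennreal (f \<zeta>) * ennreal (g \<zeta>) \<partial>circle)\<^sup>2"
    using fg nn by (simp add: nn_integral_eq_integral ennreal_power flip: ennreal_mult)
  also have "\<dots> \<le> (\<integral>\<^sup>+\<zeta>. ennreal (f \<zeta>)^2 \<partial>circle) * (\<integral>\<^sup>+\<zeta>. ennreal (g \<zeta>)^2 \<partial>circle)"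
    by (rule Cauchy_Schwarz_nn_integral) simp_all
  also have "\<dots> = ennreal ((\<integral>\<zeta>. (f \<zeta>)\<^sup>2 \<partial>circle) * (\<integral>\<zeta>. (g \<zeta>)\<^sup>2 \<partial>circle))"
    using f g nn by (simp add: nn_integral_eq_integral ennreal_power ennreal_mult)
  finally show ?thesis
    by (subst (asm) ennreal_le_iff) (auto intro!: mult_nonneg_nonneg)
qed

lemma sq_integrable_integrable_inner:
  assumes "sq_integrable f" "sq_integrable g" shows "integrable circle (\<lambda>\<zeta>. f \<zeta> * cnj (g \<zeta>))"
proof -
  have [measurable]: "f \<in> borel_measurable borel" "g \<in> borel_measurable borel"
    using assms by (auto simp: sq_integrable_def)
  show ?thesis using assms by (intro integrable_mult_of_square) (auto simp: sq_integrable_def)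
qed

lemma L2_inner_Cauchy_Schwarz:
  assumes "sq_integrable f" "sq_integrable g"
  shows "(cmod (L2_inner f g))\<^sup>2 \<le> (\<integral>\<zeta>. (cmod (f \<zeta>))\<^sup>2 \<partial>circle) * (\<integral>\<zeta>. (cmod (g \<zeta>))\<^sup>2 \<partial>circle)"
proof -
  have [measurable]: "f \<in> borel_measurable borel" "g \<in> borel_measurable borel"
    using assms by (auto simp: sq_integrable_def)
  have "cmod (L2_inner f g) \<le> (\<integral>\<zeta>. cmod (f \<zeta>) * cmod (g \<zeta>) \<partial>circle)"
    unfolding L2_inner_def by (rule order_trans[OF integral_norm_bound]) (simp add: norm_mult)
  then have "(cmod (L2_inner f g))\<^sup>2 \<le> (\<integral>\<zeta>. cmod (f \<zeta>) * cmod (g \<zeta>) \<partial>circle)\<^sup>2"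
    by (intro power_mono) auto
  also have "\<dots> \<le> (\<integral>\<zeta>. (cmod (f \<zeta>))\<^sup>2 \<partial>circle) * (\<integral>\<zeta>. (cmod (g \<zeta>))\<^sup>2 \<partial>circle)"
    using assms by (intro Cauchy_Schwarz_circle) (auto simp: sq_integrable_def)
  finally show ?thesis .
qed

lemma sq_integrable_bounded:
  assumes [measurable]: "f \<in> borel_measurable borel" and "AE \<zeta> in circle. cmod (f \<zeta>) \<le> B"
  shows "sq_integrable f"
proof -
  have "AE \<zeta> in circle. norm ((cmod (f \<zeta>))\<^sup>2) \<le> B\<^sup>2"
    using assms(2) by eventually_elim (simp add: power_mono)
  then have "integrable circle (\<lambda>\<zeta>. (cmod (f \<zeta>))\<^sup>2)"
    by (rule circle.integrable_const_bound) measurable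
  then show ?thesis by (simp add: sq_integrable_def)
qed

lemma sq_integrable_add:
  assumes "sq_integrable f" "sq_integrable g" shows "sq_integrable (\<lambda>\<zeta>. f \<zeta> + g \<zeta>)"
proof -
  have [measurable]: "f \<in> borel_measurable borel" "g \<in> borel_measurable borel"
    using assms by (auto simp: sq_integrable_def)
  have "integrable circle (\<lambda>\<zeta>. (cmod (f \<zeta> + g \<zeta>))\<^sup>2)"
  proof (rule Bochner_Integration.integrable_bound)
    show "integrable circle (\<lambda>\<zeta>. 2 * (cmod (f \<zeta>))\<^sup>2 + 2 * (cmod (g \<zeta>))\<^sup>2)"
      using assms by (simp add: sq_integrable_def)
    show "AE \<zeta> in circle. norm ((cmod (f \<zeta> + g \<zeta>))\<^sup>2)
        \<le> norm (2 * (cmod (f \<zeta>))\<^sup>2 + 2 * (cmod (g \<zeta>))\<^sup>2)"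
      using cmod_add_square_le by (intro AE_I2) auto
  qed measurable
  then show ?thesis by (simp add: sq_integrable_def)
qed

lemma sq_integrable_integrable_cnj:
  assumes "sq_integrable g" shows "integrable circle (\<lambda>\<zeta>. cnj (g \<zeta>))"
proof -
  have "sq_integrable (\<lambda>_. 1)" by (rule sq_integrable_bounded[where B=1]) auto
  from sq_integrable_integrable_inner[OF this assms] show ?thesis by simp
qed

lemma sq_integrable_cmult:
  assumes "sq_integrable f" shows "sq_integrable (\<lambda>\<zeta>. c * f \<zeta>)"
proof -
  have [measurable]: "f \<in> borel_measurable borel"
    using assms by (auto simp: sq_integrable_def)
  show ?thesis using assms by (auto simp: sq_integrable_def norm_mult power_mult_distrib)
qed

lemma sq_integrable_diff: "sq_integrable f \<Longrightarrow> sq_integrable g \<Longrightarrow> sq_integrable (\<lambda>\<zeta>. f \<zeta> - g \<zeta>)"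
  using sq_integrable_add[of f "\<lambda>\<zeta>. - 1 * g \<zeta>"] sq_integrable_cmult[of g "-1"] by simp

lemma sq_integrable_mult_bounded:
  assumes "sq_integrable f" and [measurable]: "b \<in> borel_measurable borel"
    and b: "AE \<zeta> in circle. cmod (b \<zeta>) \<le> B"
  shows "sq_integrable (\<lambda>\<zeta>. b \<zeta> * f \<zeta>)"
proof -
  have [measurable]: "f \<in> borel_measurable borel"
    using assms by (auto simp: sq_integrable_def)
  have "integrable circle (\<lambda>\<zeta>. (cmod (b \<zeta> * f \<zeta>))\<^sup>2)"
  proof (rule Bochner_Integration.integrable_bound)
    show "integrable circle (\<lambda>\<zeta>. B\<^sup>2 * (cmod (f \<zeta>))\<^sup>2)"
      using assms by (simp add: sq_integrable_def)
    show "AE \<zeta> in circle. norm ((cmod (b \<zeta> * f \<zeta>))\<^sup>2) \<le> norm (B\<^sup>2 * (cmod (f \<zeta>))\<^sup>2)"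
      using b by eventually_elim
         (simp add: norm_mult power_mult_distrib mult_right_mono power_mono)
  qed measurable
  then show ?thesis by (simp add: sq_integrable_def)
qed

section \<open>Absolutely convergent power series on the circle\<close>

definition abs_series :: "(nat \<Rightarrow> complex) \<Rightarrow> complex \<Rightarrow> complex" where
  "abs_series c \<zeta> = (\<Sum>n. c n * \<zeta> ^ n)"

lemma abs_series_sums:
  assumes "summable (\<lambda>n. cmod (c n))" "cmod \<zeta> \<le> 1"
  shows "(\<lambda>n. c n * \<zeta> ^ n) sums abs_series c \<zeta>" "summable (\<lambda>n. cmod (c n * \<zeta> ^ n))"
    "cmod (abs_series c \<zeta>) \<le> (\<Sum>n. cmod (c n))"
proof -
  have b: "cmod (c n * \<zeta> ^ n) \<le> cmod (c n)" for n
    using assms(2) by (simp add: norm_mult norm_power mult_left_le power_le_one)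
  show s: "summable (\<lambda>n. cmod (c n * \<zeta> ^ n))"
    by (rule summable_comparison_test'[OF assms(1), of 0]) (use b in simp)
  then show "(\<lambda>n. c n * \<zeta> ^ n) sums abs_series c \<zeta>"
    unfolding abs_series_def by (rule summable_sums[OF summable_norm_cancel])
  show "cmod (abs_series c \<zeta>) \<le> (\<Sum>n. cmod (c n))"
    unfolding abs_series_def
    using summable_norm[OF s] suminf_le[OF b s assms(1)] by linarith
qed

lemma abs_series_borel [measurable]: "abs_series c \<in> borel_measurable borel"
  unfolding abs_series_def by measurable

text \<open>
  Absolute convergence is uniform on the circle, so the integral against any integrable function can
  be taken termwise.  Parseval's identity and the Poisson formula below both come from here.
\<close>

lemma integral_abs_series:
  assumes c: "summable (\<lambda>n. cmod (c n))" and g: "integrable circle g"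
  shows "(\<lambda>n. c n * (\<integral>\<zeta>. \<zeta> ^ n * g \<zeta> \<partial>circle)) sums (\<integral>\<zeta>. abs_series c \<zeta> * g \<zeta> \<partial>circle)"
proof -
  have [measurable]: "g \<in> borel_measurable borel" using g by (auto dest: borel_measurable_integrable)
  have gi: "integrable circle (\<lambda>\<zeta>. \<zeta> ^ n * g \<zeta>)" for n
    by (rule Bochner_Integration.integrable_bound[OF g])
       (use AE_circle_norm in \<open>auto simp: norm_mult norm_power elim!: eventually_mono\<close>)
  have int: "integrable circle (\<lambda>\<zeta>. c n * \<zeta> ^ n * g \<zeta>)" for n
    using integrable_mult_right[OF gi, of "c n"] by (simp add: mult.assoc)
  have 1: "AE \<zeta> in circle. summable (\<lambda>n. norm (c n * \<zeta> ^ n * g \<zeta>))"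
    using AE_circle_norm
  proof eventually_elim
    case (elim \<zeta>)
    then show ?case
      using summable_mult2[OF abs_series_sums(2)[OF c], of \<zeta> "norm (g \<zeta>)"] by (simp add: norm_mult)
  qed
  have eq: "(\<integral>\<zeta>. norm (c n * \<zeta> ^ n * g \<zeta>) \<partial>circle) = cmod (c n) * (\<integral>\<zeta>. norm (g \<zeta>) \<partial>circle)" for n
  proof -
    have "(\<integral>\<zeta>. norm (c n * \<zeta> ^ n * g \<zeta>) \<partial>circle) = (\<integral>\<zeta>. cmod (c n) * norm (g \<zeta>) \<partial>circle)"
      by (intro integral_cong_AE)
         (use AE_circle_norm in \<open>auto simp: norm_mult norm_power elim!: eventually_mono\<close>)
    then show ?thesis by simp
  qed
  have 2: "summable (\<lambda>n. \<integral>\<zeta>. norm (c n * \<zeta> ^ n * g \<zeta>) \<partial>circle)"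
    unfolding eq by (intro summable_mult2 c)
  have "(\<lambda>n. \<integral>\<zeta>. c n * \<zeta> ^ n * g \<zeta> \<partial>circle) sums (\<integral>\<zeta>. (\<Sum>n. c n * \<zeta> ^ n * g \<zeta>) \<partial>circle)"
    by (intro sums_integral int 1 2)
  also have "(\<lambda>n. \<integral>\<zeta>. c n * \<zeta> ^ n * g \<zeta> \<partial>circle) = (\<lambda>n. c n * (\<integral>\<zeta>. \<zeta> ^ n * g \<zeta> \<partial>circle))"
    by (simp add: mult.assoc)
  also have "(\<integral>\<zeta>. (\<Sum>n. c n * \<zeta> ^ n * g \<zeta>) \<partial>circle) = (\<integral>\<zeta>. abs_series c \<zeta> * g \<zeta> \<partial>circle)"
  proof (rule integral_cong_AE)
    show "AE \<zeta> in circle. (\<Sum>n. c n * \<zeta> ^ n * g \<zeta>) = abs_series c \<zeta> * g \<zeta>"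
      using AE_circle_norm
    proof eventually_elim
      case (elim \<zeta>)
      then show ?case
        using sums_mult2[OF abs_series_sums(1)[OF c], of \<zeta> "g \<zeta>"] by (simp add: sums_iff)
    qed
  qed measurable
  finally show ?thesis .
qed

lemma AE_abs_series_bound:
  assumes c: "summable (\<lambda>n. cmod (c n))"
  shows "AE \<zeta> in circle. cmod (abs_series c \<zeta>) \<le> (\<Sum>n. cmod (c n))"
  using AE_circle_norm by eventually_elim (rule abs_series_sums(3)[OF c], simp)

lemma sq_integrable_abs_series:
  assumes c: "summable (\<lambda>n. cmod (c n))"
  shows "sq_integrable (abs_series c)"
  by (rule sq_integrable_bounded[OF _ AE_abs_series_bound[OF c]]) measurable

lemma abs_series_coeff:
  assumes c: "summable (\<lambda>n. cmod (c n))"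
  shows "(\<integral>\<zeta>. abs_series c \<zeta> * cnj (\<zeta> ^ m) \<partial>circle) = c m"
proof -
  have "AE \<zeta> in circle. cmod (cnj (\<zeta> ^ m)) \<le> 1"
    using AE_circle_norm by eventually_elim (simp add: norm_power)
  then have "integrable circle (\<lambda>\<zeta>. cnj (\<zeta> ^ m))"
    by (rule circle.integrable_const_bound) measurable
  from integral_abs_series[OF c this]
  have "(\<lambda>n. c n * (if n = m then 1 else 0)) sums (\<integral>\<zeta>. abs_series c \<zeta> * cnj (\<zeta> ^ m) \<partial>circle)"
    unfolding integral_powers .
  moreover have "(\<lambda>n. c n * (if n = m then 1 else 0)) = (\<lambda>n. if n = m then c n else 0)"
    by (simp add: fun_eq_iff)
  ultimately show ?thesis
    using sums_unique2[OF sums_single[of m c]] by simp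
qed

lemma L2_inner_commute: "L2_inner g f = cnj (L2_inner f g)"
proof -
  have "cnj (L2_inner f g) = (\<integral>\<zeta>. cnj (f \<zeta> * cnj (g \<zeta>)) \<partial>circle)"
    unfolding L2_inner_def by (rule Bochner_Integration.integral_cnj[symmetric])
  also have "(\<lambda>\<zeta>. cnj (f \<zeta> * cnj (g \<zeta>))) = (\<lambda>\<zeta>. g \<zeta> * cnj (f \<zeta>))"
    by (simp add: fun_eq_iff)
  finally show ?thesis
    unfolding L2_inner_def by (rule sym)
qed

lemma L2_inner_abs_series:
  assumes c: "summable (\<lambda>n. cmod (c n))" and d: "summable (\<lambda>n. cmod (d n))"
  shows "(\<lambda>n. c n * cnj (d n)) sums L2_inner (abs_series c) (abs_series d)"
proof -
  have "AE \<zeta> in circle. cmod (cnj (abs_series d \<zeta>)) \<le> (\<Sum>n. cmod (d n))"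
    using AE_abs_series_bound[OF d] by simp
  then have i: "integrable circle (\<lambda>\<zeta>. cnj (abs_series d \<zeta>))"
    by (rule circle.integrable_const_bound) measurable
  have "(\<integral>\<zeta>. \<zeta> ^ n * cnj (abs_series d \<zeta>) \<partial>circle) = cnj (d n)" for n
  proof -
    have "(\<lambda>\<zeta>. \<zeta> ^ n * cnj (abs_series d \<zeta>)) = (\<lambda>\<zeta>. cnj (abs_series d \<zeta> * cnj (\<zeta> ^ n)))"
      by (simp add: fun_eq_iff)
    then show ?thesis
      by (simp only: Bochner_Integration.integral_cnj abs_series_coeff[OF d])
  qed
  then show ?thesis
    using integral_abs_series[OF c i] by (simp add: L2_inner_def)
qed

section \<open>The Poisson kernel\<close>

text \<open>
  Setting the kernel to \<open>0\<close> off the unit circle makes it bounded on the whole plane when \<open>r\<close> stays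
  away from \<open>1\<close>, so that Fubini's theorem applies below without exceptional null sets.
\<close>

definition poisson :: "real \<Rightarrow> complex \<Rightarrow> real" where
  "poisson r w = (if cmod w = 1 then (1 - r\<^sup>2) / (cmod (1 - of_real r * w))\<^sup>2 else 0)"

lemma poisson_measurable [measurable (raw)]:
  assumes [measurable]: "f \<in> borel_measurable M" "g \<in> borel_measurable M"
  shows "(\<lambda>x. poisson (f x) (g x)) \<in> borel_measurable M"
  unfolding poisson_def by measurable

lemma poisson_denom:
  assumes "0 \<le> r" "r < 1" "cmod w = 1"
  shows "1 - r \<le> cmod (1 - of_real r * w)" "1 - of_real r * w \<noteq> 0"
proof -
  have "1 - r = cmod 1 - cmod (of_real r * w)" using assms by (simp add: norm_mult)
  also have "\<dots> \<le> cmod (1 - of_real r * w)" by (rule norm_triangle_ineq2)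
  finally show "1 - r \<le> cmod (1 - of_real r * w)" .
  then show "1 - of_real r * w \<noteq> 0" using assms by auto
qed

lemma poisson_nonneg: "0 \<le> r \<Longrightarrow> r < 1 \<Longrightarrow> 0 \<le> poisson r w"
  by (simp add: poisson_def power_le_one)

lemma poisson_le:
  assumes "0 \<le> r" "r \<le> \<rho>" "\<rho> < 1"
  shows "\<bar>poisson r w\<bar> \<le> 1 / (1 - \<rho>)\<^sup>2"
proof (cases "cmod w = 1")
  case True
  have "(1 - \<rho>)\<^sup>2 \<le> (cmod (1 - of_real r * w))\<^sup>2"
    using poisson_denom(1)[of r w] assms True by (intro power_mono) auto
  then have "(1 - r\<^sup>2) / (cmod (1 - of_real r * w))\<^sup>2 \<le> 1 / (1 - \<rho>)\<^sup>2"
    using assms by (intro frac_le) auto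
  then show ?thesis
    using True poisson_nonneg[of r w] assms by (simp add: poisson_def)
qed (simp add: poisson_def)

lemma poisson_cnj: "poisson r (cnj w) = poisson r w"
proof -
  have "cmod (1 - of_real r * cnj w) = cmod (cnj (1 - of_real r * w))" by simp
  also have "\<dots> = cmod (1 - of_real r * w)" by (rule complex_mod_cnj)
  finally show ?thesis by (simp add: poisson_def)
qed

text \<open>
  The kernel is twice the real part of the geometric series in \<open>r w\<close>, less one: the form in which it
  can be integrated against power series.
\<close>

lemma poisson_conv_Re:
  assumes "0 \<le> r" "r < 1" "cmod w = 1"
  shows "poisson r w = 2 * Re (1 / (1 - of_real r * w)) - 1"
proof -
  let ?z = "1 - of_real r * w"
  have nz: "(cmod ?z)\<^sup>2 \<noteq> 0" using poisson_denom[OF assms] by simp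
  have w: "(Re w)\<^sup>2 + (Im w)\<^sup>2 = 1" using assms(3) by (simp add: cmod_power2[symmetric])
  have "(cmod ?z)\<^sup>2 = (1 - r * Re w)\<^sup>2 + (r * Im w)\<^sup>2" by (simp add: cmod_power2)
  also have "\<dots> = 1 - 2 * r * Re w + r\<^sup>2 * ((Re w)\<^sup>2 + (Im w)\<^sup>2)"
    by (simp add: power2_eq_square algebra_simps)
  finally have e: "(cmod ?z)\<^sup>2 = 1 - 2 * r * Re w + r\<^sup>2" by (simp add: w)
  have "Re (1 / ?z) = Re ?z / (cmod ?z)\<^sup>2" by (simp add: Re_divide cmod_power2)
  then have "2 * Re (1 / ?z) - 1 = (2 * Re ?z - (cmod ?z)\<^sup>2) / (cmod ?z)\<^sup>2"
    using nz by (simp add: diff_divide_distrib)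
  also have "2 * Re ?z - (cmod ?z)\<^sup>2 = 1 - r\<^sup>2" by (simp add: e)
  finally show ?thesis using assms by (simp add: poisson_def)
qed

text \<open>
  For \<open>s \<le> r\<close> the distances of \<open>r s\<close> and of \<open>s\<close> from \<open>1\<close> are comparable, as
  \<open>1 - s \<le> 1 - r s \<le> 2 (1 - s)\<close>.  This compares both numerators and denominators, with a factor
  \<open>4\<close> each.
\<close>

lemma poisson_mult_le_of_le:
  assumes "0 \<le> s" "s \<le> r" "r < 1"
  shows "poisson (r * s) w \<le> 16 * poisson s w"
proof (cases "cmod w = 1")
  case True
  have rs: "0 \<le> r * s" "r * s \<le> s" "r * s < 1"
    using assms mult_right_mono[of r 1 s] by auto
  let ?u = "cmod (1 - of_real s * w)" and ?v = "cmod (1 - of_real (r * s) * w)"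
  have u: "?u > 0" using poisson_denom(2)[of s w] assms True by simp
  have v: "?v \<ge> 1 - r * s" "?v > 0" using poisson_denom[of "r * s" w] rs True by auto
  have "1 - of_real s * w = (1 - of_real (r * s) * w) - of_real (s * (1 - r)) * w"
    by (simp add: algebra_simps)
  then have "?u \<le> ?v + cmod (of_real (s * (1 - r)) * w)"
    by (metis norm_triangle_ineq4)
  also have "cmod (of_real (s * (1 - r)) * w) = s * (1 - r)"
    using assms True by (simp only: norm_mult norm_of_real) (simp add: abs_mult)
  also have "s * (1 - r) \<le> 1 - r * s" using assms by (simp add: algebra_simps)
  finally have uv: "?u \<le> 2 * ?v" using v by linarith
  then have "?u\<^sup>2 \<le> (2 * ?v)\<^sup>2" using u by (intro power_mono) auto
  then have uv2: "?u\<^sup>2 \<le> 4 * ?v\<^sup>2" by (simp add: power_mult_distrib)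
  have "1 - (r * s)\<^sup>2 = (1 - r * s) * (1 + r * s)" by (simp add: power2_eq_square algebra_simps)
  also have "\<dots> \<le> (1 - r * s) * 2" using rs by (intro mult_left_mono) auto
  also have "1 - r * s \<le> (1 - r) + (1 - s)"
    using mult_nonneg_nonneg[of "1 - r" "1 - s"] assms by (simp add: algebra_simps)
  also have "\<dots> \<le> 2 * (1 - s)" using assms by simp
  also have "1 - s \<le> 1 - s\<^sup>2"
    using mult_right_mono[of s 1 s] assms by (simp add: power2_eq_square)
  finally have n: "1 - (r * s)\<^sup>2 \<le> 4 * (1 - s\<^sup>2)" by simp
  have s2: "0 \<le> 1 - s\<^sup>2" using assms by (simp add: power_le_one)
  have "(1 - (r * s)\<^sup>2) / ?v\<^sup>2 \<le> 4 * (1 - s\<^sup>2) / (?u\<^sup>2 / 4)"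
    using n uv2 u s2 by (intro frac_le) auto
  then show ?thesis using True by (simp add: poisson_def)
qed (simp add: poisson_def)

text \<open>
  The pointwise inequality behind the maximal theorem: it lets the composed kernel be dominated by
  the kernels that are composed.
\<close>

lemma poisson_mult_le:
  assumes "0 \<le> s" "s < 1" "0 \<le> r" "r < 1"
  shows "poisson (r * s) w \<le> 16 * (poisson r w + poisson s w)"
proof (cases "s \<le> r")
  case True
  then show ?thesis
    using poisson_mult_le_of_le[of s r w] poisson_nonneg[of r w] assms by simp
next
  case False
  then show ?thesis
    using poisson_mult_le_of_le[of r s w] poisson_nonneg[of s w] assms by (simp add: mult.commute)
qed

lemma summable_cmod_geometric: "cmod q < 1 \<Longrightarrow> summable (\<lambda>n. cmod (q ^ n))"
  by (simp add: norm_power)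

lemma abs_series_geometric:
  assumes "cmod q < 1" "cmod \<zeta> \<le> 1"
  shows "abs_series (\<lambda>n. q ^ n) \<zeta> = 1 / (1 - q * \<zeta>)"
proof -
  have "cmod (q * \<zeta>) < 1"
    using assms mult_left_mono[of "cmod \<zeta>" 1 "cmod q"] by (simp add: norm_mult)
  then have "(\<lambda>n. (q * \<zeta>) ^ n) sums (1 / (1 - q * \<zeta>))" by (rule geometric_sums)
  then show "abs_series (\<lambda>n. q ^ n) \<zeta> = 1 / (1 - q * \<zeta>)"
    by (simp add: abs_series_def sums_iff power_mult_distrib)
qed

lemma integral_abs_series_mult:
  assumes c: "summable (\<lambda>n. cmod (c n))" and d: "summable (\<lambda>n. cmod (d n))"
  shows "(\<integral>\<zeta>. abs_series c \<zeta> * abs_series d \<zeta> \<partial>circle) = c 0 * d 0"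
proof -
  have id: "integrable circle (abs_series d)"
    by (rule circle.integrable_const_bound[OF AE_abs_series_bound[OF d]]) measurable
  have pw: "(\<integral>\<zeta>. \<zeta> ^ n * abs_series d \<zeta> \<partial>circle) = (if n = 0 then d 0 else 0)" for n
  proof -
    have "AE \<zeta> in circle. cmod (\<zeta> ^ n) \<le> 1"
      using AE_circle_norm by eventually_elim (simp add: norm_power)
    then have "integrable circle (\<lambda>\<zeta>. \<zeta> ^ n)"
      by (rule circle.integrable_const_bound) measurable
    from integral_abs_series[OF d this]
    have "(\<lambda>m. d m * (\<integral>\<zeta>. \<zeta> ^ m * \<zeta> ^ n \<partial>circle)) sums (\<integral>\<zeta>. \<zeta> ^ n * abs_series d \<zeta> \<partial>circle)"
      by (simp only: mult.commute[of "abs_series d _"])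
    moreover have "(\<integral>\<zeta>. \<zeta> ^ m * \<zeta> ^ n \<partial>circle) = (if m + n = 0 then 1 else 0)" for m
      using integral_powers[of "m + n" 0] by (simp add: power_add)
    moreover have "(\<lambda>m. d m * (if m + n = 0 then 1 else 0)) = (\<lambda>m. if m = 0 then (if n
        = 0 then d m else 0) else 0)"
      by (auto simp: fun_eq_iff)
    ultimately show ?thesis
      using sums_unique2[OF sums_single[of 0 "\<lambda>m. if n = 0 then d m else 0"]] by simp
  qed
  from integral_abs_series[OF c id]
  have "(\<lambda>n. c n * (if n = 0 then d 0 else 0)) sums (\<integral>\<zeta>. abs_series c \<zeta> * abs_series d \<zeta> \<partial>circle)"
    by (simp only: pw)
  moreover have "(\<lambda>n. c n * (if n = 0 then d 0 else 0)) = (\<lambda>n. if n = 0 then c n * d 0 else 0)"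
    by (auto simp: fun_eq_iff)
  ultimately show ?thesis
    using sums_unique2[OF sums_single[of 0 "\<lambda>m. c m * d 0"]] by simp
qed

text \<open>
  As a function of \<open>\<eta>\<close> the kernel is \<open>cnj G + G - 1\<close> with \<open>G\<close> the geometric series in
  \<open>r cnj \<zeta> \<eta>\<close>.  The first summand reproduces the series at \<open>r \<zeta>\<close> by Parseval; the other two
  contribute the constant coefficient with opposite signs.
\<close>

lemma poisson_reproducing:
  assumes c: "summable (\<lambda>n. cmod (c n))" and r: "0 \<le> r" "r < 1" and z: "cmod \<zeta> = 1"
  shows "(\<integral>\<eta>. abs_series c \<eta> * of_real (poisson r (\<zeta> * cnj \<eta>)) \<partial>circle)
    = abs_series (\<lambda>n. c n * of_real r ^ n) \<zeta>"
proof -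
  define q where "q = of_real r * cnj \<zeta>"
  have q: "cmod q < 1" using r z by (simp add: q_def norm_mult)
  note g = summable_cmod_geometric[OF q] abs_series_geometric[OF q]
  let ?G = "abs_series (\<lambda>n. q ^ n)"
  have sq: "sq_integrable (abs_series c)" "sq_integrable ?G"
    using c g(1) by (auto intro!: sq_integrable_abs_series)
  have ic: "integrable circle (abs_series c)"
    by (rule circle.integrable_const_bound[OF AE_abs_series_bound[OF c]]) measurable
  have i1: "integrable circle (\<lambda>\<eta>. abs_series c \<eta> * cnj (?G \<eta>))"
    by (rule sq_integrable_integrable_inner[OF sq])
  have i2: "integrable circle (\<lambda>\<eta>. abs_series c \<eta> * ?G \<eta>)"
    using sq by (intro integrable_mult_of_square) (auto simp: sq_integrable_def)
  have "(\<integral>\<eta>. abs_series c \<eta> * of_real (poisson r (\<zeta> * cnj \<eta>)) \<partial>circle)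
     = (\<integral>\<eta>. abs_series c \<eta> * cnj (?G \<eta>) + abs_series c \<eta> * ?G \<eta> - abs_series c \<eta> \<partial>circle)"
  proof (rule integral_cong_AE)
    show "AE \<eta> in circle. abs_series c \<eta> * of_real (poisson r (\<zeta> * cnj \<eta>))
      = abs_series c \<eta> * cnj (?G \<eta>) + abs_series c \<eta> * ?G \<eta> - abs_series c \<eta>"
      using AE_circle_norm
    proof eventually_elim
      case (elim \<eta>)
      have "complex_of_real (poisson r (\<zeta> * cnj \<eta>)) = cnj (?G \<eta>) + ?G \<eta> - 1"
      proof -
        have "cnj (?G \<eta>) = 1 / (1 - of_real r * (\<zeta> * cnj \<eta>))"
          using elim by (simp add: g(2)) (simp add: q_def mult_ac)
        moreover have "poisson r (\<zeta> * cnj \<eta>) = 2 * Re (1 / (1 - of_real r * (\<zeta> * cnj \<eta>))) - 1"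
          using z elim by (intro poisson_conv_Re r) (simp add: norm_mult)
        ultimately show ?thesis by (simp add: complex_eq_iff)
      qed
      then show ?case by (simp only: ring_distribs) simp
    qed
  qed measurable
  also have "\<dots> = (\<integral>\<eta>. abs_series c \<eta> * cnj (?G \<eta>) \<partial>circle)
      + (\<integral>\<eta>. abs_series c \<eta> * ?G \<eta> \<partial>circle) - (\<integral>\<eta>. abs_series c \<eta> \<partial>circle)"
    using i1 i2 ic by simp
  also have "(\<integral>\<eta>. abs_series c \<eta> * ?G \<eta> \<partial>circle) = c 0"
    using integral_abs_series_mult[OF c g(1)] by simp
  also have "(\<integral>\<eta>. abs_series c \<eta> \<partial>circle) = c 0"
    using abs_series_coeff[OF c, of 0] by simp
  also have "(\<integral>\<eta>. abs_series c \<eta> * cnj (?G \<eta>) \<partial>circle) = abs_series (\<lambda>n. c n * of_real r ^ n) \<zeta>"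
    using L2_inner_abs_series[OF c g(1)]
    by (simp add: L2_inner_def sums_iff abs_series_def q_def power_mult_distrib mult.assoc)
  finally show ?thesis by simp
qed

text \<open>
  The second factor is, up to real part and constants, the power series \<open>1 / (1 - s cnj \<eta> \<omega>)\<close> in
  \<open>\<omega>\<close>, which the first factor reproduces at \<open>r \<zeta>\<close>.
\<close>

lemma poisson_semigroup:
  assumes r: "0 \<le> r" "r < 1" and s: "0 \<le> s" "s < 1" and z: "cmod \<zeta> = 1" "cmod \<eta> = 1"
  shows "(\<integral>\<omega>. poisson r (\<zeta> * cnj \<omega>) * poisson s (\<omega> * cnj \<eta>) \<partial>circle) = poisson (r * s) (\<zeta> * cnj \<eta>)"
proof -
  define q where "q = of_real s * cnj \<eta>"
  have q: "cmod q < 1" using s z by (simp add: q_def norm_mult)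
  have rs: "0 \<le> r * s" "r * s < 1" using r s mult_left_le[of s r] by auto
  have rq: "cmod (of_real r * q) < 1" using rs z by (simp add: q_def norm_mult abs_mult)
  note g = summable_cmod_geometric[OF q] abs_series_geometric[OF q]
  let ?G = "abs_series (\<lambda>n. q ^ n)"
  have P: "AE \<omega> in circle. norm (poisson r (\<zeta> * cnj \<omega>)) \<le> 1 / (1 - r)\<^sup>2"
    using poisson_le[of r r] r by simp
  have iP: "integrable circle (\<lambda>\<omega>. poisson r (\<zeta> * cnj \<omega>))"
    by (rule circle.integrable_const_bound[OF P]) measurable
  have 1: "(\<integral>\<omega>. ?G \<omega> * of_real (poisson r (\<zeta> * cnj \<omega>)) \<partial>circle)
      = 1 / (1 - of_real (r * s) * (\<zeta> * cnj \<eta>))"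
    using poisson_reproducing[OF g(1) r z(1)] abs_series_geometric[OF rq, of \<zeta>] z
    by (simp add: power_mult_distrib mult_ac q_def)
  have sG: "summable (\<lambda>n. cmod ((\<lambda>n. if n = 0 then 1 else 0 :: complex) n))"
    by (rule summable_finite[of "{0}"]) auto
  have 2: "(\<integral>\<omega>. complex_of_real (poisson r (\<zeta> * cnj \<omega>)) \<partial>circle) = 1"
  proof -
    have a: "abs_series (\<lambda>n. if n = 0 then b else 0) x = b" for b x
    proof -
      have "(\<lambda>n. (if n = 0 then b else 0) * x ^ n) = (\<lambda>n. if n = 0 then b * x ^ n else 0)" by auto
      then show ?thesis
        using sums_single[of 0 "\<lambda>n. b * x ^ n"] by (simp add: abs_series_def sums_iff)
    qed
    have "(\<lambda>n. (if n = 0 then 1 else 0) * complex_of_real r ^ n) = (\<lambda>n. if n = 0 then 1 else 0)"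
      by auto
    then show ?thesis using poisson_reproducing[OF sG r z(1)] by (simp add: a)
  qed
  have iGP: "integrable circle (\<lambda>\<omega>. ?G \<omega> * of_real (poisson r (\<zeta> * cnj \<omega>)))"
  proof (rule circle.integrable_const_bound)
    show "AE \<omega> in circle. norm (?G \<omega> * of_real (poisson r (\<zeta> * cnj \<omega>)))
        \<le> (\<Sum>n. cmod (q ^ n)) * (1 / (1 - r)\<^sup>2)"
      using P AE_abs_series_bound[OF g(1)]
    proof eventually_elim
      case (elim \<omega>)
      have "norm (?G \<omega> * of_real (poisson r (\<zeta> * cnj \<omega>))) = cmod (?G \<omega>) * \<bar>poisson r (\<zeta> * cnj \<omega>)\<bar>"
        by (simp add: norm_mult)
      also have "\<dots> \<le> (\<Sum>n. cmod (q ^ n)) * (1 / (1 - r)\<^sup>2)"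
        using elim order_trans[OF norm_ge_zero elim(2)] by (intro mult_mono) auto
      finally show ?case .
    qed
  qed measurable
  have "(\<integral>\<omega>. poisson r (\<zeta> * cnj \<omega>) * poisson s (\<omega> * cnj \<eta>) \<partial>circle)
    = (\<integral>\<omega>. 2 * Re (?G \<omega> * of_real (poisson r (\<zeta> * cnj \<omega>))) - poisson r (\<zeta> * cnj \<omega>) \<partial>circle)"
  proof (rule integral_cong_AE)
    show "AE \<omega> in circle. poisson r (\<zeta> * cnj \<omega>) * poisson s (\<omega> * cnj \<eta>)
       = 2 * Re (?G \<omega> * of_real (poisson r (\<zeta> * cnj \<omega>))) - poisson r (\<zeta> * cnj \<omega>)"
      using AE_circle_norm
    proof eventually_elim
      case (elim \<omega>)
      have "poisson s (\<omega> * cnj \<eta>) = 2 * Re (1 / (1 - of_real s * (\<omega> * cnj \<eta>))) - 1"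
        using z elim by (intro poisson_conv_Re s) (simp add: norm_mult)
      also have "1 / (1 - of_real s * (\<omega> * cnj \<eta>)) = ?G \<omega>"
        using elim by (simp add: g(2)) (simp add: q_def mult_ac)
      finally have "poisson s (\<omega> * cnj \<eta>) = 2 * Re (?G \<omega>) - 1" .
      then show ?case by (simp add: right_diff_distrib)
    qed
  qed measurable
  also have "\<dots> = 2 * Re (\<integral>\<omega>. ?G \<omega> * of_real (poisson r (\<zeta> * cnj \<omega>)) \<partial>circle)
      - (\<integral>\<omega>. poisson r (\<zeta> * cnj \<omega>) \<partial>circle)"
    by (simp only: Bochner_Integration.integral_diff[OF integrable_mult_right[OF integrable_Re[OF iGP]] iP]
        integral_mult_right_zero integral_Re[OF iGP])
  also have "(\<integral>\<omega>. poisson r (\<zeta> * cnj \<omega>) \<partial>circle) = 1"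
    using 2 by (simp only: integral_complex_of_real of_real_eq_1_iff)
  also have "2 * Re (\<integral>\<omega>. ?G \<omega> * of_real (poisson r (\<zeta> * cnj \<omega>)) \<partial>circle) - 1
      = poisson (r * s) (\<zeta> * cnj \<eta>)"
    unfolding 1 using z rs by (intro poisson_conv_Re[symmetric]) (auto simp: norm_mult)
  finally show ?thesis .
qed

section \<open>An \<open>L\<^sup>2\<close> bound uniform in the choice of radii\<close>

lemma bounded_Fubini_circle:
  fixes F :: "complex \<Rightarrow> complex \<Rightarrow> real"
  assumes [measurable]: "case_prod F \<in> borel_measurable (borel \<Otimes>\<^sub>M borel)"
    and B: "\<And>x y. \<bar>F x y\<bar> \<le> B"
  shows "(\<integral>y. (\<integral>x. F x y \<partial>circle) \<partial>circle) = (\<integral>x. (\<integral>y. F x y \<partial>circle) \<partial>circle)"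
proof (rule circle2.Fubini_integral)
  interpret f: finite_measure "circle \<Otimes>\<^sub>M circle"
    by (rule finite_measure_pair_measure) unfold_locales
  show "integrable (circle \<Otimes>\<^sub>M circle) (case_prod F)"
    by (rule f.integrable_const_bound[where B=B]) (auto simp: B)
qed

lemma bounded_integrable_circle:
  fixes f :: "complex \<Rightarrow> real"
  assumes "f \<in> borel_measurable borel" "\<And>x. \<bar>f x\<bar> \<le> B"
  shows "integrable circle f"
  by (rule circle.integrable_const_bound[where B=B]) (use assms in auto)

lemma bounded_integrable_circle_square:
  fixes f :: "complex \<Rightarrow> real"
  assumes [measurable]: "f \<in> borel_measurable borel" and B: "\<And>x. \<bar>f x\<bar> \<le> B"
  shows "integrable circle (\<lambda>x. (f x)\<^sup>2)"
proof (rule bounded_integrable_circle)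
  show "\<bar>(f x)\<^sup>2\<bar> \<le> B\<^sup>2" for x
    using power_mono[OF B[of x], of 2] by simp
qed measurable

lemma bounded_integral_circle:
  fixes f :: "complex \<Rightarrow> real"
  assumes "f \<in> borel_measurable borel" "\<And>x. \<bar>f x\<bar> \<le> B"
  shows "\<bar>\<integral>x. f x \<partial>circle\<bar> \<le> B"
proof -
  have "\<bar>\<integral>x. f x \<partial>circle\<bar> \<le> (\<integral>x. \<bar>f x\<bar> \<partial>circle)" by (rule integral_abs_bound)
  also have "\<dots> \<le> (\<integral>x. B \<partial>circle)"
  proof (rule integral_mono)
    show "integrable circle (\<lambda>x. \<bar>f x\<bar>)"
      by (intro integrable_abs bounded_integrable_circle[OF assms])
  qed (use assms in auto)
  finally show ?thesis by simp
qed

text \<open>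
  Used with \<open>a\<close> an integral that is known to be finite: cancelling one factor \<open>a\<close> turns a
  self-referential estimate into a bound.
\<close>

lemma cancel_square_le:
  fixes a b :: real
  assumes "0 \<le> a" "0 \<le> b" "0 \<le> C" "a\<^sup>2 \<le> C * (b * a)"
  shows "a \<le> C * b"
proof (cases "a = 0")
  case False
  have "a * a \<le> (C * b) * a" using assms(4) by (simp add: power2_eq_square mult.assoc)
  then show ?thesis using False assms(1) by (simp add: mult_le_cancel_right)
qed (use assms in simp)

text \<open>
  Fix a measurable choice \<open>r(x)\<close> of a radius for each point.  The bound \<open>\<rho> < 1\<close> only ensures that all
  integrals below are finite; it must not enter the final constant.
\<close>

context
  fixes r :: "complex \<Rightarrow> real" and \<rho> :: real
  assumes r [measurable]: "r \<in> borel_measurable borel" and r_range: "\<And>x. 0 \<le> r x" "\<And>x. r x \<le> \<rho>"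
    and \<rho>: "\<rho> < 1"
begin

definition sel_poisson :: "complex \<Rightarrow> complex \<Rightarrow> real" where
  "sel_poisson x y = poisson (r x) (x * cnj y)"

lemma sel_poisson_measurable [measurable (raw)]:
  assumes [measurable]: "f \<in> borel_measurable M" "g \<in> borel_measurable M"
  shows "(\<lambda>x. sel_poisson (f x) (g x)) \<in> borel_measurable M"
  unfolding sel_poisson_def by measurable

lemma sel_poisson_nonneg: "0 \<le> sel_poisson x y"
  unfolding sel_poisson_def using r_range[of x] \<rho> by (intro poisson_nonneg) auto

lemma sel_poisson_le: "\<bar>sel_poisson x y\<bar> \<le> 1 / (1 - \<rho>)\<^sup>2"
  unfolding sel_poisson_def using r_range[of x] \<rho> by (intro poisson_le) auto

text \<open>
  By the semigroup law the left side, which is the kernel of \<open>T T\<^sup>*\<close>, is a Poisson kernel at the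
  product of the two radii, so that \<open>poisson_mult_le\<close> applies; the right side is the kernel of
  \<open>16 (T + T\<^sup>*)\<close>.
\<close>

lemma sel_poisson_compose:
  assumes "cmod x = 1" "cmod x' = 1"
  shows "(\<integral>y. sel_poisson x y * sel_poisson x' y \<partial>circle) \<le> 16 * (sel_poisson x x' + sel_poisson x' x)"
proof -
  have r1: "0 \<le> r x" "r x < 1" "0 \<le> r x'" "r x' < 1"
    using r_range[of x] r_range[of x'] \<rho> by auto
  have sw: "poisson t (a * cnj b) = poisson t (b * cnj a)" for t a b
    using poisson_cnj[of t "a * cnj b"] by (simp add: mult.commute)
  have "(\<integral>y. sel_poisson x y * sel_poisson x' y \<partial>circle)
      = (\<integral>y. poisson (r x) (x * cnj y) * poisson (r x') (y * cnj x') \<partial>circle)"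
    unfolding sel_poisson_def by (simp only: sw[of "r x'" x'])
  also have "\<dots> = poisson (r x * r x') (x * cnj x')"
    by (rule poisson_semigroup) (use r1 assms in auto)
  also have "\<dots> \<le> 16 * (poisson (r x) (x * cnj x') + poisson (r x') (x * cnj x'))"
    by (rule poisson_mult_le) (use r1 in auto)
  finally show ?thesis by (simp add: sel_poisson_def sw[of "r x'" x'])
qed

text \<open>
  Here \<open>S = T\<^sup>* \<psi>\<close>.  Expanding \<open>\<parallel>S\<parallel>\<^sup>2 = \<langle>T T\<^sup>* \<psi>, \<psi>\<rangle>\<close> and dominating the kernel gives
  \<open>\<parallel>S\<parallel>\<^sup>2 \<le> 16 (\<langle>T \<psi>, \<psi>\<rangle> + \<langle>T\<^sup>* \<psi>, \<psi>\<rangle>) = 32 \<langle>\<psi>, S\<rangle>\<close>; Cauchy--Schwarz and cancellation of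
  \<open>\<parallel>S\<parallel>\<close>, which is finite, finish the proof.
\<close>

lemma sel_poisson_adjoint_bound:
  fixes \<psi> :: "complex \<Rightarrow> real"
  assumes [measurable]: "\<psi> \<in> borel_measurable borel" and \<psi>: "\<And>x. 0 \<le> \<psi> x" "\<And>x. \<psi> x \<le> B"
  defines "S \<equiv> \<lambda>y. \<integral>x. sel_poisson x y * \<psi> x \<partial>circle"
  shows "(\<integral>y. (S y)\<^sup>2 \<partial>circle) \<le> 32\<^sup>2 * (\<integral>x. (\<psi> x)\<^sup>2 \<partial>circle)"
proof -
  define A where "A = 1 / (1 - \<rho>)\<^sup>2"
  have A0: "0 \<le> A" by (simp add: A_def)
  have B0: "0 \<le> B" using order_trans[OF \<psi>[of 0]] .
  have Q: "\<bar>sel_poisson x y\<bar> \<le> A" "0 \<le> sel_poisson x y" for x y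
    using sel_poisson_le[of x y] sel_poisson_nonneg by (auto simp: A_def)
  have \<psi>B: "\<bar>\<psi> x\<bar> \<le> B" for x using \<psi>[of x] by simp
  have Q\<psi>: "\<bar>sel_poisson x y * \<psi> x\<bar> \<le> A * B" for x y
    unfolding abs_mult by (intro mult_mono Q \<psi>B A0) auto
  have S_meas [measurable]: "S \<in> borel_measurable borel"
    unfolding S_def by measurable
  have S_le: "\<bar>S y\<bar> \<le> A * B" for y
    unfolding S_def by (intro bounded_integral_circle Q\<psi>) measurable
  have S_nn: "0 \<le> S y" for y
    unfolding S_def by (intro integral_nonneg_AE AE_I2 mult_nonneg_nonneg Q \<psi>)
  have AB0: "0 \<le> A * B" using A0 B0 by simp
  have QS: "\<bar>sel_poisson x y * S y\<bar> \<le> A * (A * B)" for x y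
    unfolding abs_mult by (intro mult_mono Q S_le A0) auto
  \<comment> \<open>this is \<open>T T\<^sup>* \<psi>\<close> at \<open>x\<close>\<close>
  have inner: "(\<integral>y. sel_poisson x y * S y \<partial>circle)
      \<le> 16 * ((\<integral>x'. sel_poisson x x' * \<psi> x' \<partial>circle) + S x)" if x: "cmod x = 1" for x
  proof -
    have b3: "\<bar>sel_poisson x y * (sel_poisson x' y * \<psi> x')\<bar> \<le> A * (A * B)" for x' y
      unfolding abs_mult[of "sel_poisson x y"] by (intro mult_mono Q Q\<psi> A0) auto
    have b2: "\<bar>sel_poisson x y * sel_poisson x' y\<bar> \<le> A * A" for x' y
      unfolding abs_mult by (intro mult_mono Q A0) auto
    have "(\<integral>y. sel_poisson x y * S y \<partial>circle)
        = (\<integral>y. (\<integral>x'. sel_poisson x y * (sel_poisson x' y * \<psi> x') \<partial>circle) \<partial>circle)"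
      unfolding S_def by simp
    also have "\<dots> = (\<integral>x'. (\<integral>y. sel_poisson x y * (sel_poisson x' y * \<psi> x') \<partial>circle) \<partial>circle)"
      by (rule bounded_Fubini_circle[OF _ b3]) measurable
    also have "\<dots> = (\<integral>x'. (\<integral>y. sel_poisson x y * sel_poisson x' y \<partial>circle) * \<psi> x' \<partial>circle)"
      by (simp flip: mult.assoc)
    also have "\<dots> \<le> (\<integral>x'. 16 * (sel_poisson x x' * \<psi> x' + sel_poisson x' x * \<psi> x') \<partial>circle)"
    proof (rule integral_mono_AE)
      have "\<bar>(\<integral>y. sel_poisson x y * sel_poisson x' y \<partial>circle) * \<psi> x'\<bar> \<le> A * A * B" for x'
        unfolding abs_mult by (intro mult_mono bounded_integral_circle b2 \<psi>B) (use A0 in auto)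
      then show "integrable circle (\<lambda>x'. (\<integral>y. sel_poisson x y * sel_poisson x' y \<partial>circle) * \<psi> x')"
        by (intro bounded_integrable_circle) measurable
      have "\<bar>sel_poisson x x' * \<psi> x'\<bar> \<le> A * B" for x'
        unfolding abs_mult by (intro mult_mono Q \<psi>B A0) auto
      then show "integrable circle (\<lambda>x'. 16 * (sel_poisson x x' * \<psi> x' + sel_poisson x' x * \<psi> x'))"
        using Q\<psi> by (intro integrable_mult_right Bochner_Integration.integrable_add bounded_integrable_circle[where B="A * B"]) auto
      show "AE x' in circle. (\<integral>y. sel_poisson x y * sel_poisson x' y \<partial>circle) * \<psi> x'
          \<le> 16 * (sel_poisson x x' * \<psi> x' + sel_poisson x' x * \<psi> x')"
        using AE_circle_norm
      proof eventually_elim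
        case (elim x')
        show ?case
          using mult_right_mono[OF sel_poisson_compose[OF x elim] \<psi>(1)[of x']]
          by (simp add: ring_distribs mult.assoc)
      qed
    qed
    also have "\<dots> = 16 * ((\<integral>x'. sel_poisson x x' * \<psi> x' \<partial>circle) + S x)"
    proof -
      have "\<bar>sel_poisson x x' * \<psi> x'\<bar> \<le> A * B" for x'
        unfolding abs_mult by (intro mult_mono Q \<psi>B A0) auto
      then have "integrable circle (\<lambda>x'. sel_poisson x x' * \<psi> x')"
        by (intro bounded_integrable_circle) measurable
      moreover have "integrable circle (\<lambda>x'. sel_poisson x' x * \<psi> x')"
        using Q\<psi> by (intro bounded_integrable_circle) measurable
      ultimately show ?thesis by (simp add: S_def)
    qed
    finally show ?thesis .
  qed
  have \<psi>Q: "\<bar>\<psi> x * (sel_poisson x x' * \<psi> x')\<bar> \<le> B * (A * B)" for x x'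
    unfolding abs_mult by (intro mult_mono Q \<psi>B A0 B0 mult_nonneg_nonneg) auto
  have \<psi>S: "\<bar>\<psi> x * S x\<bar> \<le> B * (A * B)" for x
    unfolding abs_mult[of "\<psi> x"] by (intro mult_mono S_le \<psi>B B0) auto
  have "(\<integral>y. (S y)\<^sup>2 \<partial>circle) = (\<integral>y. (\<integral>x. (sel_poisson x y * \<psi> x) * S y \<partial>circle) \<partial>circle)"
    unfolding S_def power2_eq_square by simp
  also have "\<dots> = (\<integral>x. (\<integral>y. (sel_poisson x y * \<psi> x) * S y \<partial>circle) \<partial>circle)"
  proof (rule bounded_Fubini_circle)
    show "\<bar>(sel_poisson x y * \<psi> x) * S y\<bar> \<le> (A * B) * (A * B)" for x y
      unfolding abs_mult[of "sel_poisson x y * \<psi> x"] by (intro mult_mono S_le Q\<psi> AB0) auto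
  qed measurable
  also have "\<dots> = (\<integral>x. \<psi> x * (\<integral>y. sel_poisson x y * S y \<partial>circle) \<partial>circle)"
    by (simp add: mult.commute[of _ "\<psi> _"] mult.assoc)
  also have "\<dots> \<le> (\<integral>x. 16 * (\<psi> x * (\<integral>x'. sel_poisson x x' * \<psi> x' \<partial>circle) + \<psi> x * S x) \<partial>circle)"
  proof (rule integral_mono_AE)
    have "\<bar>\<psi> x * (\<integral>y. sel_poisson x y * S y \<partial>circle)\<bar> \<le> B * (A * (A * B))" for x
      unfolding abs_mult[of "\<psi> x"] by (intro mult_mono bounded_integral_circle QS \<psi>B B0) auto
    then show "integrable circle (\<lambda>x. \<psi> x * (\<integral>y. sel_poisson x y * S y \<partial>circle))"
      by (intro bounded_integrable_circle) measurable
    have "\<bar>\<psi> x * (\<integral>x'. sel_poisson x x' * \<psi> x' \<partial>circle)\<bar> \<le> B * (A * B)" for x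
      using bounded_integral_circle[OF _ \<psi>Q[of x]] by simp
    then show "integrable circle (\<lambda>x. 16 * (\<psi> x * (\<integral>x'. sel_poisson x x' * \<psi> x' \<partial>circle) + \<psi> x * S x))"
      using \<psi>S by (intro integrable_mult_right Bochner_Integration.integrable_add bounded_integrable_circle[where B="B * (A * B)"]) auto
    show "AE x in circle. \<psi> x * (\<integral>y. sel_poisson x y * S y \<partial>circle)
        \<le> 16 * (\<psi> x * (\<integral>x'. sel_poisson x x' * \<psi> x' \<partial>circle) + \<psi> x * S x)"
      using AE_circle_norm
    proof eventually_elim
      case (elim x)
      show ?case
        using mult_left_mono[OF inner[OF elim] \<psi>(1)[of x]]
        by (simp add: ring_distribs mult.assoc)
    qed
  qed
  also have "\<dots> = 16 * ((\<integral>x. \<psi> x * (\<integral>x'. sel_poisson x x' * \<psi> x' \<partial>circle) \<partial>circle)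
      + (\<integral>x. \<psi> x * S x \<partial>circle))"
  proof -
    have "\<bar>\<psi> x * (\<integral>x'. sel_poisson x x' * \<psi> x' \<partial>circle)\<bar> \<le> B * (A * B)" for x
      using bounded_integral_circle[OF _ \<psi>Q[of x]] by simp
    then have "integrable circle (\<lambda>x. \<psi> x * (\<integral>x'. sel_poisson x x' * \<psi> x' \<partial>circle))"
      by (intro bounded_integrable_circle) measurable
    moreover have "integrable circle (\<lambda>x. \<psi> x * S x)"
      using \<psi>S by (intro bounded_integrable_circle) measurable
    ultimately show ?thesis by simp
  qed
  also have "(\<integral>x. \<psi> x * (\<integral>x'. sel_poisson x x' * \<psi> x' \<partial>circle) \<partial>circle) = (\<integral>x. \<psi> x * S x \<partial>circle)"
  proof -
    have "(\<integral>x. \<psi> x * (\<integral>x'. sel_poisson x x' * \<psi> x' \<partial>circle) \<partial>circle)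
        = (\<integral>x. (\<integral>x'. \<psi> x * (sel_poisson x x' * \<psi> x') \<partial>circle) \<partial>circle)" by simp
    also have "\<dots> = (\<integral>x'. (\<integral>x. \<psi> x * (sel_poisson x x' * \<psi> x') \<partial>circle) \<partial>circle)"
      by (rule bounded_Fubini_circle[OF _ \<psi>Q, symmetric]) measurable
    also have "\<dots> = (\<integral>x'. (\<integral>x. \<psi> x' * (sel_poisson x x' * \<psi> x) \<partial>circle) \<partial>circle)"
      by (simp only: mult_ac)
    finally show ?thesis by (simp add: S_def)
  qed
  finally have main: "(\<integral>y. (S y)\<^sup>2 \<partial>circle) \<le> 32 * (\<integral>x. \<psi> x * S x \<partial>circle)" by simp
  have S2: "integrable circle (\<lambda>x. (S x)\<^sup>2)" and \<psi>2: "integrable circle (\<lambda>x. (\<psi> x)\<^sup>2)"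
    by (rule bounded_integrable_circle_square[OF _ S_le], measurable)
       (rule bounded_integrable_circle_square[OF _ \<psi>B], measurable)
  have "(\<integral>y. (S y)\<^sup>2 \<partial>circle)\<^sup>2 \<le> (32 * (\<integral>x. \<psi> x * S x \<partial>circle))\<^sup>2"
    by (intro power_mono main) simp
  also have "\<dots> \<le> 32\<^sup>2 * ((\<integral>x. (\<psi> x)\<^sup>2 \<partial>circle) * (\<integral>x. (S x)\<^sup>2 \<partial>circle))"
    unfolding power_mult_distrib by (intro mult_left_mono Cauchy_Schwarz_circle S2 \<psi>2 S_nn \<psi>) auto
  finally show ?thesis
    by (rule cancel_square_le[rotated 3]) auto
qed

text \<open>
  The estimate passes from \<open>T\<^sup>*\<close> to \<open>T\<close> by duality: \<open>\<parallel>T \<phi>\<parallel>\<^sup>2 = \<langle>\<phi>, T\<^sup>* T \<phi>\<rangle>\<close>.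
\<close>

lemma sel_poisson_bound:
  fixes \<phi> :: "complex \<Rightarrow> real"
  assumes [measurable]: "\<phi> \<in> borel_measurable borel" and \<phi>: "\<And>x. 0 \<le> \<phi> x" "\<And>x. \<phi> x \<le> B"
  defines "T \<equiv> \<lambda>x. \<integral>y. sel_poisson x y * \<phi> y \<partial>circle"
  shows "T \<in> borel_measurable borel" "\<And>x. 0 \<le> T x" "\<And>x. T x \<le> 1 / (1 - \<rho>)\<^sup>2 * B"
    "(\<integral>x. (T x)\<^sup>2 \<partial>circle) \<le> 32\<^sup>2 * (\<integral>x. (\<phi> x)\<^sup>2 \<partial>circle)"
proof -
  define A where "A = 1 / (1 - \<rho>)\<^sup>2"
  have A0: "0 \<le> A" by (simp add: A_def)
  have B0: "0 \<le> B" using order_trans[OF \<phi>[of 0]] .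
  have Q: "\<bar>sel_poisson x y\<bar> \<le> A" "0 \<le> sel_poisson x y" for x y
    using sel_poisson_le[of x y] sel_poisson_nonneg by (auto simp: A_def)
  have \<phi>B: "\<bar>\<phi> x\<bar> \<le> B" for x using \<phi>[of x] by simp
  have Q\<phi>: "\<bar>sel_poisson x y * \<phi> y\<bar> \<le> A * B" for x y
    unfolding abs_mult by (intro mult_mono Q \<phi>B A0) auto
  show T_meas [measurable]: "T \<in> borel_measurable borel"
    unfolding T_def by measurable
  have T_abs: "\<bar>T x\<bar> \<le> A * B" for x
    unfolding T_def by (intro bounded_integral_circle Q\<phi>) measurable
  then show T_le: "T x \<le> 1 / (1 - \<rho>)\<^sup>2 * B" for x
    unfolding A_def[symmetric] by (rule order_trans[OF abs_ge_self])
  show T_nn: "0 \<le> T x" for x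
    unfolding T_def by (intro integral_nonneg_AE AE_I2 mult_nonneg_nonneg Q \<phi>)
  have AB0: "0 \<le> A * B" using A0 B0 by simp
  define S where "S = (\<lambda>y. \<integral>x. sel_poisson x y * T x \<partial>circle)"
  have S_meas [measurable]: "S \<in> borel_measurable borel"
    unfolding S_def by measurable
  have QT: "\<bar>sel_poisson x y * T x\<bar> \<le> A * (A * B)" for x y
    unfolding abs_mult by (intro mult_mono Q T_abs A0) auto
  have S_le: "\<bar>S y\<bar> \<le> A * (A * B)" for y
    unfolding S_def by (intro bounded_integral_circle QT) measurable
  have S_nn: "0 \<le> S y" for y
    unfolding S_def by (intro integral_nonneg_AE AE_I2 mult_nonneg_nonneg Q T_nn)
  have "(\<integral>x. (T x)\<^sup>2 \<partial>circle) = (\<integral>x. (\<integral>y. (sel_poisson x y * \<phi> y) * T x \<partial>circle) \<partial>circle)"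
    unfolding T_def power2_eq_square by simp
  also have "\<dots> = (\<integral>y. (\<integral>x. (sel_poisson x y * \<phi> y) * T x \<partial>circle) \<partial>circle)"
  proof (rule bounded_Fubini_circle[symmetric])
    show "\<bar>(sel_poisson x y * \<phi> y) * T x\<bar> \<le> (A * B) * (A * B)" for x y
      unfolding abs_mult[of "sel_poisson x y * \<phi> y"] by (intro mult_mono T_abs Q\<phi> AB0) auto
  qed measurable
  also have "\<dots> = (\<integral>y. (\<integral>x. \<phi> y * (sel_poisson x y * T x) \<partial>circle) \<partial>circle)"
    by (simp only: mult_ac)
  also have "\<dots> = (\<integral>y. \<phi> y * S y \<partial>circle)"
    by (simp add: S_def)
  finally have main: "(\<integral>x. (T x)\<^sup>2 \<partial>circle) = (\<integral>y. \<phi> y * S y \<partial>circle)" .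
  have S2: "integrable circle (\<lambda>x. (S x)\<^sup>2)" and \<phi>2: "integrable circle (\<lambda>x. (\<phi> x)\<^sup>2)"
    by (rule bounded_integrable_circle_square[OF _ S_le], measurable)
       (rule bounded_integrable_circle_square[OF _ \<phi>B], measurable)
  have "(\<integral>x. (T x)\<^sup>2 \<partial>circle)\<^sup>2 \<le> (\<integral>x. (\<phi> x)\<^sup>2 \<partial>circle) * (\<integral>x. (S x)\<^sup>2 \<partial>circle)"
    unfolding main by (intro Cauchy_Schwarz_circle S2 \<phi>2 S_nn \<phi>) auto
  also have "\<dots> \<le> (\<integral>x. (\<phi> x)\<^sup>2 \<partial>circle) * (32\<^sup>2 * (\<integral>x. (T x)\<^sup>2 \<partial>circle))"
  proof (rule mult_left_mono)
    show "(\<integral>x. (S x)\<^sup>2 \<partial>circle) \<le> 32\<^sup>2 * (\<integral>x. (T x)\<^sup>2 \<partial>circle)"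
      unfolding S_def by (rule sel_poisson_adjoint_bound[OF T_meas T_nn T_le])
  qed simp
  also have "\<dots> = 32\<^sup>2 * ((\<integral>x. (\<phi> x)\<^sup>2 \<partial>circle) * (\<integral>x. (T x)\<^sup>2 \<partial>circle))" by simp
  finally show "(\<integral>x. (T x)\<^sup>2 \<partial>circle) \<le> 32\<^sup>2 * (\<integral>x. (\<phi> x)\<^sup>2 \<partial>circle)"
    by (rule cancel_square_le[rotated 3]) auto
qed

end

section \<open>The radial maximal function\<close>

definition disc_series :: "(nat \<Rightarrow> complex) \<Rightarrow> complex \<Rightarrow> complex" where
  "disc_series a z = (if z \<in> ball 0 1 then abs_series a z else 0)"

abbreviation sq_summable :: "(nat \<Rightarrow> complex) \<Rightarrow> bool" where
  "sq_summable a \<equiv> summable (\<lambda>n. (cmod (a n))\<^sup>2)"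

lemma disc_series_borel [measurable]: "disc_series a \<in> borel_measurable borel"
  unfolding disc_series_def mem_ball dist_0_norm by measurable

lemma disc_series_outside: "z \<notin> ball 0 1 \<Longrightarrow> disc_series a z = 0"
  by (simp add: disc_series_def)

lemma sq_summable_le:
  assumes "sq_summable a" shows "(cmod (a n))\<^sup>2 \<le> (\<Sum>n. (cmod (a n))\<^sup>2)"
  using sum_le_suminf[OF assms, of "{n}"] by simp

lemma sq_summable_power:
  assumes a: "sq_summable a" and q: "cmod q < 1"
  shows "summable (\<lambda>n. cmod (a n * q ^ n))"
proof (rule summable_comparison_test')
  let ?B = "sqrt (\<Sum>n. (cmod (a n))\<^sup>2)"
  show "summable (\<lambda>n. ?B * cmod q ^ n)"
    using q by (intro summable_mult summable_geometric) simp
  have "cmod (a n) \<le> ?B" for n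
    using real_sqrt_le_mono[OF sq_summable_le[OF a, of n]] by simp
  then show "norm (cmod (a n * q ^ n)) \<le> ?B * cmod q ^ n" if "n \<ge> 0" for n
    by (simp add: norm_mult norm_power mult_right_mono)
qed

lemma disc_series_sums:
  assumes "sq_summable a" "z \<in> ball 0 1"
  shows "(\<lambda>n. a n * z ^ n) sums disc_series a z"
proof -
  have "summable (\<lambda>n. a n * z ^ n)"
    by (rule summable_norm_cancel, rule sq_summable_power) (use assms in simp_all)
  then show ?thesis using assms(2) by (simp add: disc_series_def abs_series_def summable_sums)
qed

lemma disc_series_holomorphic: "sq_summable a \<Longrightarrow> disc_series a holomorphic_on ball 0 1"
  by (rule power_series_holomorphic) (use disc_series_sums in auto)

lemma disc_series_dilate:
  assumes "0 \<le> r" "r < 1" "cmod \<zeta> \<le> 1"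
  shows "disc_series a (of_real r * \<zeta>) = abs_series (\<lambda>n. a n * of_real r ^ n) \<zeta>"
proof -
  have "r * cmod \<zeta> \<le> r * 1" using assms by (intro mult_left_mono) auto
  then show ?thesis
    using assms by (simp add: disc_series_def abs_series_def norm_mult power_mult_distrib mult.assoc)
qed

lemma suminf_dilate_le:
  assumes a: "sq_summable a" and r: "0 \<le> r" "r \<le> 1"
  shows "summable (\<lambda>n. (cmod (a n * of_real r ^ n))\<^sup>2)"
    "(\<Sum>n. (cmod (a n * of_real r ^ n))\<^sup>2) \<le> (\<Sum>n. (cmod (a n))\<^sup>2)"
proof -
  have le: "(cmod (a n * of_real r ^ n))\<^sup>2 \<le> (cmod (a n))\<^sup>2" for n
    using r by (intro power_mono) (auto simp: norm_mult norm_power mult_left_le power_le_one)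
  show s: "summable (\<lambda>n. (cmod (a n * of_real r ^ n))\<^sup>2)"
    by (rule summable_comparison_test'[OF a, of 0]) (use le in simp)
  show "(\<Sum>n. (cmod (a n * of_real r ^ n))\<^sup>2) \<le> (\<Sum>n. (cmod (a n))\<^sup>2)"
    by (rule suminf_le[OF le s a])
qed

lemma integral_norm_abs_series:
  assumes c: "summable (\<lambda>n. cmod (c n))"
  shows "(\<lambda>n. (cmod (c n))\<^sup>2) sums (\<integral>\<zeta>. (cmod (abs_series c \<zeta>))\<^sup>2 \<partial>circle)"
proof -
  have "(\<lambda>n. complex_of_real ((cmod (c n))\<^sup>2)) sums (\<integral>\<zeta>. complex_of_real ((cmod (abs_series c \<zeta>))\<^sup>2) \<partial>circle)"
    using L2_inner_abs_series[OF c c] unfolding L2_inner_def by (simp only: complex_norm_square)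
  then show ?thesis
    by (simp only: integral_complex_of_real sums_of_real_iff)
qed

text \<open>
  The function on the circle of radius \<open>R\<close> between \<open>\<sigma>\<close> and \<open>1\<close> is an absolutely convergent series, and
  its values at the smaller radii \<open>s(x)\<close> are its Poisson integrals with parameter \<open>s(x) / R\<close>.  The
  bound is independent of \<open>\<sigma>\<close>.
\<close>

lemma selector_bound:
  assumes a: "sq_summable a" and s [measurable]: "s \<in> borel_measurable borel"
    and s_range: "\<And>x. 0 \<le> s x" "\<And>x. s x \<le> \<sigma>" and \<sigma>: "\<sigma> < 1"
  shows "(\<integral>\<^sup>+x. ennreal ((cmod (disc_series a (of_real (s x) * x)))\<^sup>2) \<partial>circle)
     \<le> ennreal (32\<^sup>2 * (\<Sum>n. (cmod (a n))\<^sup>2))"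
proof -
  have \<sigma>0: "0 \<le> \<sigma>" using s_range[of 0] by simp
  \<comment> \<open>any radius strictly between \<open>\<sigma>\<close> and \<open>1\<close> would do\<close>
  define R where "R = (1 + \<sigma>) / 2"
  have R: "0 < R" "R < 1" "\<sigma> < R" using \<sigma> \<sigma>0 by (auto simp: R_def)
  define r where "r x = s x / R" for x
  have [measurable]: "r \<in> borel_measurable borel" unfolding r_def by measurable
  have r: "0 \<le> r x" "r x \<le> \<sigma> / R" for x
    using s_range[of x] R by (auto simp: r_def divide_right_mono)
  have \<rho>: "\<sigma> / R < 1" using R by simp
  define c where "c n = a n * of_real R ^ n" for n
  have c: "summable (\<lambda>n. cmod (c n))"
    unfolding c_def using R by (intro sq_summable_power a) simp
  define \<phi> where "\<phi> y = (if cmod y = 1 then cmod (abs_series c y) else 0)" for y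
  have \<phi> [measurable]: "\<phi> \<in> borel_measurable borel" unfolding \<phi>_def by measurable
  have \<phi>0: "0 \<le> \<phi> y" for y by (simp add: \<phi>_def)
  have B0: "0 \<le> (\<Sum>n. cmod (c n))" by (intro suminf_nonneg c) simp
  have \<phi>B: "\<phi> y \<le> (\<Sum>n. cmod (c n))" for y
    using abs_series_sums(3)[OF c, of y] B0 by (simp add: \<phi>_def)
  define T where "T = (\<lambda>x. \<integral>y. sel_poisson r x y * \<phi> y \<partial>circle)"
  note T = sel_poisson_bound[OF \<open>r \<in> borel_measurable borel\<close> r \<rho> \<phi> \<phi>0 \<phi>B]
  have [measurable]: "T \<in> borel_measurable borel" using T(1) by (simp add: T_def)
  \<comment> \<open>the function at the selected radius is dominated by the operator applied to \<open>\<phi>\<close>\<close>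
  have *: "AE x in circle. (cmod (disc_series a (of_real (s x) * x)))\<^sup>2 \<le> (T x)\<^sup>2"
    using AE_circle_norm
  proof eventually_elim
    case (elim x)
    have s1: "s x < 1" and r1: "r x < 1" using s_range[of x] \<sigma> r[of x] \<rho> by auto
    have "s x = R * r x" using R by (simp add: r_def)
    then have "(\<lambda>n. a n * of_real (s x) ^ n) = (\<lambda>n. c n * of_real (r x) ^ n)"
      by (simp add: fun_eq_iff c_def power_mult_distrib)
    then have "disc_series a (of_real (s x) * x) = abs_series (\<lambda>n. c n * of_real (r x) ^ n) x"
      using disc_series_dilate[of "s x" x a] s_range[of x] s1 elim by simp
    also have "\<dots> = (\<integral>y. abs_series c y * of_real (poisson (r x) (x * cnj y)) \<partial>circle)"
      by (rule poisson_reproducing[OF c r(1) r1 elim, symmetric])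
    finally have "cmod (disc_series a (of_real (s x) * x))
        \<le> (\<integral>y. norm (abs_series c y * of_real (poisson (r x) (x * cnj y))) \<partial>circle)"
      by simp
    also have "\<dots> = T x"
      unfolding T_def sel_poisson_def[OF \<open>r \<in> borel_measurable borel\<close> r \<rho>]
    proof (rule integral_cong_AE)
      show "AE y in circle. norm (abs_series c y * of_real (poisson (r x) (x * cnj y)))
          = poisson (r x) (x * cnj y) * \<phi> y"
        using AE_circle_norm
        by eventually_elim (use poisson_nonneg[OF r(1) r1] in \<open>simp add: norm_mult \<phi>_def\<close>)
    qed measurable
    finally show ?case by (intro power_mono) auto
  qed
  have bT: "\<bar>T x\<bar> \<le> 1 / (1 - \<sigma> / R)\<^sup>2 * (\<Sum>n. cmod (c n))" for x
    using T(2,3)[of x] by (simp add: T_def)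
  have iT: "integrable circle (\<lambda>x. (T x)\<^sup>2)"
    by (rule bounded_integrable_circle_square[OF _ bT]) measurable
  have "(\<integral>\<^sup>+x. ennreal ((cmod (disc_series a (of_real (s x) * x)))\<^sup>2) \<partial>circle)
      \<le> (\<integral>\<^sup>+x. ennreal ((T x)\<^sup>2) \<partial>circle)"
    using * by (intro nn_integral_mono_AE) (auto intro: ennreal_leI)
  also have "\<dots> = ennreal (\<integral>x. (T x)\<^sup>2 \<partial>circle)"
    using iT by (rule nn_integral_eq_integral) simp
  also have "\<dots> \<le> ennreal (32\<^sup>2 * (\<Sum>n. (cmod (a n))\<^sup>2))"
  proof (rule ennreal_leI)
    have "(\<integral>y. (\<phi> y)\<^sup>2 \<partial>circle) = (\<integral>y. (cmod (abs_series c y))\<^sup>2 \<partial>circle)"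
    proof (rule integral_cong_AE)
      show "AE y in circle. (\<phi> y)\<^sup>2 = (cmod (abs_series c y))\<^sup>2"
        using AE_circle_norm by eventually_elim (simp add: \<phi>_def)
    qed measurable
    also have "\<dots> = (\<Sum>n. (cmod (c n))\<^sup>2)"
      using integral_norm_abs_series[OF c] by (simp add: sums_iff)
    also have "\<dots> \<le> (\<Sum>n. (cmod (a n))\<^sup>2)"
      unfolding c_def using R by (intro suminf_dilate_le a) auto
    finally have "(\<integral>y. (\<phi> y)\<^sup>2 \<partial>circle) \<le> (\<Sum>n. (cmod (a n))\<^sup>2)" .
    then show "(\<integral>x. (T x)\<^sup>2 \<partial>circle) \<le> 32\<^sup>2 * (\<Sum>n. (cmod (a n))\<^sup>2)"
      using T(4) by (simp add: T_def)
  qed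
  finally show ?thesis .
qed

text \<open>
  Suprema over all radii are reduced to this countable family: it keeps them measurable, and by
  continuity in the radius nothing is lost.
\<close>

definition rat_radii :: "nat \<Rightarrow> real" where
  "rat_radii = from_nat_into (\<rat> \<inter> {0..<1})"

lemma range_rat_radii: "range rat_radii = \<rat> \<inter> {0..<1}"
  unfolding rat_radii_def
  by (rule range_from_nat_into) (use countable_rat in \<open>auto intro!: countable_Int1 exI[of _ 0]\<close>)

lemma rat_radii_range: "0 \<le> rat_radii j" "rat_radii j < 1"
  using range_rat_radii by (metis Int_iff atLeastLessThan_iff rangeI)+

lemma rat_radii_dense:
  fixes g :: "real \<Rightarrow> real"
  assumes g: "continuous_on {0..<1} g" and le: "\<And>j. t < rat_radii j \<Longrightarrow> g (rat_radii j) \<le> C"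
    and x: "t < x" "0 \<le> x" "x < 1"
  shows "g x \<le> C"
proof (rule ccontr)
  assume "\<not> g x \<le> C"
  then have "0 < g x - C" by simp
  with g x obtain d where d: "d > 0" "\<And>y. y \<in> {0..<1} \<Longrightarrow> dist y x < d \<Longrightarrow> dist (g y) (g x) < g x - C"
    unfolding continuous_on_iff by (metis atLeastLessThan_iff)
  \<comment> \<open>a rational radius to the right of \<open>x\<close> stays above the threshold \<open>t\<close>\<close>
  obtain y where y: "y \<in> \<rat>" "x < y" "y < min 1 (x + d)"
    using Rats_dense_in_real[of x "min 1 (x + d)"] d x by auto
  then have "y \<in> range rat_radii" using x by (simp add: range_rat_radii)
  then obtain j where j: "y = rat_radii j" by blast
  have "dist (g y) (g x) < g x - C" using y x by (intro d) (auto simp: dist_real_def)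
  then have "g y > C" by (auto simp: dist_real_def)
  then show False using le[of j] j y x by simp
qed

text \<open>
  The square of the usual radial maximal function, extended-valued because it is not known
  beforehand to be finite anywhere.
\<close>

definition radial_max :: "(nat \<Rightarrow> complex) \<Rightarrow> complex \<Rightarrow> ennreal" where
  "radial_max a \<zeta> = (SUP j. ennreal ((cmod (disc_series a (of_real (rat_radii j) * \<zeta>)))\<^sup>2))"

lemma radial_max_borel [measurable]: "radial_max a \<in> borel_measurable borel"
  unfolding radial_max_def by measurable

lemma continuous_on_radius:
  assumes f: "continuous_on (ball 0 1) f" and z: "cmod \<zeta> \<le> 1"
  shows "continuous_on {0..<1::real} (\<lambda>r. f (of_real r * \<zeta>))"
proof (rule continuous_on_compose2[OF f])
  show "continuous_on {0..<1} (\<lambda>r. of_real r * \<zeta>)" by (intro continuous_intros)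
  show "(\<lambda>r. of_real r * \<zeta>) ` {0..<1} \<subseteq> ball 0 1"
  proof safe
    fix r :: real assume r: "r \<in> {0..<1}"
    then have "r * cmod \<zeta> \<le> r * 1" using z by (intro mult_left_mono) auto
    with r show "of_real r * \<zeta> \<in> ball 0 1" by (simp add: norm_mult)
  qed
qed

lemma radial_max_upper:
  assumes a: "sq_summable a" and z: "cmod \<zeta> \<le> 1" and r: "0 \<le> r" "r < 1"
    and m: "radial_max a \<zeta> \<le> ennreal C" "0 \<le> C"
  shows "(cmod (disc_series a (of_real r * \<zeta>)))\<^sup>2 \<le> C"
proof (rule rat_radii_dense[where t="-1" and g="\<lambda>r. (cmod (disc_series a (of_real r * \<zeta>)))\<^sup>2"])
  show "continuous_on {0..<1} (\<lambda>r. (cmod (disc_series a (of_real r * \<zeta>)))\<^sup>2)"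
    by (intro continuous_intros continuous_on_radius z holomorphic_on_imp_continuous_on disc_series_holomorphic a)
  show "(cmod (disc_series a (of_real (rat_radii j) * \<zeta>)))\<^sup>2 \<le> C" for j
  proof -
    have "ennreal ((cmod (disc_series a (of_real (rat_radii j) * \<zeta>)))\<^sup>2) \<le> radial_max a \<zeta>"
      unfolding radial_max_def by (rule SUP_upper) simp
    also have "\<dots> \<le> ennreal C" by (rule m)
    finally show ?thesis using m(2) by (simp add: ennreal_le_iff)
  qed
qed (use r in auto)

text \<open>Needed to realise a finite maximum of radial values by a measurable choice of radii.\<close>

lemma measurable_argmax:
  fixes g :: "nat \<Rightarrow> complex \<Rightarrow> real"
  assumes g [measurable]: "\<And>j. g j \<in> borel_measurable borel"
  shows "\<exists>k. k \<in> measurable borel (count_space UNIV) \<and> (\<forall>x. k x \<le> N \<and> (\<forall>j\<le>N. g j x \<le> g (k x) x))"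
proof (induction N)
  case 0
  show ?case by (rule exI[of _ "\<lambda>_. 0"]) auto
next
  case (Suc N)
  then obtain k where k [measurable]: "k \<in> measurable borel (count_space UNIV)"
    and kN: "\<And>x. k x \<le> N" "\<And>x j. j \<le> N \<Longrightarrow> g j x \<le> g (k x) x" by blast
  define k' where "k' x = (if g (k x) x \<le> g (Suc N) x then Suc N else k x)" for x
  have "(\<lambda>x. g (k x) x) \<in> borel_measurable borel"
    by (rule measurable_compose_countable[OF g k])
  then have "k' \<in> measurable borel (count_space UNIV)"
    unfolding k'_def by measurable
  moreover have "k' x \<le> Suc N" for x using kN(1)[of x] by (simp add: k'_def)
  moreover have "g j x \<le> g (k' x) x" if "j \<le> Suc N" for j x
  proof (cases "j = Suc N")
    case False
    then show ?thesis using kN(2)[of j x] that by (auto simp: k'_def)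
  qed (auto simp: k'_def)
  ultimately show ?case by blast
qed

text \<open>
  The maximum over the first radii is attained at a measurable selection of radii, to which the
  uniform bound applies; monotone convergence gives the full supremum.
\<close>

lemma nn_integral_radial_max:
  assumes a: "sq_summable a"
  shows "(\<integral>\<^sup>+\<zeta>. radial_max a \<zeta> \<partial>circle) \<le> ennreal (32\<^sup>2 * (\<Sum>n. (cmod (a n))\<^sup>2))"
proof -
  define g where "g j \<zeta> = (cmod (disc_series a (of_real (rat_radii j) * \<zeta>)))\<^sup>2" for j \<zeta>
  have g [measurable]: "g j \<in> borel_measurable borel" for j unfolding g_def by measurable
  have "\<forall>N. \<exists>k. k \<in> measurable borel (count_space UNIV) \<and> (\<forall>x. k x \<le> N \<and> (\<forall>j\<le>N. g j x \<le> g (k x) x))"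
    using measurable_argmax[of g, OF g] by blast
  from choice[OF this] obtain k where k [measurable]: "\<And>N. k N \<in> measurable borel (count_space UNIV)"
    and kN: "\<And>N x. k N x \<le> (N::nat)" "\<And>N x j. j \<le> N \<Longrightarrow> g j x \<le> g (k N x) x"
    by blast
  define G where "G N x = ennreal (g (k N x) x)" for N x
  have [measurable]: "G N \<in> borel_measurable borel" for N
    unfolding G_def using measurable_compose_countable[OF g k] by measurable
  \<comment> \<open>the first \<open>N\<close> radii are among the first \<open>N + 1\<close>, so the maxima increase\<close>
  have "incseq G"
    unfolding incseq_def le_fun_def G_def
    by (intro allI impI ennreal_leI kN(2) order_trans[OF kN(1)])
  have "radial_max a x \<le> (SUP N. G N x)" for x
    unfolding radial_max_def G_def g_def[symmetric]
    by (rule SUP_mono) (use kN(2) in \<open>auto intro!: ennreal_leI\<close>)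
  then have "(\<integral>\<^sup>+\<zeta>. radial_max a \<zeta> \<partial>circle) \<le> (\<integral>\<^sup>+\<zeta>. (SUP N. G N \<zeta>) \<partial>circle)"
    by (intro nn_integral_mono)
  also have "\<dots> = (SUP N. \<integral>\<^sup>+\<zeta>. G N \<zeta> \<partial>circle)"
    by (rule nn_integral_monotone_convergence_SUP[OF \<open>incseq G\<close>]) measurable
  also have "\<dots> \<le> ennreal (32\<^sup>2 * (\<Sum>n. (cmod (a n))\<^sup>2))"
  proof (rule SUP_least)
    fix N
    define s where "s x = rat_radii (k N x)" for x
    have "s \<in> borel_measurable borel" unfolding s_def by measurable
    moreover have "0 \<le> s x" for x using rat_radii_range by (simp add: s_def)
    moreover have "s x \<le> Max (rat_radii ` {..N})" for x
      unfolding s_def using kN(1) by (intro Max_ge) auto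
    moreover have "Max (rat_radii ` {..N}) < 1"
      using rat_radii_range by (subst Max_less_iff) auto
    ultimately have "(\<integral>\<^sup>+x. ennreal ((cmod (disc_series a (of_real (s x) * x)))\<^sup>2) \<partial>circle)
     \<le> ennreal (32\<^sup>2 * (\<Sum>n. (cmod (a n))\<^sup>2))"
      by (rule selector_bound[OF a])
    then show "(\<integral>\<^sup>+\<zeta>. G N \<zeta> \<partial>circle) \<le> ennreal (32\<^sup>2 * (\<Sum>n. (cmod (a n))\<^sup>2))"
      by (simp add: G_def g_def s_def)
  qed
  finally show ?thesis .
qed

section \<open>Radial limits\<close>

lemma convergent_at_left_1:
  fixes g :: "real \<Rightarrow> complex"
  assumes "\<And>e. e > 0 \<Longrightarrow> \<exists>P. eventually P (at_left 1) \<and> (\<forall>x y. P x \<and> P y \<longrightarrow> dist (g x) (g y) < e)"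
  shows "\<exists>l. (g \<longlongrightarrow> l) (at_left 1)"
proof -
  have "cauchy_filter (filtermap g (at_left 1))"
    using assms by (simp add: cauchy_filter_metric_filtermap)
  then show ?thesis
    using cauchy_filter_complete_converges[OF _ complete_UNIV, of "filtermap g (at_left 1)"]
    by (simp add: filterlim_def filtermap_bot_iff)
qed

definition tail_coeffs :: "nat \<Rightarrow> (nat \<Rightarrow> complex) \<Rightarrow> nat \<Rightarrow> complex" where
  "tail_coeffs N a n = (if n < N then 0 else a n)"

lemma tail_coeffs_sums:
  assumes "sq_summable a"
  shows "(\<lambda>n. (cmod (tail_coeffs N a n))\<^sup>2) sums ((\<Sum>n. (cmod (a n))\<^sup>2) - (\<Sum>n<N. (cmod (a n))\<^sup>2))"
proof -
  have "(\<lambda>n. if n \<in> {..<N} then (cmod (a n))\<^sup>2 else 0) sums (\<Sum>n<N. (cmod (a n))\<^sup>2)"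
    by (rule sums_If_finite_set) simp
  from sums_diff[OF summable_sums[OF assms] this]
  have "(\<lambda>n. (cmod (a n))\<^sup>2 - (if n \<in> {..<N} then (cmod (a n))\<^sup>2 else 0))
     sums ((\<Sum>n. (cmod (a n))\<^sup>2) - (\<Sum>n<N. (cmod (a n))\<^sup>2))" .
  also have "(\<lambda>n. (cmod (a n))\<^sup>2 - (if n \<in> {..<N} then (cmod (a n))\<^sup>2 else 0))
      = (\<lambda>n. (cmod (tail_coeffs N a n))\<^sup>2)"
    by (auto simp: tail_coeffs_def fun_eq_iff)
  finally show ?thesis .
qed

lemma disc_series_tail:
  assumes a: "sq_summable a" and z: "z \<in> ball 0 1"
  shows "disc_series a z = (\<Sum>n<N. a n * z ^ n) + disc_series (tail_coeffs N a) z"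
proof -
  have "sq_summable (tail_coeffs N a)"
    using tail_coeffs_sums[OF a] by (rule sums_summable)
  note t = disc_series_sums[OF this z]
  have "(\<lambda>n. if n \<in> {..<N} then a n * z ^ n else 0) sums (\<Sum>n<N. a n * z ^ n)"
    by (rule sums_If_finite_set) simp
  from sums_add[OF this t]
  have "(\<lambda>n. (if n \<in> {..<N} then a n * z ^ n else 0) + tail_coeffs N a n * z ^ n)
    sums ((\<Sum>n<N. a n * z ^ n) + disc_series (tail_coeffs N a) z)" .
  also have "(\<lambda>n. (if n \<in> {..<N} then a n * z ^ n else 0) + tail_coeffs N a n * z ^ n)
      = (\<lambda>n. a n * z ^ n)"
    by (auto simp: tail_coeffs_def fun_eq_iff)
  finally show ?thesis using disc_series_sums[OF a z] sums_unique2 by blast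
qed

text \<open>
  The integrals of the maximal functions of the tails tend to \<open>0\<close>, so their infimum has integral
  \<open>0\<close>.
\<close>

lemma AE_small_radial_max:
  assumes a: "sq_summable a"
  shows "AE \<zeta> in circle. \<forall>e>0. \<exists>N. radial_max (tail_coeffs N a) \<zeta> < e"
proof -
  let ?S = "\<lambda>N. (\<Sum>n. (cmod (a n))\<^sup>2) - (\<Sum>n<N. (cmod (a n))\<^sup>2)"
  have "?S \<longlonglongrightarrow> (\<Sum>n. (cmod (a n))\<^sup>2) - (\<Sum>n. (cmod (a n))\<^sup>2)"
    by (intro tendsto_diff tendsto_const summable_LIMSEQ a)
  then have "(\<lambda>N. ennreal (32\<^sup>2 * ?S N)) \<longlonglongrightarrow> ennreal (32\<^sup>2 * 0)"
    by (intro tendsto_ennrealI tendsto_mult_left) simp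
  then have lim: "(\<lambda>N. ennreal (32\<^sup>2 * ?S N)) \<longlonglongrightarrow> 0" by simp
  have le: "(\<integral>\<^sup>+\<zeta>. (INF N. radial_max (tail_coeffs N a) \<zeta>) \<partial>circle) \<le> ennreal (32\<^sup>2 * ?S N)" for N
  proof -
    have "(\<integral>\<^sup>+\<zeta>. (INF N. radial_max (tail_coeffs N a) \<zeta>) \<partial>circle)
        \<le> (\<integral>\<^sup>+\<zeta>. radial_max (tail_coeffs N a) \<zeta> \<partial>circle)"
      by (intro nn_integral_mono INF_lower) simp
    also have "\<dots> \<le> ennreal (32\<^sup>2 * ?S N)"
      using nn_integral_radial_max[OF sums_summable[OF tail_coeffs_sums[OF a, of N]]]
        tail_coeffs_sums[OF a, of N] by (simp add: sums_iff)
    finally show ?thesis .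
  qed
  have "(\<integral>\<^sup>+\<zeta>. (INF N. radial_max (tail_coeffs N a) \<zeta>) \<partial>circle) \<le> 0"
    by (rule LIMSEQ_le_const[OF lim]) (use le in blast)
  then have "AE \<zeta> in circle. (INF N. radial_max (tail_coeffs N a) \<zeta>) = 0"
    by (subst (asm) le_zero_eq, subst (asm) nn_integral_0_iff_AE) auto
  then show ?thesis
  proof eventually_elim
    case (elim \<zeta>)
    show ?case
    proof (intro allI impI)
      fix e :: ennreal assume "0 < e"
      then have "(INF N. radial_max (tail_coeffs N a) \<zeta>) < e" using elim by simp
      then show "\<exists>N. radial_max (tail_coeffs N a) \<zeta> < e" by (simp add: INF_less_iff)
    qed
  qed
qed

lemma eventually_at_left_1: "t < 1 \<Longrightarrow> eventually (\<lambda>r::real. t < r \<and> r < 1) (at_left 1)"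
  by (rule eventually_at_leftI[of t]) auto

text \<open>
  Fatou's theorem for square summable coefficients.  The function is a polynomial, which has radial
  limits, plus a tail that is uniformly small along the whole radius; so the radial values satisfy
  the Cauchy criterion.
\<close>

lemma AE_radial_limit:
  assumes a: "sq_summable a"
  shows "AE \<zeta> in circle. \<exists>l. ((\<lambda>r. disc_series a (of_real r * \<zeta>)) \<longlongrightarrow> l) (at_left 1)"
  using AE_small_radial_max[OF a] AE_circle_norm
proof eventually_elim
  case (elim \<zeta>)
  show ?case
  proof (rule convergent_at_left_1)
    fix e :: real assume e: "e > 0"
    have "0 < ennreal ((e/4)\<^sup>2)" using e by simp
    with elim obtain N where N: "radial_max (tail_coeffs N a) \<zeta> < ennreal ((e/4)\<^sup>2)" by blast
    define p where "p z = (\<Sum>n<N. a n * z ^ n)" for z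
    have t: "sq_summable (tail_coeffs N a)"
      using tail_coeffs_sums[OF a] by (rule sums_summable)
    have h: "cmod (disc_series (tail_coeffs N a) (of_real r * \<zeta>)) \<le> e/4" if r: "0 < r" "r < 1" for r
    proof -
      have "(cmod (disc_series (tail_coeffs N a) (of_real r * \<zeta>)))\<^sup>2 \<le> (e/4)\<^sup>2"
        using r elim N e by (intro radial_max_upper[OF t]) auto
      then show ?thesis using e by (simp add: power2_le_iff_abs_le)
    qed
    have "((\<lambda>r. p (of_real r * \<zeta>)) \<longlongrightarrow> p (of_real 1 * \<zeta>)) (at_left 1)"
      unfolding p_def by (intro tendsto_intros)
    then have ev: "eventually (\<lambda>r. dist (p (of_real r * \<zeta>)) (p (of_real 1 * \<zeta>)) < e/4) (at_left 1)"
      using e by (intro tendstoD) auto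
    let ?P = "\<lambda>r::real. (0 < r \<and> r < 1) \<and> dist (p (of_real r * \<zeta>)) (p (of_real 1 * \<zeta>)) < e/4"
    have "eventually ?P (at_left 1)"
      by (intro eventually_conj eventually_at_left_1 ev) simp
    moreover have "dist (disc_series a (of_real x * \<zeta>)) (disc_series a (of_real y * \<zeta>)) < e"
        if "?P x \<and> ?P y" for x y
    proof -
      have d: "disc_series a (of_real r * \<zeta>) = p (of_real r * \<zeta>)
          + disc_series (tail_coeffs N a) (of_real r * \<zeta>)"
        if "0 < r" "r < 1" for r
        unfolding p_def using that elim by (intro disc_series_tail a) (simp add: norm_mult)
      let ?h = "\<lambda>r::real. disc_series (tail_coeffs N a) (of_real r * \<zeta>)"
      have "dist (disc_series a (of_real x * \<zeta>)) (disc_series a (of_real y * \<zeta>))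
          \<le> dist (p (of_real x * \<zeta>)) (p (of_real y * \<zeta>)) + dist (?h x) (?h y)"
        using that d by (simp add: dist_triangle_add)
      also have "dist (p (of_real x * \<zeta>)) (p (of_real y * \<zeta>)) < e/4 + e/4"
        using that by (intro dist_triangle_less_add[where y="p (of_real 1 * \<zeta>)"]) (auto simp: dist_commute)
      also have "dist (?h x) (?h y) \<le> e/4 + e/4"
        unfolding dist_norm using that h by (intro order_trans[OF norm_triangle_ineq4] add_mono) auto
      finally show ?thesis by simp
    qed
    ultimately show "\<exists>P. eventually P (at_left 1) \<and>
        (\<forall>x y. P x \<and> P y \<longrightarrow> dist (disc_series a (of_real x * \<zeta>)) (disc_series a (of_real y * \<zeta>)) < e)"
      by blast
  qed
qed

text \<open>A sequence of radii increasing to \<open>1\<close>, for use with dominated convergence.\<close>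

definition radii :: "nat \<Rightarrow> real" where "radii n = 1 - inverse (real (Suc n))"

lemma radii_range: "0 \<le> radii n" "radii n < 1"
  by (auto simp: radii_def field_simps)

lemma radii_lim: "filterlim radii (at_left 1) sequentially"
proof (rule tendsto_imp_filterlim_at_left)
  show "radii \<longlonglongrightarrow> 1"
    unfolding radii_def using tendsto_diff[OF tendsto_const[of 1] LIMSEQ_inverse_real_of_nat] by simp
qed (simp add: radii_range)

text \<open>
  The Cauchy criterion along rational radii: a countable condition, which shows that the set of points
  with a radial limit is Borel.
\<close>

lemma radial_limit_iff:
  assumes f: "continuous_on (ball 0 1) f" and z: "cmod \<zeta> \<le> 1"
  shows "(\<exists>l. ((\<lambda>r. f (of_real r * \<zeta>)) \<longlongrightarrow> l) (at_left 1)) \<longleftrightarrow>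
    (\<forall>k. \<exists>N. \<forall>i j. radii N < rat_radii i \<longrightarrow> radii N < rat_radii j \<longrightarrow>
       cmod (f (of_real (rat_radii i) * \<zeta>) - f (of_real (rat_radii j) * \<zeta>)) \<le> inverse (real (Suc k)))"
    (is "?L \<longleftrightarrow> ?R")
proof
  assume R: ?R
  show ?L
  proof (rule convergent_at_left_1)
    fix e :: real assume "e > 0"
    then obtain k where k: "inverse (real (Suc k)) < e" using reals_Archimedean by blast
    from R obtain N where N: "\<And>i j. radii N < rat_radii i \<Longrightarrow> radii N < rat_radii j \<Longrightarrow>
       cmod (f (of_real (rat_radii i) * \<zeta>) - f (of_real (rat_radii j) * \<zeta>)) \<le> inverse (real (Suc k))"
      by blast
    have c: "continuous_on {0..<1::real} (\<lambda>r. f (of_real r * \<zeta>))"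
      by (rule continuous_on_radius[OF f z])
    have 1: "cmod (f (of_real x * \<zeta>) - f (of_real (rat_radii j) * \<zeta>)) \<le> inverse (real (Suc k))"
      if "radii N < x" "x < 1" "radii N < rat_radii j" for x j
    proof (rule rat_radii_dense[where t="radii N" and g="\<lambda>x. cmod (f (of_real x * \<zeta>)
        - f (of_real (rat_radii j) * \<zeta>))"])
      show "continuous_on {0..<1} (\<lambda>x. cmod (f (of_real x * \<zeta>) - f (of_real (rat_radii j) * \<zeta>)))"
        by (intro continuous_intros c)
    qed (use that N radii_range[of N] in auto)
    have 2: "cmod (f (of_real x * \<zeta>) - f (of_real y * \<zeta>)) \<le> inverse (real (Suc k))"
      if "radii N < x" "x < 1" "radii N < y" "y < 1" for x y
    proof (rule rat_radii_dense[where t="radii N" and g="\<lambda>y. cmod (f (of_real x * \<zeta>)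
        - f (of_real y * \<zeta>))"])
      show "continuous_on {0..<1} (\<lambda>y. cmod (f (of_real x * \<zeta>) - f (of_real y * \<zeta>)))"
        by (intro continuous_intros c)
    qed (use that 1 radii_range[of N] in auto)
    have "eventually (\<lambda>x. radii N < x \<and> x < 1) (at_left 1)"
      by (rule eventually_at_left_1) (rule radii_range)
    moreover have "dist (f (of_real x * \<zeta>)) (f (of_real y * \<zeta>)) < e"
      if "(radii N < x \<and> x < 1) \<and> (radii N < y \<and> y < 1)" for x y
      using 2[of x y] that k unfolding dist_norm by linarith
    ultimately show "\<exists>P. eventually P (at_left 1) \<and>
        (\<forall>x y. P x \<and> P y \<longrightarrow> dist (f (of_real x * \<zeta>)) (f (of_real y * \<zeta>)) < e)"
      by blast
  qed
next
  assume ?L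
  then obtain l where l: "((\<lambda>r. f (of_real r * \<zeta>)) \<longlongrightarrow> l) (at_left 1)" by blast
  show ?R
  proof
    fix k
    have "eventually (\<lambda>r. dist (f (of_real r * \<zeta>)) l < inverse (real (Suc k)) / 2) (at_left 1)"
      using l by (rule tendstoD) simp
    then obtain b where b: "b < 1" "\<And>r. b < r \<Longrightarrow> r < 1
        \<Longrightarrow> dist (f (of_real r * \<zeta>)) l < inverse (real (Suc k)) / 2"
      by (auto simp: eventually_at_left_field)
    obtain N where "inverse (real (Suc N)) < 1 - b" using b(1) reals_Archimedean[of "1 - b"] by auto
    then have N: "b < radii N" by (simp add: radii_def)
    have "cmod (f (of_real (rat_radii i) * \<zeta>) - f (of_real (rat_radii j) * \<zeta>)) \<le> inverse (real (Suc k))"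
      if "radii N < rat_radii i" "radii N < rat_radii j" for i j
    proof -
      have "dist (f (of_real (rat_radii i) * \<zeta>)) (f (of_real (rat_radii j) * \<zeta>))
          < inverse (real (Suc k)) / 2 + inverse (real (Suc k)) / 2"
        using that N b(2)[of "rat_radii i"] b(2)[of "rat_radii j"] rat_radii_range
        by (intro dist_triangle_less_add[where y=l]) (auto simp: dist_commute)
      then show ?thesis by (simp add: dist_norm)
    qed
    then show "\<exists>N. \<forall>i j. radii N < rat_radii i \<longrightarrow> radii N < rat_radii j \<longrightarrow>
       cmod (f (of_real (rat_radii i) * \<zeta>) - f (of_real (rat_radii j) * \<zeta>)) \<le> inverse (real (Suc k))"
      by blast
  qed
qed

lemma bdry_eq: "((\<lambda>r. f (of_real r * \<zeta>)) \<longlongrightarrow> l) (at_left 1) \<Longrightarrow> bdry f \<zeta> = l"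
  unfolding bdry_def by (rule tendsto_Lim) simp

lemma disc_fun_borel:
  assumes f: "continuous_on (ball 0 1) f" and out: "\<And>z. z \<notin> ball 0 1 \<Longrightarrow> f z = (0::complex)"
  shows "f \<in> borel_measurable borel"
proof -
  have "f = (\<lambda>z. if z \<in> ball 0 1 then f z else 0)" using out by (auto simp: fun_eq_iff)
  also have "\<dots> \<in> borel_measurable borel"
    by (rule borel_measurable_continuous_on_if) (use f in auto)
  finally show ?thesis .
qed

text \<open>
  Off the Borel set where the radial limit exists, \<open>bdry f\<close> takes one fixed default value, that of the
  empty definite description; and outside the closed disc the radial values are eventually \<open>0\<close>.  On
  the remaining set it is the limit along a sequence of radii.
\<close>

lemma bdry_borel:
  assumes f: "continuous_on (ball 0 1) f" and out: "\<And>z. z \<notin> ball 0 1 \<Longrightarrow> f z = 0"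
  shows "bdry f \<in> borel_measurable borel"
proof -
  note [measurable] = disc_fun_borel[OF f out]
  define Q where "Q \<zeta> \<longleftrightarrow> (\<forall>k. \<exists>N. \<forall>i j. radii N < rat_radii i \<longrightarrow> radii N < rat_radii j \<longrightarrow>
       cmod (f (of_real (rat_radii i) * \<zeta>) - f (of_real (rat_radii j) * \<zeta>))
           \<le> inverse (real (Suc k)))" for \<zeta>
  have Q: "(\<exists>l. ((\<lambda>r. f (of_real r * \<zeta>)) \<longlongrightarrow> l) (at_left 1)) \<longleftrightarrow> Q \<zeta>" if "cmod \<zeta> \<le> 1" for \<zeta>
    unfolding Q_def by (rule radial_limit_iff[OF f that])
  have [measurable]: "Measurable.pred borel Q" unfolding Q_def by measurable
  have "bdry f = (\<lambda>\<zeta>. if 1 < cmod \<zeta> then 0 else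
      if Q \<zeta> then lim (\<lambda>n. f (of_real (radii n) * \<zeta>)) else (THE l. False))"
  proof
    fix \<zeta>
    consider "1 < cmod \<zeta>" | "cmod \<zeta> \<le> 1" "Q \<zeta>" | "cmod \<zeta> \<le> 1" "\<not> Q \<zeta>" by linarith
    then show "bdry f \<zeta> = (if 1 < cmod \<zeta> then 0 else
        if Q \<zeta> then lim (\<lambda>n. f (of_real (radii n) * \<zeta>)) else (THE l. False))"
    proof cases
      case 1
      have "eventually (\<lambda>r. 1 / cmod \<zeta> < r \<and> r < 1) (at_left 1)"
        using 1 by (intro eventually_at_left_1) (auto simp: divide_less_eq)
      then have "eventually (\<lambda>r. f (of_real r * \<zeta>) = 0) (at_left 1)"
      proof eventually_elim
        case (elim r)
        have "0 < 1 / cmod \<zeta>" using 1 by (intro divide_pos_pos) auto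
        then have "0 < r" using elim by linarith
        have "1 < r * cmod \<zeta>" using elim 1 by (auto simp: divide_less_eq split: if_splits)
        with \<open>0 < r\<close> show ?case by (intro out) (simp add: norm_mult)
      qed
      then have "bdry f \<zeta> = 0" by (intro bdry_eq tendsto_eventually)
      then show ?thesis using 1 by simp
    next
      case 2
      then obtain l where l: "((\<lambda>r. f (of_real r * \<zeta>)) \<longlongrightarrow> l) (at_left 1)"
        using Q by blast
      have "(\<lambda>n. f (of_real (radii n) * \<zeta>)) \<longlonglongrightarrow> l"
        using filterlim_compose[OF l radii_lim] .
      then show ?thesis using 2 bdry_eq[where f=f and \<zeta>=\<zeta>, OF l] by (auto simp: limI)
    next
      case 3
      then have "\<not> ((\<lambda>r. f (of_real r * \<zeta>)) \<longlongrightarrow> l) (at_left 1)" for l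
        using Q by blast
      then show ?thesis using 3 by (simp add: bdry_def t2_space_class.Lim_def)
    qed
  qed
  also have "\<dots> \<in> borel_measurable borel" by measurable
  finally show ?thesis .
qed

section \<open>\<open>H2\<close> as a space of square summable power series\<close>

lemma AE_disc_series_dilate:
  assumes r: "0 \<le> r" "r < 1"
  shows "AE \<zeta> in circle. disc_series a (of_real r * \<zeta>) = abs_series (\<lambda>n. a n * of_real r ^ n) \<zeta>"
  using AE_circle_norm by eventually_elim (rule disc_series_dilate[OF r], simp)

lemma integral_norm_disc_series_dilate:
  assumes c: "summable (\<lambda>n. cmod (a n * of_real r ^ n))" and r: "0 \<le> r" "r < 1"
  shows "(\<lambda>n. (cmod (a n * of_real r ^ n))\<^sup>2) sums (\<integral>\<zeta>. (cmod (disc_series a (of_real r * \<zeta>)))\<^sup>2 \<partial>circle)"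
proof -
  have "(\<integral>\<zeta>. (cmod (disc_series a (of_real r * \<zeta>)))\<^sup>2 \<partial>circle)
      = (\<integral>\<zeta>. (cmod (abs_series (\<lambda>n. a n * of_real r ^ n) \<zeta>))\<^sup>2 \<partial>circle)"
  proof (rule integral_cong_AE)
    show "AE \<zeta> in circle. (cmod (disc_series a (of_real r * \<zeta>)))\<^sup>2
        = (cmod (abs_series (\<lambda>n. a n * of_real r ^ n) \<zeta>))\<^sup>2"
      using AE_disc_series_dilate[OF r, of a] by eventually_elim simp
  qed measurable
  then show ?thesis using integral_norm_abs_series[OF c] by simp
qed

lemma sq_summable_dilate:
  "sq_summable a \<Longrightarrow> 0 \<le> r \<Longrightarrow> r < 1 \<Longrightarrow> summable (\<lambda>n. cmod (a n * of_real r ^ n))"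
  by (rule sq_summable_power) simp_all

lemma disc_series_in_H2:
  assumes a: "sq_summable a" shows "disc_series a \<in> H2"
proof -
  have "bdd_above ((\<lambda>r. \<integral>\<zeta>. (cmod (disc_series a (of_real r * \<zeta>)))\<^sup>2 \<partial>circle) ` {0..<1})"
  proof (rule bdd_aboveI2)
    fix r :: real assume r: "r \<in> {0..<1}"
    then show "(\<integral>\<zeta>. (cmod (disc_series a (of_real r * \<zeta>)))\<^sup>2 \<partial>circle) \<le> (\<Sum>n. (cmod (a n))\<^sup>2)"
      using integral_norm_disc_series_dilate[OF sq_summable_dilate[OF a], of r]
        suminf_dilate_le(2)[OF a, of r] by (simp add: sums_iff)
  qed
  then show ?thesis
    using disc_series_holomorphic[OF a] by (simp add: H2_def disc_series_def)
qed

text \<open>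
  Parseval on the circle of radius \<open>r\<close> bounds the weighted partial sums of the squared Taylor
  coefficients; let \<open>r\<close> tend to \<open>1\<close>.
\<close>

lemma H2_coeffs:
  assumes f: "f \<in> H2"
  obtains a where "sq_summable a" "f = disc_series a"
proof -
  define a where "a n = (deriv ^^ n) f 0 / fact n" for n
  have fh: "f holomorphic_on ball 0 1" and out: "\<And>z. z \<notin> ball 0 1 \<Longrightarrow> f z = 0"
    using f by (auto simp: H2_def)
  have s: "(\<lambda>n. a n * z ^ n) sums f z" if "z \<in> ball 0 1" for z
    using holomorphic_power_series[OF fh that] by (simp add: a_def)
  have eq: "f = disc_series a"
  proof
    fix z show "f z = disc_series a z"
      using s[of z] out[of z] by (auto simp: disc_series_def abs_series_def sums_iff)
  qed
  have "bdd_above ((\<lambda>r. \<integral>\<zeta>. (cmod (f (of_real r * \<zeta>)))\<^sup>2 \<partial>circle) ` {0..<1})"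
    using f by (simp add: H2_def)
  then obtain B where B: "\<And>r. r \<in> {0..<1} \<Longrightarrow> (\<integral>\<zeta>. (cmod (f (of_real r * \<zeta>)))\<^sup>2 \<partial>circle) \<le> B"
    unfolding bdd_above_def by blast
  have part: "(\<Sum>n<N. (cmod (a n * of_real r ^ n))\<^sup>2) \<le> B" if r: "r \<in> {0..<1}" for N r
  proof -
    have c: "summable (\<lambda>n. cmod (a n * of_real r ^ n))"
    proof (rule powser_insidea)
      have n: "cmod (complex_of_real r) = r" "cmod (complex_of_real ((1 + r) / 2)) = (1 + r) / 2"
        using r by (simp_all only: norm_of_real) auto
      then have "complex_of_real ((1 + r) / 2) \<in> ball 0 1"
        using r by (simp del: of_real_add of_real_divide)
      then show "summable (\<lambda>n. a n * (of_real ((1 + r) / 2)) ^ n)"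
        using s sums_summable by blast
      show "norm (complex_of_real r) < norm (complex_of_real ((1 + r) / 2))"
        unfolding n using r by simp
    qed
    have i: "(\<lambda>n. (cmod (a n * of_real r ^ n))\<^sup>2) sums (\<integral>\<zeta>. (cmod (disc_series a (of_real r * \<zeta>)))\<^sup>2 \<partial>circle)"
      using integral_norm_disc_series_dilate[OF c] r by simp
    have "(\<Sum>n<N. (cmod (a n * of_real r ^ n))\<^sup>2) \<le> (\<Sum>n. (cmod (a n * of_real r ^ n))\<^sup>2)"
      by (rule sum_le_suminf[OF sums_summable[OF i]]) auto
    also have "\<dots> \<le> B" using i B[OF r] by (simp add: sums_iff eq)
    finally show ?thesis .
  qed
  have "(\<Sum>n<N. (cmod (a n))\<^sup>2) \<le> B" for N
  proof (rule LIMSEQ_le_const2)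
    have "radii \<longlonglongrightarrow> 1" using radii_lim by (simp add: filterlim_at)
    then have "(\<lambda>k. \<Sum>n<N. (cmod (a n * of_real (radii k) ^ n))\<^sup>2)
        \<longlonglongrightarrow> (\<Sum>n<N. (cmod (a n * of_real 1 ^ n))\<^sup>2)"
      by (intro tendsto_intros)
    then show "(\<lambda>k. \<Sum>n<N. (cmod (a n * of_real (radii k) ^ n))\<^sup>2) \<longlonglongrightarrow> (\<Sum>n<N. (cmod (a n))\<^sup>2)"
      by simp
    show "\<exists>N'. \<forall>k\<ge>N'. (\<Sum>n<N. (cmod (a n * of_real (radii k) ^ n))\<^sup>2) \<le> B"
      using part radii_range by auto
  qed
  then have "sq_summable a"
    by (intro summableI_nonneg_bounded) auto
  then show thesis using eq that by blast
qed

lemma H2_holomorphic: "f \<in> H2 \<Longrightarrow> f holomorphic_on ball 0 1"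
  and H2_outside: "f \<in> H2 \<Longrightarrow> z \<notin> ball 0 1 \<Longrightarrow> f z = 0"
  by (auto simp: H2_def)

lemma H2_borel: "f \<in> H2 \<Longrightarrow> f \<in> borel_measurable borel"
  by (rule disc_fun_borel) (auto simp: H2_def holomorphic_on_imp_continuous_on)

lemma bdry_H2_borel: "f \<in> H2 \<Longrightarrow> bdry f \<in> borel_measurable borel"
  by (rule bdry_borel) (auto simp: H2_def holomorphic_on_imp_continuous_on)

lemma bdry_radial_limit:
  assumes "f \<in> H2"
  shows "AE \<zeta> in circle. ((\<lambda>r. f (of_real r * \<zeta>)) \<longlongrightarrow> bdry f \<zeta>) (at_left 1)"
proof -
  obtain a where a: "sq_summable a" "f = disc_series a" using H2_coeffs[OF assms] .
  show ?thesis
    using AE_radial_limit[OF a(1)] unfolding a(2)[symmetric]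
  proof eventually_elim
    case (elim \<zeta>)
    then obtain l where l: "((\<lambda>r. f (of_real r * \<zeta>)) \<longlongrightarrow> l) (at_left 1)" by blast
    then show ?case using bdry_eq[where f=f and \<zeta>=\<zeta>, OF l] by simp
  qed
qed

text \<open>
  The maximal function serves as an integrable majorant for the squares of all dilations.
\<close>

lemma H2_dominated:
  assumes "f \<in> H2"
  obtains m where "integrable circle m" "AE \<zeta> in circle. \<forall>n. (cmod (f (of_real (radii n) * \<zeta>)))\<^sup>2 \<le> m \<zeta>"
proof -
  obtain a where a: "sq_summable a" "f = disc_series a" using H2_coeffs[OF assms] .
  define m where "m \<zeta> = enn2real (radial_max a \<zeta>)" for \<zeta>
  have fin: "(\<integral>\<^sup>+\<zeta>. radial_max a \<zeta> \<partial>circle) < \<infinity>"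
    using nn_integral_radial_max[OF a(1)] by (rule le_less_trans) simp
  have AEfin: "AE \<zeta> in circle. radial_max a \<zeta> \<noteq> \<infinity>"
    by (rule nn_integral_PInf_AE) (use fin in auto)
  have "integrable circle m"
  proof (rule integrableI_bounded)
    have "(\<integral>\<^sup>+\<zeta>. ennreal (norm (m \<zeta>)) \<partial>circle) = (\<integral>\<^sup>+\<zeta>. radial_max a \<zeta> \<partial>circle)"
      using AEfin by (intro nn_integral_cong_AE, elim eventually_mono) (simp add: m_def less_top)
    then show "(\<integral>\<^sup>+\<zeta>. ennreal (norm (m \<zeta>)) \<partial>circle) < \<infinity>" using fin by simp
  qed (unfold m_def, measurable)
  moreover have "AE \<zeta> in circle. \<forall>n. (cmod (f (of_real (radii n) * \<zeta>)))\<^sup>2 \<le> m \<zeta>"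
    using AEfin AE_circle_norm
  proof eventually_elim
    case (elim \<zeta>)
    then show ?case unfolding a(2)
      by (intro allI radial_max_upper[OF a(1)]) (auto simp: m_def radii_range less_top)
  qed
  ultimately show thesis by (rule that)
qed

lemma bdry_LIMSEQ:
  assumes "f \<in> H2"
  shows "AE \<zeta> in circle. (\<lambda>n. f (of_real (radii n) * \<zeta>)) \<longlonglongrightarrow> bdry f \<zeta>"
  using bdry_radial_limit[OF assms] by eventually_elim (rule filterlim_compose[OF _ radii_lim])

lemma sq_integrable_bdry:
  assumes f: "f \<in> H2" shows "sq_integrable (bdry f)"
proof -
  have [measurable]: "f \<in> borel_measurable borel" "bdry f \<in> borel_measurable borel"
    using H2_borel bdry_H2_borel f by auto
  obtain m where m: "integrable circle m" "AE \<zeta> in circle. \<forall>n. (cmod (f (of_real (radii n) * \<zeta>)))\<^sup>2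
      \<le> m \<zeta>"
    using H2_dominated[OF f] .
  have "integrable circle (\<lambda>\<zeta>. (cmod (bdry f \<zeta>))\<^sup>2)"
  proof (rule integrable_dominated_convergence[OF _ _ m(1)])
    show "AE \<zeta> in circle. (\<lambda>n. (cmod (f (of_real (radii n) * \<zeta>)))\<^sup>2) \<longlonglongrightarrow> (cmod (bdry f \<zeta>))\<^sup>2"
      using bdry_LIMSEQ[OF f] by eventually_elim (intro tendsto_intros)
    show "AE \<zeta> in circle. norm ((cmod (f (of_real (radii n) * \<zeta>)))\<^sup>2) \<le> m \<zeta>" for n
      using m(2) by eventually_elim simp
  qed measurable
  then show ?thesis by (simp add: sq_integrable_def)
qed

text \<open>
  Inner products with boundary values are limits of inner products with the dilations, where power
  series converge absolutely; the Taylor coefficients are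
  recovered from the boundary values through this limit.
\<close>

lemma L2_inner_bdry_limit:
  assumes f: "f \<in> H2" and g: "sq_integrable g"
  shows "(\<lambda>n. \<integral>\<zeta>. f (of_real (radii n) * \<zeta>) * cnj (g \<zeta>) \<partial>circle) \<longlonglongrightarrow> L2_inner (bdry f) g"
proof -
  have [measurable]: "f \<in> borel_measurable borel" "bdry f \<in> borel_measurable borel" "g \<in> borel_measurable borel"
    using H2_borel bdry_H2_borel f g by (auto simp: sq_integrable_def)
  obtain m where m: "integrable circle m" "AE \<zeta> in circle. \<forall>n. (cmod (f (of_real (radii n) * \<zeta>)))\<^sup>2
      \<le> m \<zeta>"
    using H2_dominated[OF f] .
  show ?thesis
    unfolding L2_inner_def
  proof (rule integral_dominated_convergence)
    show "integrable circle (\<lambda>\<zeta>. m \<zeta> + (cmod (g \<zeta>))\<^sup>2)"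
      using m(1) g by (simp add: sq_integrable_def)
    show "AE \<zeta> in circle. (\<lambda>n. f (of_real (radii n) * \<zeta>) * cnj (g \<zeta>)) \<longlonglongrightarrow> bdry f \<zeta> * cnj (g \<zeta>)"
      using bdry_LIMSEQ[OF f] by eventually_elim (intro tendsto_intros)
    show "AE \<zeta> in circle. norm (f (of_real (radii n) * \<zeta>) * cnj (g \<zeta>)) \<le> m \<zeta> + (cmod (g \<zeta>))\<^sup>2" for n
      using m(2)
    proof eventually_elim
      case (elim \<zeta>)
      let ?x = "cmod (f (of_real (radii n) * \<zeta>))" and ?y = "cmod (g \<zeta>)"
      have "?x * ?y \<le> ?x\<^sup>2 + ?y\<^sup>2" by (rule mult_le_sum_squares) simp_all
      moreover have "?x\<^sup>2 \<le> m \<zeta>" using elim by blast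
      ultimately show ?case unfolding norm_mult complex_mod_cnj by linarith
    qed
  qed measurable
qed

lemma integral_disc_series_dilate:
  assumes a: "sq_summable a" and g: "sq_integrable g" and r: "0 \<le> r" "r < 1"
  shows "(\<lambda>k. a k * of_real r ^ k * L2_inner (\<lambda>\<zeta>. \<zeta> ^ k) g) sums (\<integral>\<zeta>. disc_series a (of_real r * \<zeta>) * cnj (g \<zeta>) \<partial>circle)"
proof -
  have [measurable]: "g \<in> borel_measurable borel" using g by (simp add: sq_integrable_def)
  note ig = sq_integrable_integrable_cnj[OF g]
  have "(\<integral>\<zeta>. disc_series a (of_real r * \<zeta>) * cnj (g \<zeta>) \<partial>circle)
      = (\<integral>\<zeta>. abs_series (\<lambda>n. a n * of_real r ^ n) \<zeta> * cnj (g \<zeta>) \<partial>circle)"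
  proof (rule integral_cong_AE)
    show "AE \<zeta> in circle. disc_series a (of_real r * \<zeta>) * cnj (g \<zeta>)
        = abs_series (\<lambda>n. a n * of_real r ^ n) \<zeta> * cnj (g \<zeta>)"
      using AE_disc_series_dilate[OF r, of a] by eventually_elim simp
  qed measurable
  then show ?thesis
    using integral_abs_series[OF sq_summable_dilate[OF a r] ig] by (simp add: L2_inner_def)
qed

lemma sq_integrable_power: "sq_integrable (\<lambda>\<zeta>. \<zeta> ^ k)"
proof (rule sq_integrable_bounded)
  show "AE \<zeta> in circle. cmod (\<zeta> ^ k) \<le> 1"
    using AE_circle_norm by eventually_elim (simp add: norm_power)
qed measurable

lemma L2_inner_bdry_power:
  assumes a: "sq_summable a"
  shows "L2_inner (bdry (disc_series a)) (\<lambda>\<zeta>. \<zeta> ^ m) = a m"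
proof -
  have "(\<integral>\<zeta>. disc_series a (of_real r * \<zeta>) * cnj (\<zeta> ^ m) \<partial>circle) = a m * of_real r ^ m" if r: "0
      \<le> r" "r < 1" for r
  proof -
    have "(\<lambda>k. a k * of_real r ^ k * L2_inner (\<lambda>\<zeta>. \<zeta> ^ k) (\<lambda>\<zeta>. \<zeta> ^ m)) = (\<lambda>k. if k
        = m then a k * of_real r ^ k else 0)"
      unfolding L2_inner_def integral_powers by (simp add: fun_eq_iff)
    then show ?thesis
      using integral_disc_series_dilate[OF a sq_integrable_power[of m] r] sums_unique2[OF sums_single[of m "\<lambda>k. a k * of_real r ^ k"]]
      by simp
  qed
  then have "(\<lambda>n. a m * of_real (radii n) ^ m) \<longlonglongrightarrow> L2_inner (bdry (disc_series a)) (\<lambda>\<zeta>. \<zeta> ^ m)"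
    using L2_inner_bdry_limit[OF disc_series_in_H2[OF a] sq_integrable_power[of m]] radii_range by simp
  moreover have "(\<lambda>n. a m * of_real (radii n) ^ m) \<longlonglongrightarrow> a m * of_real 1 ^ m"
  proof -
    have "radii \<longlonglongrightarrow> 1" using radii_lim by (simp add: filterlim_at)
    then show ?thesis by (intro tendsto_intros)
  qed
  ultimately show ?thesis using LIMSEQ_unique by fastforce
qed

text \<open>In effect, the powers of \<open>\<zeta>\<close> span a dense subspace of the boundary values of \<open>H2\<close>.\<close>

lemma L2_inner_bdry_eq_0:
  assumes f: "f \<in> H2" and g: "sq_integrable g" and orth: "\<And>k. L2_inner (\<lambda>\<zeta>. \<zeta> ^ k) g = 0"
  shows "L2_inner (bdry f) g = 0"
proof -
  obtain a where a: "sq_summable a" "f = disc_series a" using H2_coeffs[OF f] .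
  have "(\<integral>\<zeta>. f (of_real (radii n) * \<zeta>) * cnj (g \<zeta>) \<partial>circle) = 0" for n
    using integral_disc_series_dilate[OF a(1) g, of "radii n"] radii_range sums_unique2[OF sums_zero]
    by (simp add: orth a(2))
  then show ?thesis
    using L2_inner_bdry_limit[OF f g] by (simp add: LIMSEQ_const_iff)
qed

lemma L2_inner_cong:
  assumes "AE \<zeta> in circle. f \<zeta> = f' \<zeta>" "AE \<zeta> in circle. g \<zeta> = g' \<zeta>"
    and "sq_integrable f" "sq_integrable f'" "sq_integrable g" "sq_integrable g'"
  shows "L2_inner f g = L2_inner f' g'"
  unfolding L2_inner_def
proof (rule integral_cong_AE)
  show "AE \<zeta> in circle. f \<zeta> * cnj (g \<zeta>) = f' \<zeta> * cnj (g' \<zeta>)"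
    using assms(1,2) by eventually_elim simp
  have [measurable]: "f \<in> borel_measurable borel" "f' \<in> borel_measurable borel"
    "g \<in> borel_measurable borel" "g' \<in> borel_measurable borel" using assms by (auto simp: sq_integrable_def)
  show "(\<lambda>\<zeta>. f \<zeta> * cnj (g \<zeta>)) \<in> borel_measurable circle" "(\<lambda>\<zeta>. f' \<zeta> * cnj (g' \<zeta>)) \<in> borel_measurable circle"
    by measurable
qed

lemma L2_inner_add_left:
  "sq_integrable f \<Longrightarrow> sq_integrable f' \<Longrightarrow> sq_integrable g \<Longrightarrow> L2_inner (\<lambda>\<zeta>. f \<zeta> + f' \<zeta>) g
      = L2_inner f g + L2_inner f' g"
  unfolding L2_inner_def
  by (simp add: distrib_right Bochner_Integration.integral_add sq_integrable_integrable_inner)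

lemma L2_inner_diff_left:
  "sq_integrable f \<Longrightarrow> sq_integrable f' \<Longrightarrow> sq_integrable g \<Longrightarrow> L2_inner (\<lambda>\<zeta>. f \<zeta> - f' \<zeta>) g
      = L2_inner f g - L2_inner f' g"
  unfolding L2_inner_def
  by (simp add: left_diff_distrib Bochner_Integration.integral_diff sq_integrable_integrable_inner)

lemma L2_inner_minus_left:
  "sq_integrable f \<Longrightarrow> sq_integrable f' \<Longrightarrow> sq_integrable g \<Longrightarrow> L2_inner (f - f') g
      = L2_inner f g - L2_inner f' g"
  unfolding fun_diff_def by (rule L2_inner_diff_left)

lemma L2_inner_cmult_left: "L2_inner (\<lambda>\<zeta>. c * f \<zeta>) g = c * L2_inner f g"
  unfolding L2_inner_def by (simp add: mult.assoc)

lemma L2_inner_self: "L2_inner f f = of_real (\<integral>\<zeta>. (cmod (f \<zeta>))\<^sup>2 \<partial>circle)"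
  unfolding L2_inner_def by (simp only: complex_norm_square[symmetric] integral_complex_of_real)

lemma H2_add:
  assumes "f \<in> H2" "g \<in> H2" shows "f + g \<in> H2"
proof -
  obtain a where a: "sq_summable a" "f = disc_series a" using H2_coeffs[OF assms(1)] .
  obtain b where b: "sq_summable b" "g = disc_series b" using H2_coeffs[OF assms(2)] .
  have s: "summable (\<lambda>n. 2 * (cmod (a n))\<^sup>2 + 2 * (cmod (b n))\<^sup>2)"
    by (intro summable_add summable_mult a b)
  have ab: "sq_summable (\<lambda>n. a n + b n)"
    by (rule summable_comparison_test'[OF s, of 0]) (simp add: cmod_add_square_le)
  have "f + g = disc_series (\<lambda>n. a n + b n)"
  proof
    fix z
    show "(f + g) z = disc_series (\<lambda>n. a n + b n) z"
    proof (cases "z \<in> ball 0 1")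
      case True
      have "(\<lambda>n. (a n + b n) * z ^ n) sums (f z + g z)"
        using sums_add[OF disc_series_sums[OF a(1) True] disc_series_sums[OF b(1) True]]
        by (simp add: a b distrib_right)
      then show ?thesis using sums_unique2[OF disc_series_sums[OF ab True]] by simp
    qed (simp add: a b disc_series_outside)
  qed
  then show ?thesis using disc_series_in_H2[OF ab] by simp
qed

lemma fscale_H2:
  assumes "f \<in> H2" shows "c *\<^sub>F f \<in> H2"
proof -
  obtain a where a: "sq_summable a" "f = disc_series a" using H2_coeffs[OF assms(1)] .
  have ca: "sq_summable (\<lambda>n. c * a n)"
    unfolding norm_mult power_mult_distrib by (intro summable_mult a)
  have "c *\<^sub>F f = disc_series (\<lambda>n. c * a n)"
  proof
    fix z
    show "(c *\<^sub>F f) z = disc_series (\<lambda>n. c * a n) z"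
    proof (cases "z \<in> ball 0 1")
      case True
      have "(\<lambda>n. c * a n * z ^ n) sums (c * f z)"
        using sums_mult[OF disc_series_sums[OF a(1) True], of c] by (simp add: a mult.assoc)
      then show ?thesis using sums_unique2[OF disc_series_sums[OF ca True]] by (simp add: fscale_def)
    qed (simp add: a disc_series_outside fscale_def)
  qed
  then show ?thesis using disc_series_in_H2[OF ca] by simp
qed

lemma H2_diff: "f \<in> H2 \<Longrightarrow> g \<in> H2 \<Longrightarrow> f - g \<in> H2"
  using H2_add[OF _ fscale_H2[of g "-1"], of f] by (simp add: fscale_def fun_eq_iff plus_fun_def fun_diff_def)

lemma zero_H2: "0 \<in> H2"
proof -
  have "disc_series (\<lambda>_. 0) = 0" by (simp add: disc_series_def abs_series_def fun_eq_iff)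
  then show ?thesis using disc_series_in_H2[of "\<lambda>_. 0"] by simp
qed

lemma bdry_add:
  assumes "f \<in> H2" "g \<in> H2"
  shows "AE \<zeta> in circle. bdry (f + g) \<zeta> = bdry f \<zeta> + bdry g \<zeta>"
  using bdry_radial_limit[OF assms(1)] bdry_radial_limit[OF assms(2)]
  by eventually_elim (intro bdry_eq, simp add: tendsto_add)

lemma bdry_diff:
  assumes "f \<in> H2" "g \<in> H2"
  shows "AE \<zeta> in circle. bdry (f - g) \<zeta> = bdry f \<zeta> - bdry g \<zeta>"
  using bdry_radial_limit[OF assms(1)] bdry_radial_limit[OF assms(2)]
  by eventually_elim (intro bdry_eq, simp add: tendsto_diff)

lemma bdry_fscale:
  assumes "f \<in> H2"
  shows "AE \<zeta> in circle. bdry (c *\<^sub>F f) \<zeta> = c * bdry f \<zeta>"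
  using bdry_radial_limit[OF assms(1)]
  by eventually_elim (intro bdry_eq, simp add: fscale_def tendsto_mult_left)

lemma H2_inner_add_left:
  assumes "f \<in> H2" "g \<in> H2" "h \<in> H2" shows "H2_inner (f + g) h = H2_inner f h + H2_inner g h"
proof -
  have "H2_inner (f + g) h = L2_inner (\<lambda>\<zeta>. bdry f \<zeta> + bdry g \<zeta>) (bdry h)"
    unfolding H2_inner_def using assms
    by (intro L2_inner_cong bdry_add sq_integrable_bdry sq_integrable_add H2_add) auto
  then show ?thesis using assms by (simp add: L2_inner_add_left sq_integrable_bdry H2_inner_def)
qed

lemma H2_inner_diff_left:
  assumes "f \<in> H2" "g \<in> H2" "h \<in> H2" shows "H2_inner (f - g) h = H2_inner f h - H2_inner g h"
proof -
  have "H2_inner (f - g) h = L2_inner (\<lambda>\<zeta>. bdry f \<zeta> - bdry g \<zeta>) (bdry h)"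
    unfolding H2_inner_def using assms
    by (intro L2_inner_cong bdry_diff sq_integrable_bdry sq_integrable_diff H2_diff) auto
  then show ?thesis using assms by (simp add: L2_inner_diff_left sq_integrable_bdry H2_inner_def)
qed

lemma H2_inner_fscale_left:
  assumes "f \<in> H2" "h \<in> H2" shows "H2_inner (c *\<^sub>F f) h = c * H2_inner f h"
proof -
  have "H2_inner (c *\<^sub>F f) h = L2_inner (\<lambda>\<zeta>. c * bdry f \<zeta>) (bdry h)"
    unfolding H2_inner_def using assms
    by (intro L2_inner_cong bdry_fscale sq_integrable_bdry sq_integrable_cmult fscale_H2) auto
  then show ?thesis by (simp add: L2_inner_cmult_left H2_inner_def)
qed

lemma H2_inner_zero_left: "k \<in> H2 \<Longrightarrow> H2_inner 0 k = 0"
  using H2_inner_fscale_left[OF zero_H2, of k 0] by (simp add: fscale_def zero_fun_def)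

lemma H2_inner_commute: "H2_inner g f = cnj (H2_inner f g)"
  unfolding H2_inner_def by (rule L2_inner_commute)

lemma H2_inner_add_right:
  assumes "f \<in> H2" "g \<in> H2" "h \<in> H2" shows "H2_inner h (f + g) = H2_inner h f + H2_inner h g"
  using H2_inner_add_left[OF assms] by (simp add: H2_inner_commute[of h])

lemma H2_inner_fscale_right:
  assumes "f \<in> H2" "h \<in> H2" shows "H2_inner h (c *\<^sub>F f) = cnj c * H2_inner h f"
  using H2_inner_fscale_left[OF assms] by (simp add: H2_inner_commute[of h])

lemma H2_norm_power2: "(H2_norm f)\<^sup>2 = (\<integral>\<zeta>. (cmod (bdry f \<zeta>))\<^sup>2 \<partial>circle)"
  by (simp add: H2_norm_def H2_inner_def L2_inner_self)

lemma H2_norm_nonneg: "0 \<le> H2_norm f"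
  by (simp add: H2_norm_def H2_inner_def L2_inner_self)

lemma H2_inner_self: "H2_inner f f = of_real ((H2_norm f)\<^sup>2)"
  unfolding H2_norm_power2 H2_inner_def by (rule L2_inner_self)

lemma H2_Cauchy_Schwarz:
  assumes "f \<in> H2" "g \<in> H2" shows "cmod (H2_inner f g) \<le> H2_norm f * H2_norm g"
proof (rule power2_le_imp_le)
  show "(cmod (H2_inner f g))\<^sup>2 \<le> (H2_norm f * H2_norm g)\<^sup>2"
    unfolding power_mult_distrib H2_norm_power2 H2_inner_def
    using assms by (intro L2_inner_Cauchy_Schwarz sq_integrable_bdry)
qed (simp add: H2_norm_nonneg)

lemma H2_coeff_bound:
  assumes a: "sq_summable a" shows "cmod (a n) \<le> H2_norm (disc_series a)"
proof (rule power2_le_imp_le)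
  have "(\<integral>\<zeta>. (cmod (\<zeta> ^ n))\<^sup>2 \<partial>circle) = (\<integral>\<zeta>. 1 \<partial>circle)"
  proof (rule integral_cong_AE)
    show "AE \<zeta> in circle. (cmod (\<zeta> ^ n))\<^sup>2 = 1"
      using AE_circle_norm by eventually_elim (simp add: norm_power)
  qed measurable
  then show "(cmod (a n))\<^sup>2 \<le> (H2_norm (disc_series a))\<^sup>2"
    using L2_inner_Cauchy_Schwarz[OF sq_integrable_bdry[OF disc_series_in_H2[OF a]] sq_integrable_power[of n]]
    unfolding H2_norm_power2 L2_inner_bdry_power[OF a] by simp
qed (rule H2_norm_nonneg)

text \<open>
  Each Taylor coefficient is an inner product with a unit vector, hence bounded by the norm; sum the
  geometric series.  Norm convergence therefore implies pointwise convergence on the disc.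
\<close>

lemma H2_point_bound:
  assumes f: "f \<in> H2" and z: "z \<in> ball 0 1"
  shows "cmod (f z) \<le> H2_norm f / (1 - cmod z)"
proof -
  obtain a where a: "sq_summable a" "f = disc_series a" using H2_coeffs[OF f] .
  have g: "(\<lambda>n. H2_norm f * cmod z ^ n) sums (H2_norm f * (1 / (1 - cmod z)))"
    using z by (intro sums_mult geometric_sums) simp
  have "cmod (f z) \<le> (\<Sum>n. H2_norm f * cmod z ^ n)"
  proof -
    have le: "cmod (a n * z ^ n) \<le> H2_norm f * cmod z ^ n" for n
      using H2_coeff_bound[OF a(1), of n] by (simp add: norm_mult norm_power a(2) mult_right_mono)
    have s: "summable (\<lambda>n. cmod (a n * z ^ n))" using z by (intro sq_summable_power a) simp
    have "f z = (\<Sum>n. a n * z ^ n)" using disc_series_sums[OF a(1) z] by (simp add: a(2) sums_iff)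
    also have "cmod \<dots> \<le> (\<Sum>n. cmod (a n * z ^ n))" by (rule summable_norm[OF s])
    also have "\<dots> \<le> (\<Sum>n. H2_norm f * cmod z ^ n)" by (rule suminf_le[OF le s sums_summable[OF g]])
    finally show ?thesis .
  qed
  then show ?thesis using g by (simp add: sums_iff)
qed

lemma H2_norm_eq_0:
  assumes "f \<in> H2" "H2_norm f = 0" shows "f = 0"
proof
  fix z show "f z = 0 z"
    using H2_point_bound[OF assms(1), of z] H2_outside[OF assms(1), of z] assms(2)
    by (cases "z \<in> ball 0 1") auto
qed

lemma H2_inner_one_bdry:
  assumes f: "f \<in> H2" shows "L2_inner (bdry f) (\<lambda>_. 1) = f 0"
proof -
  obtain a where a: "sq_summable a" "f = disc_series a" using H2_coeffs[OF f] .
  have "f 0 = a 0" by (simp add: a(2) disc_series_def abs_series_def)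
  then show ?thesis using L2_inner_bdry_power[OF a(1), of 0] by (simp add: a(2))
qed

section \<open>Orthogonal projections\<close>

lemma proj_eq:
  assumes M: "M \<subseteq> H2" "\<And>f g. f \<in> M \<Longrightarrow> g \<in> M \<Longrightarrow> f - g \<in> M" and g: "sq_integrable g"
    and h: "h \<in> M" "\<And>k. k \<in> M \<Longrightarrow> L2_inner (g - bdry h) (bdry k) = 0"
  shows "proj M g = h"
  unfolding proj_def
proof (rule the_equality)
  show "h \<in> M \<and> (\<forall>k\<in>M. L2_inner (g - bdry h) (bdry k) = 0)" using h by blast
  fix h' assume h': "h' \<in> M \<and> (\<forall>k\<in>M. L2_inner (g - bdry h') (bdry k) = 0)"
  have H: "h \<in> H2" "h' \<in> H2" "h' - h \<in> H2" using M h h' by auto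
  let ?k = "h' - h"
  have "0 = L2_inner (g - bdry h) (bdry ?k) - L2_inner (g - bdry h') (bdry ?k)"
    using h h' M(2) by simp
  also have "\<dots> = L2_inner (bdry h') (bdry ?k) - L2_inner (bdry h) (bdry ?k)"
    using H g by (simp add: L2_inner_minus_left sq_integrable_bdry)
  also have "\<dots> = H2_inner ?k ?k"
    using H by (simp add: H2_inner_def[symmetric] H2_inner_diff_left)
  finally have "H2_norm ?k = 0" by (simp add: H2_inner_self)
  then have "h' - h = 0" using H2_norm_eq_0 H by blast
  then show "h' = h" by simp
qed

text \<open>
  The projection is the power series whose coefficients are the Fourier coefficients of \<open>g\<close> with
  nonnegative index.  Bessel's inequality makes them square summable, and the difference to \<open>g\<close> has
  no such Fourier coefficients left.
\<close>

lemma proj_H2_orthogonal: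
  assumes g: "sq_integrable g"
  shows "proj H2 g \<in> H2" "\<And>k. k \<in> H2 \<Longrightarrow> L2_inner g (bdry k) = H2_inner (proj H2 g) k"
proof -
  define a where "a n = L2_inner g (\<lambda>\<zeta>. \<zeta> ^ n)" for n
  have "(\<Sum>n<N. (cmod (a n))\<^sup>2) \<le> 1 * (\<integral>\<zeta>. (cmod (g \<zeta>))\<^sup>2 \<partial>circle)" for N
  proof (rule cancel_square_le)
    \<comment> \<open>testing \<open>g\<close> against the partial sum of its own Fourier series\<close>
    define c where "c n = (if n \<in> {..<N} then a n else 0)" for n
    have c: "summable (\<lambda>n. cmod (c n))"
      by (rule summable_finite[of "{..<N}"]) (auto simp: c_def)
    have s: "(\<lambda>n. if n \<in> {..<N} then (cmod (a n))\<^sup>2 else 0) sums (\<Sum>n<N. (cmod (a n))\<^sup>2)"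
      by (rule sums_If_finite_set) simp
    note ig = sq_integrable_integrable_cnj[OF g]
    have "(\<lambda>n. c n * L2_inner (\<lambda>\<zeta>. \<zeta> ^ n) g) sums L2_inner (abs_series c) g"
      using integral_abs_series[OF c ig] by (simp add: L2_inner_def)
    moreover have "(\<lambda>n. c n * L2_inner (\<lambda>\<zeta>. \<zeta> ^ n) g)
        = (\<lambda>n. complex_of_real (if n \<in> {..<N} then (cmod (a n))\<^sup>2 else 0))"
      by (auto simp: fun_eq_iff c_def a_def L2_inner_commute[of _ g] complex_norm_square simp del: of_real_power)
    ultimately have gp: "L2_inner (abs_series c) g = of_real (\<Sum>n<N. (cmod (a n))\<^sup>2)"
      using sums_unique2[OF _ sums_of_real[OF s, where 'a=complex]] by simp
    have "(\<lambda>n. (cmod (c n))\<^sup>2) = (\<lambda>n. if n \<in> {..<N} then (cmod (a n))\<^sup>2 else 0)"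
      by (auto simp: c_def fun_eq_iff)
    then have pp: "(\<integral>\<zeta>. (cmod (abs_series c \<zeta>))\<^sup>2 \<partial>circle) = (\<Sum>n<N. (cmod (a n))\<^sup>2)"
      using integral_norm_abs_series[OF c] s sums_unique2 by simp
    show "(\<Sum>n<N. (cmod (a n))\<^sup>2)\<^sup>2 \<le> 1 * ((\<integral>\<zeta>. (cmod (g \<zeta>))\<^sup>2 \<partial>circle) * (\<Sum>n<N. (cmod (a n))\<^sup>2))"
      using L2_inner_Cauchy_Schwarz[OF sq_integrable_abs_series[OF c] g] unfolding gp pp by (simp add: mult.commute del: of_real_sum)
  qed (auto intro: sum_nonneg)
  then have a: "sq_summable a" by (intro summableI_nonneg_bounded) auto
  have hH: "disc_series a \<in> H2" by (rule disc_series_in_H2[OF a])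
  have sq: "sq_integrable (\<lambda>\<zeta>. g \<zeta> - bdry (disc_series a) \<zeta>)" by (intro sq_integrable_diff g sq_integrable_bdry hH)
  have orth: "L2_inner (\<lambda>\<zeta>. \<zeta> ^ k) (\<lambda>\<zeta>. g \<zeta> - bdry (disc_series a) \<zeta>) = 0" for k
    by (subst L2_inner_commute)
       (simp add: L2_inner_diff_left g sq_integrable_bdry hH sq_integrable_power L2_inner_bdry_power[OF a] a_def)
  have o: "L2_inner (g - bdry (disc_series a)) (bdry k) = 0" if "k \<in> H2" for k
    unfolding fun_diff_def using L2_inner_bdry_eq_0[OF that sq orth]
    by (subst L2_inner_commute) simp
  have p: "proj H2 g = disc_series a"
    by (rule proj_eq) (use g hH o H2_diff in auto)
  show "proj H2 g \<in> H2" unfolding p by (rule hH)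
  fix k assume k: "k \<in> H2"
  show "L2_inner g (bdry k) = H2_inner (proj H2 g) k"
    unfolding p H2_inner_def using o[OF k] g k hH
    by (simp add: L2_inner_minus_left sq_integrable_bdry)
qed

section \<open>Bounded multipliers and the backward shift\<close>

lemma H2_mult:
  assumes b: "b holomorphic_on ball 0 1" "\<And>z. z \<in> ball 0 1 \<Longrightarrow> cmod (b z) \<le> B" and f: "f \<in> H2"
  shows "b * f \<in> H2"
proof -
  have hol: "(b * f) holomorphic_on ball 0 1"
    unfolding times_fun_def by (intro holomorphic_intros b H2_holomorphic f)
  have out: "(b * f) z = 0" if "z \<notin> ball 0 1" for z using H2_outside[OF f that] by simp
  have [measurable]: "f \<in> borel_measurable borel" "b * f \<in> borel_measurable borel"
    by (rule H2_borel[OF f]) (rule disc_fun_borel[OF holomorphic_on_imp_continuous_on[OF hol] out])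
  obtain a where a: "sq_summable a" "f = disc_series a" using H2_coeffs[OF f] .
  have le: "(\<integral>\<zeta>. (cmod ((b * f) (of_real r * \<zeta>)))\<^sup>2 \<partial>circle)
      \<le> B\<^sup>2 * (\<Sum>n. (cmod (a n))\<^sup>2)" if r: "r \<in> {0..<1}" for r
  proof -
    have r': "0 \<le> r" "r < 1" using r by auto
    note s = sq_summable_dilate[OF a(1) r']
    have "AE \<zeta> in circle. cmod (f (of_real r * \<zeta>)) \<le> (\<Sum>n. cmod (a n * of_real r ^ n))"
      using AE_disc_series_dilate[OF r', of a] AE_abs_series_bound[OF s] by eventually_elim (simp add: a(2))
    then have "sq_integrable (\<lambda>\<zeta>. f (of_real r * \<zeta>))" by (intro sq_integrable_bounded) measurable
    then have i: "integrable circle (\<lambda>\<zeta>. (cmod (f (of_real r * \<zeta>)))\<^sup>2)" by (simp add: sq_integrable_def)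
    have AEle: "AE \<zeta> in circle. (cmod ((b * f) (of_real r * \<zeta>)))\<^sup>2 \<le> B\<^sup>2 * (cmod (f (of_real r * \<zeta>)))\<^sup>2"
      using AE_circle_norm
    proof eventually_elim
      case (elim \<zeta>)
      have "cmod (b (of_real r * \<zeta>)) \<le> B" using elim r by (intro b) (simp add: norm_mult)
      then show ?case
        by (simp add: norm_mult power_mult_distrib mult_right_mono power_mono)
    qed
    have "(\<integral>\<zeta>. (cmod ((b * f) (of_real r * \<zeta>)))\<^sup>2 \<partial>circle)
        \<le> (\<integral>\<zeta>. B\<^sup>2 * (cmod (f (of_real r * \<zeta>)))\<^sup>2 \<partial>circle)"
    proof (rule integral_mono_AE)
      show "integrable circle (\<lambda>\<zeta>. (cmod ((b * f) (of_real r * \<zeta>)))\<^sup>2)"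
        by (rule Bochner_Integration.integrable_bound[OF integrable_mult_right[OF i, of "B\<^sup>2"]])
          (measurable, use AEle in simp)
    qed (use i AEle in auto)
    also have "\<dots> = B\<^sup>2 * (\<Sum>n. (cmod (a n * of_real r ^ n))\<^sup>2)"
      using integral_norm_disc_series_dilate[OF s r'] by (simp add: a(2) sums_iff)
    also have "\<dots> \<le> B\<^sup>2 * (\<Sum>n. (cmod (a n))\<^sup>2)"
      using suminf_dilate_le(2)[OF a(1), of r] r' by (intro mult_left_mono) auto
    finally show ?thesis .
  qed
  have "bdd_above ((\<lambda>r. \<integral>\<zeta>. (cmod ((b * f) (of_real r * \<zeta>)))\<^sup>2 \<partial>circle) ` {0..<1})"
    by (rule bdd_aboveI2[OF le])
  then show ?thesis using hol out by (simp add: H2_def)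
qed

lemma bdry_mult:
  assumes b: "AE \<zeta> in circle. ((\<lambda>r. b (of_real r * \<zeta>)) \<longlongrightarrow> \<beta> \<zeta>) (at_left 1)" and f: "f \<in> H2"
  shows "AE \<zeta> in circle. bdry (b * f) \<zeta> = \<beta> \<zeta> * bdry f \<zeta>"
  using b bdry_radial_limit[OF f] by eventually_elim (intro bdry_eq, simp add: tendsto_mult)

lemma disc_const_H2: "disc_const c \<in> H2"
proof -
  have "abs_series (\<lambda>n. if n = 0 then c else 0) z = c" for z
  proof -
    have "(\<lambda>n. (if n = 0 then c else 0) * z ^ n) = (\<lambda>n. if n = 0 then c * z ^ n else 0)" by auto
    then show ?thesis using sums_single[of 0 "\<lambda>n. c * z ^ n"] by (simp add: abs_series_def sums_iff)
  qed
  then have "disc_const c = disc_series (\<lambda>n. if n = 0 then c else 0)"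
    by (simp add: disc_const_def disc_series_def fun_eq_iff)
  moreover have "sq_summable (\<lambda>n. if n = 0 then c else 0)"
    by (rule summable_finite[of "{0}"]) auto
  ultimately show ?thesis using disc_series_in_H2 by simp
qed

lemma bdry_disc_const: "AE \<zeta> in circle. bdry (disc_const c) \<zeta> = c"
  using AE_circle_norm
proof eventually_elim
  case (elim \<zeta>)
  have "eventually (\<lambda>r. 0 < r \<and> r < 1) (at_left (1::real))" by (rule eventually_at_left_1) simp
  then have "eventually (\<lambda>r. disc_const c (of_real r * \<zeta>) = c) (at_left 1)"
    by eventually_elim (use elim in \<open>simp add: disc_const_def norm_mult\<close>)
  then show ?case by (intro bdry_eq tendsto_eventually)
qed

lemma H2_inner_disc_const_right:
  assumes f: "f \<in> H2" shows "H2_inner f (disc_const 1) = f 0"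
proof -
  have one: "sq_integrable (\<lambda>_. 1)" by (rule sq_integrable_bounded[where B=1]) auto
  have "H2_inner f (disc_const 1) = L2_inner (bdry f) (\<lambda>_. 1)"
    unfolding H2_inner_def using f one
    by (intro L2_inner_cong bdry_disc_const sq_integrable_bdry disc_const_H2) auto
  then show ?thesis using H2_inner_one_bdry[OF f] by simp
qed

lemma H2_inner_disc_const_left:
  assumes f: "f \<in> H2" shows "H2_inner (disc_const 1) f = cnj (f 0)"
  using H2_inner_disc_const_right[OF f] H2_inner_commute[of "disc_const 1" f] by simp

lemma H2_inner_mult_isometry:
  assumes b: "b holomorphic_on ball 0 1" "\<And>z. z \<in> ball 0 1 \<Longrightarrow> cmod (b z) \<le> B"
    and lim: "AE \<zeta> in circle. \<exists>w. ((\<lambda>r::real. b (of_real r * \<zeta>)) \<longlongrightarrow> w) (at_left 1) \<and> cmod w = 1"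
    and f: "f \<in> H2" and g: "g \<in> H2"
  shows "H2_inner (b * f) (b * g) = H2_inner f g"
proof -
  have 1: "AE \<zeta> in circle. ((\<lambda>r. b (of_real r * \<zeta>)) \<longlongrightarrow> bdry b \<zeta>) (at_left 1)"
    and 2: "AE \<zeta> in circle. bdry b \<zeta> * cnj (bdry b \<zeta>) = 1"
  proof -
    have *: "AE \<zeta> in circle. ((\<lambda>r. b (of_real r * \<zeta>)) \<longlongrightarrow> bdry b \<zeta>) (at_left 1) \<and> cmod (bdry b \<zeta>) = 1"
      using lim
    proof eventually_elim
      case (elim \<zeta>)
      then obtain w where w: "((\<lambda>r. b (of_real r * \<zeta>)) \<longlongrightarrow> w) (at_left 1)" "cmod w = 1" by blast
      then show ?case using bdry_eq[where f=b and \<zeta>=\<zeta>, OF w(1)] by simp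
    qed
    show "AE \<zeta> in circle. ((\<lambda>r. b (of_real r * \<zeta>)) \<longlongrightarrow> bdry b \<zeta>) (at_left 1)"
      using * by eventually_elim simp
    show "AE \<zeta> in circle. bdry b \<zeta> * cnj (bdry b \<zeta>) = 1"
      using * by eventually_elim (simp add: complex_norm_square[symmetric])
  qed
  have H: "b * f \<in> H2" "b * g \<in> H2" using H2_mult[OF b] f g by auto
  have [measurable]: "bdry f \<in> borel_measurable borel" "bdry g \<in> borel_measurable borel"
    "bdry (b * f) \<in> borel_measurable borel" "bdry (b * g) \<in> borel_measurable borel"
    using bdry_H2_borel f g H by auto
  show ?thesis
    unfolding H2_inner_def L2_inner_def
  proof (rule integral_cong_AE)
    show "AE \<zeta> in circle. bdry (b * f) \<zeta> * cnj (bdry (b * g) \<zeta>) = bdry f \<zeta> * cnj (bdry g \<zeta>)"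
      using bdry_mult[OF 1 f] bdry_mult[OF 1 g] 2
    proof eventually_elim
      case (elim \<zeta>)
      have "bdry (b * f) \<zeta> * cnj (bdry (b * g) \<zeta>)
          = (bdry b \<zeta> * cnj (bdry b \<zeta>)) * (bdry f \<zeta> * cnj (bdry g \<zeta>))"
        using elim(1,2) by (simp add: mult_ac)
      then show ?case using elim(3) by simp
    qed
  qed measurable
qed

abbreviation zshift :: "(complex \<Rightarrow> complex) \<Rightarrow> complex \<Rightarrow> complex" where
  "zshift f \<equiv> (\<lambda>z. z) * f"

lemma radial_id: "AE \<zeta> in circle. ((\<lambda>r. complex_of_real r * \<zeta>) \<longlongrightarrow> \<zeta>) (at_left 1)"
proof (rule AE_I2)
  fix \<zeta>
  have "((\<lambda>r. complex_of_real r * \<zeta>) \<longlongrightarrow> of_real 1 * \<zeta>) (at_left 1)"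
    by (intro tendsto_intros)
  then show "((\<lambda>r. complex_of_real r * \<zeta>) \<longlongrightarrow> \<zeta>) (at_left 1)" by simp
qed

lemma zshift_H2: "f \<in> H2 \<Longrightarrow> zshift f \<in> H2"
  by (rule H2_mult[where B=1]) auto

lemma H2_inner_zshift: "f \<in> H2 \<Longrightarrow> g \<in> H2 \<Longrightarrow> H2_inner (zshift f) (zshift g) = H2_inner f g"
proof (rule H2_inner_mult_isometry[where B=1])
  show "AE \<zeta> in circle. \<exists>w. ((\<lambda>r. complex_of_real r * \<zeta>) \<longlongrightarrow> w) (at_left 1) \<and> cmod w = 1"
    using radial_id AE_circle_norm by eventually_elim blast
qed auto

text \<open>
  Multiplication by \<open>z\<close> is isometric, hence injective.  Identities for backward shifts can thus be
  checked after multiplication by \<open>z\<close>, which avoids their special value at \<open>0\<close>.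
\<close>

lemma zshift_cancel:
  assumes f: "f \<in> H2" and g: "g \<in> H2" and eq: "\<And>z. z \<in> ball 0 1 \<Longrightarrow> z * f z = z * g z"
  shows "f = g"
proof -
  have d: "f - g \<in> H2" using f g by (rule H2_diff)
  have "zshift (f - g) = 0"
  proof
    fix z show "zshift (f - g) z = 0 z"
      using eq[of z] H2_outside[OF d, of z] by (cases "z \<in> ball 0 1") (auto simp: right_diff_distrib)
  qed
  then have "H2_inner (f - g) (f - g) = H2_inner 0 0"
    using H2_inner_zshift[OF d d] by simp
  also have "\<dots> = 0"
    by (rule H2_inner_zero_left[OF zero_H2])
  finally have "f - g = 0"
    using H2_norm_eq_0[OF d] by (simp add: H2_inner_self)
  then show ?thesis by simp
qed

text \<open>
  The quotient defining the backward shift shifts the Taylor coefficients; at \<open>0\<close> its value is the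
  derivative of \<open>f\<close>, which is the coefficient of index \<open>1\<close>.
\<close>

lemma backshift_disc_series:
  assumes a: "sq_summable a"
  shows "sq_summable (\<lambda>n. a (Suc n))" "backshift (disc_series a) = disc_series (\<lambda>n. a (Suc n))"
proof -
  let ?S = "disc_series (\<lambda>n. a (Suc n))"
  show s: "sq_summable (\<lambda>n. a (Suc n))" using a by (subst summable_Suc_iff)
  have eq: "disc_series a z = a 0 + z * ?S z" if "z \<in> ball 0 1" for z
  proof -
    have "(\<lambda>n. a (Suc n) * z ^ Suc n) sums (z * ?S z)"
      using sums_mult[OF disc_series_sums[OF s that], of z] by (simp add: mult_ac)
    then have "(\<lambda>n. a n * z ^ n) sums (z * ?S z + a 0 * z ^ 0)" by (rule sums_Suc)
    then show ?thesis using sums_unique2[OF disc_series_sums[OF a that]] by (simp add: add.commute)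
  qed
  have d: "deriv (disc_series a) 0 = ?S 0"
  proof (rule DERIV_imp_deriv)
    have "?S field_differentiable at 0"
      by (rule holomorphic_on_imp_differentiable_at[OF disc_series_holomorphic[OF s]]) auto
    then obtain S' where "(?S has_field_derivative S') (at 0)" by (auto simp: field_differentiable_def)
    then have "((\<lambda>z. a 0 + z * ?S z) has_field_derivative ?S 0) (at 0)"
      by (auto intro!: derivative_eq_intros)
    then show "(disc_series a has_field_derivative ?S 0) (at 0)"
      by (rule has_field_derivative_transform_within_open[where S="ball 0 1"]) (use eq in auto)
  qed
  show "backshift (disc_series a) = ?S"
  proof
    fix z
    have "disc_series a 0 = a 0" using eq[of 0] by simp
    then show "backshift (disc_series a) z = ?S z"
      using d eq[of z] by (auto simp: backshift_def disc_series_outside)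
  qed
qed

lemma backshift_H2: "f \<in> H2 \<Longrightarrow> backshift f \<in> H2"
  by (erule H2_coeffs) (auto simp: backshift_disc_series intro: disc_series_in_H2)

lemma mult_backshift: "z \<in> ball 0 1 \<Longrightarrow> z * backshift f z = f z - f 0"
  by (auto simp: backshift_def)

text \<open>
  As \<open>z\<close> times \<open>S\<^sup>*f\<close> is \<open>f - f(0)\<close> and multiplication by \<open>z\<close> is isometric, the two sides differ by
  the inner product of the constant \<open>f(0)\<close> with \<open>z g\<close>, which vanishes at \<open>0\<close>.
\<close>

lemma backshift_adjoint:
  assumes f: "f \<in> H2" and g: "g \<in> H2"
  shows "H2_inner (backshift f) g = H2_inner f (zshift g)"
proof -
  let ?c = "f 0 *\<^sub>F disc_const 1"
  have S: "backshift f \<in> H2" by (rule backshift_H2[OF f])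
  have c: "?c \<in> H2" by (intro fscale_H2 disc_const_H2)
  have "zshift (backshift f) = f - ?c"
  proof
    fix z show "zshift (backshift f) z = (f - ?c) z"
      using mult_backshift[of z f] H2_outside[OF f, of z] H2_outside[OF S, of z]
      by (cases "z \<in> ball 0 1") (auto simp: fscale_def disc_const_def)
  qed
  then have "H2_inner (backshift f) g = H2_inner (f - ?c) (zshift g)"
    using H2_inner_zshift[OF S g] by simp
  also have "\<dots> = H2_inner f (zshift g) - f 0 * cnj (zshift g 0)"
    using f g c by (simp add: H2_inner_diff_left zshift_H2 H2_inner_fscale_left disc_const_H2 H2_inner_disc_const_left)
  finally show ?thesis by simp
qed

lemma H2_inner_left_cong:
  assumes "f \<in> H2" "g \<in> H2" "\<And>k. k \<in> H2 \<Longrightarrow> H2_inner f k = H2_inner g k"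
  shows "f = g"
proof -
  have d: "f - g \<in> H2" using assms H2_diff by blast
  have "H2_inner (f - g) (f - g) = 0"
    using assms d by (simp add: H2_inner_diff_left)
  then have "f - g = 0" using H2_norm_eq_0[OF d] by (simp add: H2_inner_self)
  then show ?thesis by simp
qed

lemma H2_inner_tendsto:
  assumes X: "\<And>n. X n \<in> H2" and f: "f \<in> H2" and k: "k \<in> H2" and lim: "(\<lambda>n. H2_norm (X n - f)) \<longlonglongrightarrow> 0"
  shows "(\<lambda>n. H2_inner (X n) k) \<longlonglongrightarrow> H2_inner f k"
proof -
  have "(\<lambda>n. H2_norm (X n - f) * H2_norm k) \<longlonglongrightarrow> 0 * H2_norm k"
    by (intro tendsto_mult lim tendsto_const)
  then have l: "(\<lambda>n. H2_norm (X n - f) * H2_norm k) \<longlonglongrightarrow> 0" by simp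
  have "(\<lambda>n. H2_inner (X n) k - H2_inner f k) \<longlonglongrightarrow> 0"
  proof (rule Lim_null_comparison[OF _ l])
    show "\<forall>\<^sub>F n in sequentially. norm (H2_inner (X n) k - H2_inner f k) \<le> H2_norm (X n - f) * H2_norm k"
      using X f k H2_Cauchy_Schwarz[OF H2_diff[OF X f] k]
      by (intro always_eventually allI) (simp add: H2_inner_diff_left)
  qed
  then show ?thesis using LIM_zero_iff by blast
qed

lemma H2_point_tendsto:
  assumes X: "\<And>n. X n \<in> H2" and f: "f \<in> H2" and z: "z \<in> ball 0 1" and lim: "(\<lambda>n. H2_norm (X n - f)) \<longlonglongrightarrow> 0"
  shows "(\<lambda>n. X n z) \<longlonglongrightarrow> f z"
proof -
  have "(\<lambda>n. H2_norm (X n - f) / (1 - cmod z)) \<longlonglongrightarrow> 0 / (1 - cmod z)"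
    using z by (intro tendsto_divide lim tendsto_const) auto
  then have l: "(\<lambda>n. H2_norm (X n - f) / (1 - cmod z)) \<longlonglongrightarrow> 0" by simp
  have "(\<lambda>n. X n z - f z) \<longlonglongrightarrow> 0"
  proof (rule Lim_null_comparison[OF _ l])
    show "\<forall>\<^sub>F n in sequentially. norm (X n z - f z) \<le> H2_norm (X n - f) / (1 - cmod z)"
      using H2_point_bound[OF H2_diff[OF X f] z] by (intro always_eventually allI) simp
  qed
  then show ?thesis using LIM_zero_iff by blast
qed

section \<open>Inner functions and model spaces\<close>

context
  fixes \<theta> assumes inner: "inner_function \<theta>"
begin

lemma inner_holomorphic: "\<theta> holomorphic_on ball 0 1"
  and inner_outside: "z \<notin> ball 0 1 \<Longrightarrow> \<theta> z = 0"
  and inner_boundary: "AE \<zeta> in circle. \<exists>w. ((\<lambda>r::real. \<theta> (of_real r * \<zeta>)) \<longlongrightarrow> w) (at_left 1) \<and> cmod w = 1"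
  and inner_bounded: "\<exists>B. \<forall>z\<in>ball 0 1. cmod (\<theta> z) \<le> B"
  using inner by (auto simp: inner_function_def bounded_iff)

lemma inner_mult_H2: "f \<in> H2 \<Longrightarrow> \<theta> * f \<in> H2"
  using inner_bounded H2_mult[OF inner_holomorphic] by blast

lemma H2_inner_inner_mult:
  "f \<in> H2 \<Longrightarrow> g \<in> H2 \<Longrightarrow> H2_inner (\<theta> * f) (\<theta> * g) = H2_inner f g"
  using inner_bounded H2_inner_mult_isometry[OF inner_holomorphic _ inner_boundary] by blast

lemma inner_mult_one: "\<theta> * disc_const 1 = \<theta>"
  using inner_outside by (auto simp: disc_const_def fun_eq_iff)

lemma inner_H2: "\<theta> \<in> H2"
  using inner_mult_H2[OF disc_const_H2[of 1]] by (simp add: inner_mult_one)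

lemma H2_norm_inner_mult: "f \<in> H2 \<Longrightarrow> H2_norm (\<theta> * f) = H2_norm f"
  by (simp add: H2_norm_def H2_inner_inner_mult)

text \<open>
  Every power of \<open>\<theta>\<close> has the norm of the constant \<open>1\<close>, so evaluation at \<open>z\<close> bounds the powers of
  \<open>\<theta>(z)\<close> uniformly.
\<close>

lemma inner_le_1: assumes z: "z \<in> ball 0 1" shows "cmod (\<theta> z) \<le> 1"
proof (rule ccontr)
  assume "\<not> cmod (\<theta> z) \<le> 1"
  then have "1 < cmod (\<theta> z)" by simp
  then obtain n where n: "H2_norm (disc_const 1) / (1 - cmod z) < cmod (\<theta> z) ^ n"
    using real_arch_pow by blast
  \<comment> \<open>the powers of \<open>\<theta>\<close>, set to \<open>0\<close> off the disc also for exponent \<open>0\<close>\<close>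
  define p where "p n = ((\<lambda>f. \<theta> * f) ^^ n) (disc_const 1)" for n
  have "p n \<in> H2 \<and> H2_norm (p n) = H2_norm (disc_const 1) \<and> p n z = \<theta> z ^ n" for n
  proof (induction n)
    case 0
    then show ?case using z disc_const_H2 by (simp add: p_def disc_const_def)
  next
    case (Suc n)
    have "p (Suc n) = \<theta> * p n" by (simp add: p_def)
    moreover have "(\<theta> * p n) z = \<theta> z ^ Suc n" using Suc by simp
    ultimately show ?case using Suc inner_mult_H2[of "p n"] H2_norm_inner_mult[of "p n"] by metis
  qed
  then have "cmod (\<theta> z ^ n) \<le> H2_norm (disc_const 1) / (1 - cmod z)"
    using H2_point_bound[OF _ z, of "p n"] by metis
  then show False using n by (simp add: norm_power)
qed

lemma inner_at_0_less_1:
  assumes "\<not> \<theta> constant_on ball 0 1" shows "cmod (\<theta> 0) < 1"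
proof (rule ccontr)
  assume "\<not> cmod (\<theta> 0) < 1"
  then have "cmod (\<theta> z) \<le> cmod (\<theta> 0)" if "z \<in> ball 0 1" for z
    using inner_le_1[OF that] by simp
  then have "\<theta> constant_on ball 0 1"
    by (intro maximum_modulus_principle[OF inner_holomorphic, of "ball 0 1" 0]) auto
  then show False using assms by blast
qed

text \<open>
  This identifies the Toeplitz operator with symbol \<open>cnj \<theta>\<close> as the adjoint of multiplication by \<open>\<theta>\<close>.
\<close>

lemma toeplitz_cnj_inner:
  assumes f: "f \<in> H2"
  shows "toeplitz (\<lambda>\<zeta>. cnj (bdry \<theta> \<zeta>)) f \<in> H2"
    "\<And>k. k \<in> H2 \<Longrightarrow> H2_inner (toeplitz (\<lambda>\<zeta>. cnj (bdry \<theta> \<zeta>)) f) k = H2_inner f (\<theta> * k)"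
proof -
  have [measurable]: "bdry \<theta> \<in> borel_measurable borel" "bdry f \<in> borel_measurable borel"
    by (rule bdry_H2_borel, rule inner_H2) (rule bdry_H2_borel[OF f])
  have lim: "AE \<zeta> in circle. ((\<lambda>r. \<theta> (of_real r * \<zeta>)) \<longlongrightarrow> bdry \<theta> \<zeta>) (at_left 1)"
    by (rule bdry_radial_limit[OF inner_H2])
  have "AE \<zeta> in circle. cmod (cnj (bdry \<theta> \<zeta>)) \<le> 1"
    using inner_boundary
  proof eventually_elim
    case (elim \<zeta>)
    then obtain w where w: "((\<lambda>r. \<theta> (of_real r * \<zeta>)) \<longlongrightarrow> w) (at_left 1)" "cmod w = 1" by blast
    then show ?case using bdry_eq[where f=\<theta> and \<zeta>=\<zeta>, OF w(1)] by simp
  qed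
  then have s: "sq_integrable ((\<lambda>\<zeta>. cnj (bdry \<theta> \<zeta>)) * bdry f)"
    unfolding times_fun_def by (intro sq_integrable_mult_bounded sq_integrable_bdry f) measurable
  show "toeplitz (\<lambda>\<zeta>. cnj (bdry \<theta> \<zeta>)) f \<in> H2"
    unfolding toeplitz_def by (rule proj_H2_orthogonal(1)[OF s])
  fix k assume k: "k \<in> H2"
  have [measurable]: "bdry k \<in> borel_measurable borel" "bdry (\<theta> * k) \<in> borel_measurable borel"
    by (rule bdry_H2_borel[OF k]) (rule bdry_H2_borel[OF inner_mult_H2[OF k]])
  have "H2_inner (toeplitz (\<lambda>\<zeta>. cnj (bdry \<theta> \<zeta>)) f) k
      = L2_inner ((\<lambda>\<zeta>. cnj (bdry \<theta> \<zeta>)) * bdry f) (bdry k)"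
    unfolding toeplitz_def by (rule proj_H2_orthogonal(2)[OF s k, symmetric])
  also have "\<dots> = (\<integral>\<zeta>. cnj (bdry \<theta> \<zeta>) * bdry f \<zeta> * cnj (bdry k \<zeta>) \<partial>circle)"
    by (simp add: L2_inner_def)
  also have "\<dots> = H2_inner f (\<theta> * k)"
    unfolding H2_inner_def L2_inner_def
  proof (rule integral_cong_AE)
    show "AE \<zeta> in circle. cnj (bdry \<theta> \<zeta>) * bdry f \<zeta> * cnj (bdry k \<zeta>) = bdry f \<zeta> * cnj (bdry (\<theta> * k) \<zeta>)"
      using bdry_mult[OF lim k] by eventually_elim (simp add: mult_ac)
  qed measurable
  finally show "H2_inner (toeplitz (\<lambda>\<zeta>. cnj (bdry \<theta> \<zeta>)) f) k = H2_inner f (\<theta> * k)" .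
qed

lemma model_space_iff: "f \<in> model_space \<theta> \<longleftrightarrow> f \<in> H2 \<and> (\<forall>k\<in>H2. H2_inner f (\<theta> * k) = 0)"
  by (simp add: model_space_def)

lemma model_space_add: "f \<in> model_space \<theta> \<Longrightarrow> g \<in> model_space \<theta> \<Longrightarrow> f + g \<in> model_space \<theta>"
  by (simp add: model_space_iff H2_add H2_inner_add_left inner_mult_H2)

lemma model_space_fscale: "f \<in> model_space \<theta> \<Longrightarrow> c *\<^sub>F f \<in> model_space \<theta>"
  by (simp add: model_space_iff fscale_H2 H2_inner_fscale_left inner_mult_H2)

lemma zshift_inner_mult: "zshift (\<theta> * k) = \<theta> * zshift k"
  by (simp add: fun_eq_iff)

lemma model_space_backshift: "f \<in> model_space \<theta> \<Longrightarrow> backshift f \<in> model_space \<theta>"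
  unfolding model_space_iff
  using backshift_H2 backshift_adjoint[OF _ inner_mult_H2] zshift_inner_mult zshift_H2 by metis

lemma backshift_inner_in_model_space: "backshift \<theta> \<in> model_space \<theta>"
proof -
  have "H2_inner (backshift \<theta>) (\<theta> * k) = 0" if k: "k \<in> H2" for k
  proof -
    have "H2_inner (backshift \<theta>) (\<theta> * k) = H2_inner (\<theta> * disc_const 1) (\<theta> * zshift k)"
      using backshift_adjoint[OF inner_H2 inner_mult_H2[OF k]]
      by (simp only: zshift_inner_mult inner_mult_one)
    also have "\<dots> = cnj (zshift k 0)"
      by (simp only: H2_inner_inner_mult disc_const_H2 zshift_H2 k H2_inner_disc_const_left)
    finally show ?thesis by simp
  qed
  then show ?thesis by (simp add: model_space_iff backshift_H2 inner_H2)
qed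

text \<open>
  The product rule for the backward shift.  It explains the defect space: the second term on the
  right lies in the model space, and only the first term can leave \<open>M\<close>.
\<close>

lemma backshift_inner_mult:
  assumes v: "v \<in> H2"
  shows "backshift (\<theta> * v) = \<theta> * backshift v + v 0 *\<^sub>F backshift \<theta>"
proof (rule zshift_cancel)
  show "backshift (\<theta> * v) \<in> H2" "\<theta> * backshift v + v 0 *\<^sub>F backshift \<theta> \<in> H2"
    using v by (auto intro!: backshift_H2 inner_mult_H2 H2_add fscale_H2 inner_H2)
  fix z :: complex assume z: "z \<in> ball 0 1"
  have "z * (\<theta> * backshift v + v 0 *\<^sub>F backshift \<theta>) z
      = \<theta> z * (z * backshift v z) + v 0 * (z * backshift \<theta> z)"
    by (simp add: fscale_def algebra_simps)
  also have "\<dots> = z * backshift (\<theta> * v) z"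
    unfolding mult_backshift[OF z] by (simp add: algebra_simps)
  finally show "z * backshift (\<theta> * v) z = z * (\<theta> * backshift v + v 0 *\<^sub>F backshift \<theta>) z" by (rule sym)
qed

end

lemma backshift_add_fscale:
  assumes f: "f \<in> H2" and g: "g \<in> H2"
  shows "backshift (f + c *\<^sub>F g) = backshift f + c *\<^sub>F backshift g"
proof (rule zshift_cancel)
  show "backshift (f + c *\<^sub>F g) \<in> H2" "backshift f + c *\<^sub>F backshift g \<in> H2"
    using f g by (auto intro!: backshift_H2 H2_add fscale_H2)
  fix z :: complex assume z: "z \<in> ball 0 1"
  have "z * (backshift f + c *\<^sub>F backshift g) z = z * backshift f z + c * (z * backshift g z)"
    by (simp add: fscale_def algebra_simps)
  also have "\<dots> = z * backshift (f + c *\<^sub>F g) z"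
    unfolding mult_backshift[OF z] by (simp add: fscale_def algebra_simps)
  finally show "z * backshift (f + c *\<^sub>F g) z = z * (backshift f + c *\<^sub>F backshift g) z" by (rule sym)
qed

section \<open>The pair space and the kernel of the perturbed Toeplitz operator\<close>

lemma range_disc_const_iff:
  assumes h: "h \<in> H2" shows "h \<in> range disc_const \<longleftrightarrow> (\<forall>z\<in>ball 0 1. h z = h 0)"
proof
  assume "\<forall>z\<in>ball 0 1. h z = h 0"
  then have "h z = disc_const (h 0) z" for z
    using H2_outside[OF h, of z] unfolding disc_const_def by (metis (full_types))
  then have "h = disc_const (h 0)" by (rule ext)
  then show "h \<in> range disc_const" by blast
qed (auto simp: disc_const_def)

text \<open>
  The space \<open>K\<close> for arbitrary coefficients, on whose values neither closedness nor invariance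
  depends.
\<close>

definition model_pairs :: "(complex \<Rightarrow> complex) \<Rightarrow> complex \<Rightarrow> complex \<Rightarrow> complex \<Rightarrow> complex \<Rightarrow>
    ((complex \<Rightarrow> complex) \<times> (complex \<Rightarrow> complex)) set" where
  "model_pairs \<theta> \<alpha> \<beta> \<gamma> \<delta> = {(k0, k1). k0 \<in> H2 \<and> k1 \<in> H2 \<and>
     k0 - (\<alpha> *\<^sub>F k0 + \<beta> *\<^sub>F k1) * \<theta> \<in> model_space \<theta> \<and> \<gamma> *\<^sub>F k0 + \<delta> *\<^sub>F k1 \<in> range disc_const}"

context
  fixes \<theta> assumes inner: "inner_function \<theta>"
begin

text \<open>
  Both conditions become equations that are linear and continuous in the pair; in the first, the
  factor \<open>\<theta>\<close> in front of the linear combination disappears because multiplication by \<open>\<theta>\<close> is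
  isometric.
\<close>

lemma model_pairs_iff:
  "(k0, k1) \<in> model_pairs \<theta> \<alpha> \<beta> \<gamma> \<delta> \<longleftrightarrow> k0 \<in> H2 \<and> k1 \<in> H2 \<and>
     (\<forall>k\<in>H2. H2_inner k0 (\<theta> * k) - (\<alpha> * H2_inner k0 k + \<beta> * H2_inner k1 k) = 0) \<and>
     (\<forall>z\<in>ball 0 1. \<gamma> * k0 z + \<delta> * k1 z = \<gamma> * k0 0 + \<delta> * k1 0)"
proof (cases "k0 \<in> H2 \<and> k1 \<in> H2")
  case True
  let ?q = "\<alpha> *\<^sub>F k0 + \<beta> *\<^sub>F k1"
  have q: "?q \<in> H2" using True by (intro H2_add fscale_H2) auto
  have A: "k0 - ?q * \<theta> = k0 - \<theta> * ?q" by (simp add: mult.commute)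
  have AH: "k0 - \<theta> * ?q \<in> H2" using True q by (intro H2_diff inner_mult_H2[OF inner]) auto
  have "H2_inner (k0 - \<theta> * ?q) (\<theta> * k) = H2_inner k0 (\<theta> * k) - (\<alpha> * H2_inner k0 k + \<beta> * H2_inner k1 k)"
    if k: "k \<in> H2" for k
  proof -
    have "H2_inner (k0 - \<theta> * ?q) (\<theta> * k) = H2_inner k0 (\<theta> * k) - H2_inner (\<theta> * ?q) (\<theta> * k)"
      using True q k inner_mult_H2[OF inner] by (intro H2_inner_diff_left) auto
    also have "H2_inner (\<theta> * ?q) (\<theta> * k) = H2_inner ?q k"
      by (rule H2_inner_inner_mult[OF inner q k])
    also have "\<dots> = \<alpha> * H2_inner k0 k + \<beta> * H2_inner k1 k"
      using True k by (simp only: H2_inner_add_left fscale_H2 H2_inner_fscale_left)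
    finally show ?thesis .
  qed
  then have 1: "k0 - ?q * \<theta> \<in> model_space \<theta> \<longleftrightarrow>
     (\<forall>k\<in>H2. H2_inner k0 (\<theta> * k) - (\<alpha> * H2_inner k0 k + \<beta> * H2_inner k1 k) = 0)"
    unfolding A model_space_iff[OF inner] using AH by simp
  have "\<gamma> *\<^sub>F k0 + \<delta> *\<^sub>F k1 \<in> H2" using True by (intro H2_add fscale_H2) auto
  from range_disc_const_iff[OF this]
  have 2: "\<gamma> *\<^sub>F k0 + \<delta> *\<^sub>F k1 \<in> range disc_const \<longleftrightarrow>
     (\<forall>z\<in>ball 0 1. \<gamma> * k0 z + \<delta> * k1 z = \<gamma> * k0 0 + \<delta> * k1 0)"
    by (simp only: plus_fun_apply fscale_def)
  show ?thesis unfolding model_pairs_def using 1 2 True by simp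
qed (auto simp: model_pairs_def)

lemma model_pairsD:
  assumes "(k0, k1) \<in> model_pairs \<theta> \<alpha> \<beta> \<gamma> \<delta>"
  shows "k0 \<in> H2" "k1 \<in> H2"
    "\<And>k. k \<in> H2 \<Longrightarrow> H2_inner k0 (\<theta> * k) - (\<alpha> * H2_inner k0 k + \<beta> * H2_inner k1 k) = 0"
    "\<And>z. z \<in> ball 0 1 \<Longrightarrow> \<gamma> * k0 z + \<delta> * k1 z = \<gamma> * k0 0 + \<delta> * k1 0"
  using assms unfolding model_pairs_iff by blast+

lemma closed_model_pairs: "closed_subspace_H2xH2 (model_pairs \<theta> \<alpha> \<beta> \<gamma> \<delta>)" (is "closed_subspace_H2xH2 ?K")
  unfolding closed_subspace_H2xH2_def
proof (intro conjI allI impI)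
  show "?K \<subseteq> H2 \<times> H2" by (auto simp: model_pairs_def)
  show "cfun2.subspace ?K"
    unfolding cfun2.subspace_def
  proof (intro conjI ballI allI)
    have "(0, 0) \<in> ?K" unfolding model_pairs_iff using zero_H2 inner_mult_H2[OF inner] H2_inner_zero_left by simp
    then show "0 \<in> ?K" by (simp add: zero_prod_def)
  next
    fix x y assume "x \<in> ?K" "y \<in> ?K"
    then obtain k0 k1 l0 l1 where xy: "x = (k0, k1)" "y
        = (l0, l1)" and K: "(k0, k1) \<in> ?K" "(l0, l1) \<in> ?K"
      by (metis prod.collapse)
    note k = model_pairsD[OF K(1)] and l = model_pairsD[OF K(2)]
    have "(k0 + l0, k1 + l1) \<in> ?K"
      unfolding model_pairs_iff
    proof (intro conjI ballI)
      fix f assume f: "f \<in> H2"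
      have "H2_inner (k0 + l0) (\<theta> * f) - (\<alpha> * H2_inner (k0 + l0) f + \<beta> * H2_inner (k1 + l1) f)
        = (H2_inner k0 (\<theta> * f) - (\<alpha> * H2_inner k0 f + \<beta> * H2_inner k1 f))
          + (H2_inner l0 (\<theta> * f) - (\<alpha> * H2_inner l0 f + \<beta> * H2_inner l1 f))"
        using k(1,2) l(1,2) f inner_mult_H2[OF inner f] by (simp only: H2_inner_add_left) (simp add: algebra_simps)
      then show "H2_inner (k0 + l0) (\<theta> * f) - (\<alpha> * H2_inner (k0 + l0) f + \<beta> * H2_inner (k1 + l1) f) = 0"
        using k(3)[OF f] l(3)[OF f] by simp
    next
      fix z :: complex assume z: "z \<in> ball 0 1"
      have "\<gamma> * k0 z + \<delta> * k1 z = \<gamma> * k0 0 + \<delta> * k1 0" "\<gamma> * l0 z + \<delta> * l1 z = \<gamma> * l0 0 + \<delta> * l1 0"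
        by (rule k(4)[OF z], rule l(4)[OF z])
      then have "(\<gamma> * k0 z + \<delta> * k1 z) + (\<gamma> * l0 z + \<delta> * l1 z)
          = (\<gamma> * k0 0 + \<delta> * k1 0) + (\<gamma> * l0 0 + \<delta> * l1 0)"
        by (simp only:)
      then show "\<gamma> * (k0 + l0) z + \<delta> * (k1 + l1) z = \<gamma> * (k0 + l0) 0 + \<delta> * (k1 + l1) 0"
        by (simp add: algebra_simps)
    qed (intro H2_add k(1,2) l(1,2))+
    then show "x + y \<in> ?K" by (simp add: xy)
  next
    fix c x assume "x \<in> ?K"
    then obtain k0 k1 where x: "x = (k0, k1)" and K: "(k0, k1) \<in> ?K"
      by (metis prod.collapse)
    note k = model_pairsD[OF K]
    have "(c *\<^sub>F k0, c *\<^sub>F k1) \<in> ?K"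
      unfolding model_pairs_iff
    proof (intro conjI ballI)
      fix f assume f: "f \<in> H2"
      have "H2_inner (c *\<^sub>F k0) (\<theta> * f) - (\<alpha> * H2_inner (c *\<^sub>F k0) f + \<beta> * H2_inner (c *\<^sub>F k1) f)
        = c * (H2_inner k0 (\<theta> * f) - (\<alpha> * H2_inner k0 f + \<beta> * H2_inner k1 f))"
        using k(1,2) f inner_mult_H2[OF inner f] by (simp only: H2_inner_fscale_left) (simp add: algebra_simps)
      then show "H2_inner (c *\<^sub>F k0) (\<theta> * f) - (\<alpha> * H2_inner (c *\<^sub>F k0) f
          + \<beta> * H2_inner (c *\<^sub>F k1) f) = 0"
        using k(3)[OF f] by simp
    next
      fix z :: complex assume z: "z \<in> ball 0 1"
      have "\<gamma> * k0 z + \<delta> * k1 z = \<gamma> * k0 0 + \<delta> * k1 0" by (rule k(4)[OF z])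
      then have "c * (\<gamma> * k0 z + \<delta> * k1 z) = c * (\<gamma> * k0 0 + \<delta> * k1 0)" by (simp only:)
      then show "\<gamma> * (c *\<^sub>F k0) z + \<delta> * (c *\<^sub>F k1) z = \<gamma> * (c *\<^sub>F k0) 0 + \<delta> * (c *\<^sub>F k1) 0"
        by (simp add: fscale_def algebra_simps)
    qed (intro fscale_H2 k(1,2))+
    then show "fscale2 c x \<in> ?K" by (simp add: x fscale2_def)
  qed
next
  fix X Y f g
  assume *: "(\<forall>n. (X n, Y n) \<in> ?K) \<and> f \<in> H2 \<and> g \<in> H2 \<and>
        (\<lambda>n::nat. H2_norm (X n - f)) \<longlonglongrightarrow> 0 \<and> (\<lambda>n. H2_norm (Y n - g)) \<longlonglongrightarrow> 0"
  then have K: "(X n, Y n) \<in> ?K" for n by blast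
  note K' = model_pairsD[OF K]
  note X = K'(1) and Y = K'(2)
  have f: "f \<in> H2" and g: "g \<in> H2" and Xf: "(\<lambda>n. H2_norm (X n - f))
      \<longlonglongrightarrow> 0" and Yg: "(\<lambda>n. H2_norm (Y n - g)) \<longlonglongrightarrow> 0"
    using * by auto
  show "(f, g) \<in> ?K"
    unfolding model_pairs_iff
  proof (intro conjI ballI f g)
    fix k assume k: "k \<in> H2"
    have "(\<lambda>n. H2_inner (X n) (\<theta> * k) - (\<alpha> * H2_inner (X n) k + \<beta> * H2_inner (Y n) k))
        \<longlonglongrightarrow> H2_inner f (\<theta> * k) - (\<alpha> * H2_inner f k + \<beta> * H2_inner g k)"
      by (intro tendsto_intros H2_inner_tendsto X Y f g k Xf Yg inner_mult_H2[OF inner])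
    then show "H2_inner f (\<theta> * k) - (\<alpha> * H2_inner f k + \<beta> * H2_inner g k) = 0"
      by (simp add: K'(3)[OF k] LIMSEQ_const_iff)
  next
    fix z :: complex assume z: "z \<in> ball 0 1"
    have l: "(\<lambda>n. \<gamma> * X n y + \<delta> * Y n y) \<longlonglongrightarrow> \<gamma> * f y + \<delta> * g y" if "y \<in> ball 0 1" for y
      by (intro tendsto_intros H2_point_tendsto X Y f g Xf Yg that)
    have "(\<lambda>n. \<gamma> * X n z + \<delta> * Y n z) = (\<lambda>n. \<gamma> * X n 0 + \<delta> * Y n 0)" by (intro ext K'(4)[OF z])
    then show "\<gamma> * f z + \<delta> * g z = \<gamma> * f 0 + \<delta> * g 0"
      using l[OF z] l[of 0] LIMSEQ_unique by (metis centre_in_ball zero_less_one)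
  qed
qed

text \<open>
  The first equation for the shifted pair tested on \<open>f\<close> is the one for the original pair tested on
  \<open>z f\<close>.  In the second, the backward shift annihilates constants.
\<close>

lemma invariant_model_pairs: "invariant_SS (model_pairs \<theta> \<alpha> \<beta> \<gamma> \<delta>)"
  unfolding invariant_SS_def
proof (intro allI impI)
  fix k0 k1 assume K: "(k0, k1) \<in> model_pairs \<theta> \<alpha> \<beta> \<gamma> \<delta>"
  note k = model_pairsD[OF K]
  note H = k(1,2)
  have S: "backshift k0 \<in> H2" "backshift k1 \<in> H2" using H backshift_H2 by auto
  show "(backshift k0, backshift k1) \<in> model_pairs \<theta> \<alpha> \<beta> \<gamma> \<delta>"
    unfolding model_pairs_iff
  proof (intro conjI S)
    show "\<forall>f\<in>H2. H2_inner (backshift k0) (\<theta> * f) - (\<alpha> * H2_inner (backshift k0) f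
        + \<beta> * H2_inner (backshift k1) f) = 0"
    proof
      fix f assume f: "f \<in> H2"
      have "H2_inner k0 (\<theta> * zshift f) - (\<alpha> * H2_inner k0 (zshift f) + \<beta> * H2_inner k1 (zshift f)) = 0"
        by (rule k(3)[OF zshift_H2[OF f]])
      then show "H2_inner (backshift k0) (\<theta> * f) - (\<alpha> * H2_inner (backshift k0) f
          + \<beta> * H2_inner (backshift k1) f) = 0"
        using H f inner_mult_H2[OF inner f] by (simp only: backshift_adjoint zshift_inner_mult[OF inner])
    qed
    have "\<gamma> *\<^sub>F backshift k0 + \<delta> *\<^sub>F backshift k1 = 0"
    proof (rule zshift_cancel)
      show "\<gamma> *\<^sub>F backshift k0 + \<delta> *\<^sub>F backshift k1 \<in> H2" by (intro H2_add fscale_H2 S)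
      show "0 \<in> H2" by (rule zero_H2)
      fix z :: complex assume z: "z \<in> ball 0 1"
      have "\<gamma> * k0 z + \<delta> * k1 z = \<gamma> * k0 0 + \<delta> * k1 0" by (rule k(4)[OF z])
      moreover have "z * (\<gamma> *\<^sub>F backshift k0 + \<delta> *\<^sub>F backshift k1) z
          = \<gamma> * (z * backshift k0 z) + \<delta> * (z * backshift k1 z)"
        by (simp add: fscale_def algebra_simps)
      ultimately show "z * (\<gamma> *\<^sub>F backshift k0 + \<delta> *\<^sub>F backshift k1) z = z * 0 z"
        unfolding mult_backshift[OF z] by (simp add: algebra_simps)
    qed
    then have "\<gamma> * backshift k0 z + \<delta> * backshift k1 z = 0" for z
      by (simp add: fscale_def fun_eq_iff)
    then show "\<forall>z\<in>ball 0 1. \<gamma> * backshift k0 z + \<delta> * backshift k1 z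
        = \<gamma> * backshift k0 0 + \<delta> * backshift k1 0"
      by simp
  qed
qed

text \<open>Membership in the kernel is tested against all of \<open>H2\<close>, which removes the projection.\<close>

lemma rank_one_kernel_iff:
  assumes f: "f \<in> H2" and v: "v \<in> H2"
  shows "toeplitz (\<lambda>\<zeta>. cnj (bdry \<theta> \<zeta>)) f + c *\<^sub>F v = 0 \<longleftrightarrow>
    (\<forall>k\<in>H2. H2_inner f (\<theta> * k) + c * H2_inner v k = 0)"
proof -
  let ?h = "toeplitz (\<lambda>\<zeta>. cnj (bdry \<theta> \<zeta>)) f + c *\<^sub>F v"
  note T = toeplitz_cnj_inner[OF inner f]
  have h: "?h \<in> H2" using T v by (intro H2_add fscale_H2)
  have eq: "H2_inner ?h k = H2_inner f (\<theta> * k) + c * H2_inner v k" if "k \<in> H2" for k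
    using T(2)[OF that] that v by (simp only: H2_inner_add_left H2_inner_fscale_left T(1) fscale_H2)
  show ?thesis
  proof
    assume "?h = 0"
    then show "\<forall>k\<in>H2. H2_inner f (\<theta> * k) + c * H2_inner v k = 0" using eq H2_inner_zero_left by metis
  next
    assume "\<forall>k\<in>H2. H2_inner f (\<theta> * k) + c * H2_inner v k = 0"
    then show "?h = 0" by (intro H2_inner_left_cong h zero_H2) (simp only: eq H2_inner_zero_left)
  qed
qed

lemma model_space_add_multiple_iff:
  assumes f: "f \<in> H2" and v: "v \<in> H2"
  shows "f - c *\<^sub>F (\<theta> * v) \<in> model_space \<theta> \<longleftrightarrow> (\<forall>k\<in>H2. H2_inner f (\<theta> * k) = c * H2_inner v k)"
proof -
  have tv: "\<theta> * v \<in> H2" by (rule inner_mult_H2[OF inner v])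
  have "H2_inner (f - c *\<^sub>F (\<theta> * v)) (\<theta> * k) = H2_inner f (\<theta> * k) - c * H2_inner v k"
      if k: "k \<in> H2" for k
    using f v k tv inner_mult_H2[OF inner k]
    by (simp only: H2_inner_diff_left fscale_H2 H2_inner_fscale_left H2_inner_inner_mult[OF inner])
  then show ?thesis
    unfolding model_space_iff[OF inner] using H2_diff[OF f fscale_H2[OF tv]] by simp
qed

end

theorem corollary3p7:
  fixes \<theta> u v :: "complex \<Rightarrow> complex"
    and R1 :: "(complex \<Rightarrow> complex) \<Rightarrow> complex \<Rightarrow> complex"
    and M :: "(complex \<Rightarrow> complex) set"
    and K :: "((complex \<Rightarrow> complex) \<times> (complex \<Rightarrow> complex)) set"
  assumes "inner_function \<theta>" and "\<not> \<theta> constant_on ball 0 1"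
    and "u \<in> H2" and "v \<in> H2" and "H2_norm u = 1" and "backshift v \<noteq> 0"
    and "\<exists>w\<in>H2. u = \<theta> * w"
    and R1: "R1 = (\<lambda>f. toeplitz (\<lambda>\<zeta>. cnj (bdry \<theta> \<zeta>)) f + H2_inner f u *\<^sub>F v)"
    and "1 + H2_inner (\<theta> * v) u = 0"
    and M: "M = {f \<in> H2. R1 f = 0}"
    and K: "K = {(k0, k1). k0 \<in> H2 \<and> k1 \<in> H2 \<and>
       k0 - (cnj (\<theta> 0) *\<^sub>F k0 + (v 0 / of_real (H2_norm (backshift v))) *\<^sub>F k1) * \<theta>
         \<in> model_space \<theta> \<and>
       (cnj (\<theta> 0 * v 0) / of_real ((H2_norm v)\<^sup>2)) *\<^sub>F k0
         + (1 / of_real (H2_norm (backshift v))) *\<^sub>F k1 \<in> range disc_const}"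
  shows "
    M = {g + h | g h. g \<in> model_space \<theta> \<and> h \<in> cfun.span {\<theta> * v}} \<and>
    (\<forall>g\<in>model_space \<theta>. \<forall>h\<in>cfun.span {\<theta> * v}. H2_inner g h = 0) \<and>
    nearly_invariant 1 M \<and>
    defect_space 1 M (cfun.span {\<theta> * backshift v}) \<and>
    proj M (bdry (disc_const 1)) =
       disc_const 1 - cnj (\<theta> 0) *\<^sub>F \<theta>
         + (cnj (\<theta> 0) * cnj (v 0) / of_real ((H2_norm v)\<^sup>2)) *\<^sub>F (\<theta> * v) \<and>
    closed_subspace_H2xH2 K \<and> invariant_SS K \<and>
    M = {k0 - (cnj (\<theta> 0) *\<^sub>F k0 + (v 0 / of_real (H2_norm (backshift v))) *\<^sub>F k1) * \<theta>
         + ((cnj (\<theta> 0 * v 0) / of_real ((H2_norm v)\<^sup>2)) *\<^sub>F k0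
            + (1 / of_real (H2_norm (backshift v))) *\<^sub>F k1) * (\<theta> * v) | k0 k1. (k0, k1) \<in> K}"
proof -
  note inner = assms(1) and u = assms(3) and v = assms(4)
  obtain w where w: "w \<in> H2" "u = \<theta> * w" using assms(7) by blast
  have \<theta>H: "\<theta> \<in> H2" by (rule inner_H2[OF inner])
  have tv: "\<theta> * v \<in> H2" by (rule inner_mult_H2[OF inner v])
  have Sv: "backshift v \<in> H2" by (rule backshift_H2[OF v])
  have tSv: "\<theta> * backshift v \<in> H2" by (rule inner_mult_H2[OF inner Sv])
  note z0 = H2_inner_zero_left
  have norm0: "H2_norm 0 = 0" by (simp add: H2_norm_def z0[OF zero_H2])
  have nSv: "H2_norm (backshift v) \<noteq> 0" using H2_norm_eq_0[OF Sv] assms(6) by blast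
  have "v \<noteq> 0"
  proof
    assume "v = 0"
    then have "z * backshift v z = z * 0 z" if "z \<in> ball 0 1" for z
      using mult_backshift[OF that, of v] by simp
    then have "backshift v = 0" by (rule zshift_cancel[OF Sv zero_H2])
    then show False using assms(6) by blast
  qed
  then have nv: "H2_norm v \<noteq> 0" using H2_norm_eq_0[OF v] by blast
  have KH: "g \<in> H2" if "g \<in> model_space \<theta>" for g using that by (simp add: model_space_def)

  have M_iff: "f \<in> M \<longleftrightarrow> f \<in> H2 \<and> (\<forall>k\<in>H2. H2_inner f (\<theta> * k) + H2_inner f u * H2_inner v k = 0)" for f
    unfolding M R1 using rank_one_kernel_iff[OF inner _ v] by blast
  have u_model: "H2_inner g u = 0" if "g \<in> model_space \<theta>" for g
    using that w by (simp add: model_space_def)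
  have tvu: "H2_inner (\<theta> * v) u = - 1" using assms(9) by (simp add: add_eq_0_iff)
  \<comment> \<open>the coefficient of \<open>\<theta> v\<close> is forced to be \<open>- \<langle>f, u\<rangle>\<close>, and \<open>\<langle>\<theta> v, u\<rangle> = -1\<close> makes this consistent\<close>
  have M_decomp: "f \<in> M \<longleftrightarrow> (\<exists>g c. g \<in> model_space \<theta> \<and> f = g + c *\<^sub>F (\<theta> * v))" for f
  proof
    assume f: "f \<in> M"
    let ?c = "- H2_inner f u"
    have fH: "f \<in> H2" using f M_iff by blast
    have "H2_inner f (\<theta> * k) = ?c * H2_inner v k" if "k \<in> H2" for k
      using f that M_iff by (simp add: eq_neg_iff_add_eq_0)
    then have "f - ?c *\<^sub>F (\<theta> * v) \<in> model_space \<theta>"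
      using model_space_add_multiple_iff[OF inner fH v] by blast
    moreover have "f = (f - ?c *\<^sub>F (\<theta> * v)) + ?c *\<^sub>F (\<theta> * v)" by (rule diff_add_cancel[symmetric])
    ultimately show "\<exists>g c. g \<in> model_space \<theta> \<and> f = g + c *\<^sub>F (\<theta> * v)" by blast
  next
    assume "\<exists>g c. g \<in> model_space \<theta> \<and> f = g + c *\<^sub>F (\<theta> * v)"
    then obtain g c where g: "g \<in> model_space \<theta>" and f: "f = g + c *\<^sub>F (\<theta> * v)" by blast
    have fH: "f \<in> H2" unfolding f by (intro H2_add fscale_H2 tv KH g)
    have fg: "f - c *\<^sub>F (\<theta> * v) = g" unfolding f by (rule add_diff_cancel_right')
    have 1: "\<forall>k\<in>H2. H2_inner f (\<theta> * k) = c * H2_inner v k"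
      unfolding model_space_add_multiple_iff[OF inner fH v, symmetric] fg by (rule g)
    have "H2_inner f u = - c"
      unfolding f using KH[OF g] tv u u_model[OF g] tvu
      by (simp only: H2_inner_add_left H2_inner_fscale_left fscale_H2) simp
    then show "f \<in> M" using 1 fH M_iff by simp
  qed
  have span_tv: "cfun.span {\<theta> * v} = range (\<lambda>c. c *\<^sub>F (\<theta> * v))"
    and span_tSv: "cfun.span {\<theta> * backshift v} = range (\<lambda>c. c *\<^sub>F (\<theta> * backshift v))"
    by (rule cfun.span_singleton)+
  have C1: "M = {g + h | g h. g \<in> model_space \<theta> \<and> h \<in> cfun.span {\<theta> * v}}"
    unfolding span_tv using M_decomp by blast
  have C2: "\<forall>g\<in>model_space \<theta>. \<forall>h\<in>cfun.span {\<theta> * v}. H2_inner g h = 0"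
    unfolding span_tv
  proof (intro ballI)
    fix g h assume g: "g \<in> model_space \<theta>" and "h \<in> range (\<lambda>c. c *\<^sub>F (\<theta> * v))"
    then obtain c where h: "h = c *\<^sub>F (\<theta> * v)" by blast
    have "H2_inner g (\<theta> * v) = 0" using g v by (simp add: model_space_def)
    then show "H2_inner g h = 0" unfolding h using H2_inner_fscale_right[OF tv KH[OF g]] by simp
  qed
  have model_M: "g \<in> M" if "g \<in> model_space \<theta>" for g
  proof -
    have "g = g + 0 *\<^sub>F (\<theta> * v)" by (simp add: fscale_def fun_eq_iff)
    then show ?thesis using M_decomp that by blast
  qed

  have MH: "M \<subseteq> H2" using M_iff by blast
  have M_sub: "cfun.subspace M"
    unfolding cfun.subspace_def
  proof (intro conjI ballI allI)
    have "0 \<in> model_space \<theta>" using zero_H2 z0 inner_mult_H2[OF inner] by (simp add: model_space_def)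
    then show "0 \<in> M" by (rule model_M)
  next
    fix x y assume "x \<in> M" "y \<in> M"
    then obtain g c h d where g: "g \<in> model_space \<theta>" "h \<in> model_space \<theta>"
      and xy: "x = g + c *\<^sub>F (\<theta> * v)" "y = h + d *\<^sub>F (\<theta> * v)" using M_decomp by blast
    have "x + y = (g + h) + (c + d) *\<^sub>F (\<theta> * v)"
      unfolding xy by (simp add: fscale_def fun_eq_iff algebra_simps)
    then show "x + y \<in> M" using model_space_add[OF inner g] M_decomp by blast
  next
    fix a x assume "x \<in> M"
    then obtain g c where g: "g \<in> model_space \<theta>" and x: "x = g + c *\<^sub>F (\<theta> * v)" using M_decomp by blast
    have "a *\<^sub>F x = a *\<^sub>F g + (a * c) *\<^sub>F (\<theta> * v)"
      unfolding x by (simp add: fscale_def fun_eq_iff algebra_simps)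
    then show "a *\<^sub>F x \<in> M" using model_space_fscale[OF inner g] M_decomp by blast
  qed
  have M_closed: "closed_subspace_H2 M"
    unfolding closed_subspace_H2_def
  proof (intro conjI allI impI MH M_sub)
    fix X f
    assume *: "(\<forall>n. X n \<in> M) \<and> f \<in> H2 \<and> (\<lambda>n::nat. H2_norm (X n - f)) \<longlonglongrightarrow> 0"
    have XM: "X n \<in> M" for n using * by blast
    have f: "f \<in> H2" and Xf: "(\<lambda>n. H2_norm (X n - f)) \<longlonglongrightarrow> 0" using * by auto
    have X: "X n \<in> H2" for n using XM MH by blast
    have "H2_inner f (\<theta> * k) + H2_inner f u * H2_inner v k = 0" if k: "k \<in> H2" for k
    proof -
      have "(\<lambda>n. H2_inner (X n) (\<theta> * k) + H2_inner (X n) u * H2_inner v k)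
          \<longlonglongrightarrow> H2_inner f (\<theta> * k) + H2_inner f u * H2_inner v k"
        by (intro tendsto_intros H2_inner_tendsto X f k Xf u inner_mult_H2[OF inner])
      moreover have "H2_inner (X n) (\<theta> * k) + H2_inner (X n) u * H2_inner v k = 0" for n
        using XM[of n] M_iff k by blast
      ultimately show ?thesis by (simp add: LIMSEQ_const_iff)
    qed
    then show "f \<in> M" using M_iff f by blast
  qed
  have C4: "defect_space 1 M (cfun.span {\<theta> * backshift v})"
    unfolding defect_space_def
  proof (intro conjI ballI impI)
    show "cfun.span {\<theta> * backshift v} \<subseteq> H2"
      unfolding span_tSv using fscale_H2[OF tSv] by blast
    have "\<theta> * backshift v \<noteq> 0"
    proof
      assume "\<theta> * backshift v = 0"
      then have "H2_norm (backshift v) = 0" using H2_norm_inner_mult[OF inner Sv] norm0 by simp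
      then show False using nSv by blast
    qed
    then have "cfun.independent {\<theta> * backshift v}" by (simp add: cfun.dependent_single)
    then show "\<exists>B. finite B \<and> card B = 1 \<and> cfun.independent B \<and> cfun.span {\<theta> * backshift v}
        = cfun.span B"
      by (intro exI[of _ "{\<theta> * backshift v}"]) auto
    fix f assume "f \<in> M" "f 0 = 0"
    then obtain g c where g: "g \<in> model_space \<theta>" and f: "f = g + c *\<^sub>F (\<theta> * v)" using M_decomp by blast
    have "backshift f = backshift g + c *\<^sub>F (\<theta> * backshift v + v 0 *\<^sub>F backshift \<theta>)"
      unfolding f using backshift_add_fscale[OF KH[OF g] tv, of c] backshift_inner_mult[OF inner v] by simp
    also have "\<dots> = (backshift g + (c * v 0) *\<^sub>F backshift \<theta>) + c *\<^sub>F (\<theta> * backshift v)"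
      by (simp add: fscale_def fun_eq_iff algebra_simps)
    finally have "backshift f = (backshift g + (c * v 0) *\<^sub>F backshift \<theta>) + c *\<^sub>F (\<theta> * backshift v)" .
    moreover have "backshift g + (c * v 0) *\<^sub>F backshift \<theta> \<in> M"
      by (intro model_M model_space_add[OF inner] model_space_fscale[OF inner]
          model_space_backshift[OF inner] backshift_inner_in_model_space[OF inner] g)
    ultimately show "\<exists>g\<in>M. \<exists>h\<in>cfun.span {\<theta> * backshift v}. backshift f = g + h"
      unfolding span_tSv by blast
  qed
  have C3: "nearly_invariant 1 M"
    unfolding nearly_invariant_def using M_closed C4 by blast

  let ?a = "cnj (\<theta> 0)"
  let ?b = "cnj (\<theta> 0) * cnj (v 0) / of_real ((H2_norm v)\<^sup>2)"
  have oneH: "disc_const 1 \<in> H2" by (rule disc_const_H2)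
  have g1: "disc_const 1 - ?a *\<^sub>F \<theta> \<in> model_space \<theta>"
  proof -
    have "H2_inner (disc_const 1 - ?a *\<^sub>F \<theta>) (\<theta> * k) = 0" if k: "k \<in> H2" for k
    proof -
      have tk: "\<theta> * k \<in> H2" by (rule inner_mult_H2[OF inner k])
      have "H2_inner \<theta> (\<theta> * k) = cnj (k 0)"
        using H2_inner_inner_mult[OF inner oneH k] H2_inner_disc_const_left[OF k]
        by (simp only: inner_mult_one[OF inner])
      moreover have "H2_inner (disc_const 1) (\<theta> * k) = cnj (\<theta> 0) * cnj (k 0)"
        using H2_inner_disc_const_left[OF tk] by simp
      moreover have "H2_inner (disc_const 1 - ?a *\<^sub>F \<theta>) (\<theta> * k)
          = H2_inner (disc_const 1) (\<theta> * k) - ?a * H2_inner \<theta> (\<theta> * k)"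
        using oneH \<theta>H tk by (simp only: H2_inner_diff_left fscale_H2 H2_inner_fscale_left)
      ultimately show ?thesis by simp
    qed
    then show ?thesis using H2_diff[OF oneH fscale_H2[OF \<theta>H]] by (simp add: model_space_def)
  qed
  have C5: "proj M (bdry (disc_const 1)) = disc_const 1 - ?a *\<^sub>F \<theta> + ?b *\<^sub>F (\<theta> * v)"
  proof (rule proj_eq[OF MH])
    show "f - g \<in> M" if "f \<in> M" "g \<in> M" for f g using cfun.subspace_diff[OF M_sub that] .
    show "sq_integrable (bdry (disc_const 1))" by (rule sq_integrable_bdry[OF oneH])
    show hM: "disc_const 1 - ?a *\<^sub>F \<theta> + ?b *\<^sub>F (\<theta> * v) \<in> M" using g1 M_decomp by blast
    fix k assume "k \<in> M"
    then obtain g d where g: "g \<in> model_space \<theta>" and k: "k = g + d *\<^sub>F (\<theta> * v)" using M_decomp by blast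
    let ?h = "disc_const 1 - ?a *\<^sub>F \<theta> + ?b *\<^sub>F (\<theta> * v)"
    have hH: "?h \<in> H2" using hM MH by blast
    have gH: "g \<in> H2" by (rule KH[OF g])
    have kH: "k \<in> H2" unfolding k by (intro H2_add fscale_H2 tv gH)
    have "H2_inner \<theta> g = cnj (H2_inner g (\<theta> * disc_const 1))"
      by (simp only: inner_mult_one[OF inner] H2_inner_commute[of \<theta> g])
    also have "\<dots> = 0" using g oneH unfolding model_space_def by simp
    finally have tg: "H2_inner \<theta> g = 0" .
    have tvg: "H2_inner (\<theta> * v) g = 0"
      using g v H2_inner_commute[of "\<theta> * v" g] by (simp add: model_space_def)
    have ttv: "H2_inner \<theta> (\<theta> * v) = cnj (v 0)"
      using H2_inner_inner_mult[OF inner oneH v] H2_inner_disc_const_left[OF v]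
      by (simp only: inner_mult_one[OF inner])
    have tvtv: "H2_inner (\<theta> * v) (\<theta> * v) = of_real ((H2_norm v)\<^sup>2)"
      using H2_inner_inner_mult[OF inner v v] H2_inner_self[of v] by simp
    have "L2_inner (bdry (disc_const 1) - bdry ?h) (bdry k) = H2_inner (disc_const 1) k - H2_inner ?h k"
      unfolding H2_inner_def by (intro L2_inner_minus_left sq_integrable_bdry oneH hH kH)
    also have "H2_inner ?h k = H2_inner (disc_const 1) k - ?a * H2_inner \<theta> k + ?b * H2_inner (\<theta> * v) k"
      using oneH \<theta>H tv kH
      by (simp only: H2_inner_add_left H2_inner_diff_left H2_diff H2_inner_fscale_left fscale_H2)
    also have "H2_inner \<theta> k = cnj d * cnj (v 0)"
      unfolding k using \<theta>H tv gH tg ttv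
      by (simp only: H2_inner_add_right H2_inner_fscale_right fscale_H2) simp
    also have "H2_inner (\<theta> * v) k = cnj d * of_real ((H2_norm v)\<^sup>2)"
      unfolding k using \<theta>H tv gH tvg tvtv
      by (simp only: H2_inner_add_right H2_inner_fscale_right fscale_H2) simp
    also have "H2_inner (disc_const 1) k - (H2_inner (disc_const 1) k - ?a * (cnj d * cnj (v 0))
        + ?b * (cnj d * of_real ((H2_norm v)\<^sup>2))) = 0"
      using nv by simp
    finally show "L2_inner (bdry (disc_const 1) - bdry ?h) (bdry k) = 0" .
  qed

  let ?n = "complex_of_real (H2_norm (backshift v))"
  let ?\<gamma> = "cnj (\<theta> 0 * v 0) / of_real ((H2_norm v)\<^sup>2)"
  have K': "K = model_pairs \<theta> (cnj (\<theta> 0)) (v 0 / ?n) ?\<gamma> (1 / ?n)"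
    unfolding K model_pairs_def ..
  have C6: "closed_subspace_H2xH2 K" "invariant_SS K"
    unfolding K' by (rule closed_model_pairs[OF inner], rule invariant_model_pairs[OF inner])
  have disc_const_mult: "disc_const c * (\<theta> * v) = c *\<^sub>F (\<theta> * v)" for c
    using inner_outside[OF inner] by (auto simp: disc_const_def fscale_def fun_eq_iff)
  let ?A = "\<lambda>k0 k1. k0 - (cnj (\<theta> 0) *\<^sub>F k0 + (v 0 / ?n) *\<^sub>F k1) * \<theta>"
  let ?B = "\<lambda>k0 k1. ?\<gamma> *\<^sub>F k0 + (1 / ?n) *\<^sub>F k1"
  have C7: "M = {?A k0 k1 + ?B k0 k1 * (\<theta> * v) | k0 k1. (k0, k1) \<in> K}"
  proof (intro set_eqI iffI)
    fix f assume "f \<in> {?A k0 k1 + ?B k0 k1 * (\<theta> * v) | k0 k1. (k0, k1) \<in> K}"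
    then obtain k0 k1 where f: "f = ?A k0 k1 + ?B k0 k1 * (\<theta> * v)" and k: "(k0, k1) \<in> K" by blast
    have A: "?A k0 k1 \<in> model_space \<theta>" and B: "?B k0 k1 \<in> range disc_const"
      using k unfolding K by blast+
    from B obtain c where c: "?B k0 k1 = disc_const c" by blast
    have "f = ?A k0 k1 + c *\<^sub>F (\<theta> * v)" unfolding f c disc_const_mult ..
    then show "f \<in> M" using A M_decomp by blast
  next
    fix f assume "f \<in> M"
    then obtain g c where g: "g \<in> model_space \<theta>" and f: "f = g + c *\<^sub>F (\<theta> * v)" using M_decomp by blast
    define t where "t = 1 - (cmod (v 0))\<^sup>2 / (H2_norm v)\<^sup>2"
    have "cmod (v 0) \<le> H2_norm v" using H2_point_bound[OF v, of 0] by simp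
    then have "(cmod (v 0))\<^sup>2 \<le> (H2_norm v)\<^sup>2" by (intro power_mono) auto
    then have t: "0 \<le> t" "t \<le> 1" using nv by (auto simp: t_def divide_le_eq)
    \<comment> \<open>eliminating \<open>k1\<close> from the two conditions leaves \<open>k0 D = g + v(0) c \<theta>\<close>\<close>
    define D where "D z = 1 - ?a * of_real t * \<theta> z" for z
    have a1: "cmod (\<theta> 0) < 1" by (rule inner_at_0_less_1[OF inner assms(2)])
    have D: "1 - cmod (\<theta> 0) \<le> cmod (D z)" "D z \<noteq> 0" if z: "z \<in> ball 0 1" for z
    proof -
      have "cmod (?a * of_real t * \<theta> z) = cmod (\<theta> 0) * (t * cmod (\<theta> z))"
        using t by (simp add: norm_mult)
      also have "\<dots> \<le> cmod (\<theta> 0) * (1 * 1)"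
        using t inner_le_1[OF inner z] by (intro mult_left_mono mult_mono) auto
      finally have "cmod (?a * of_real t * \<theta> z) \<le> cmod (\<theta> 0)" by simp
      moreover have "cmod 1 - cmod (?a * of_real t * \<theta> z) \<le> cmod (D z)"
        unfolding D_def by (rule norm_triangle_ineq2)
      ultimately show "1 - cmod (\<theta> 0) \<le> cmod (D z)" by simp
      then show "D z \<noteq> 0" using a1 by auto
    qed
    define p where "p = g + (v 0 * c) *\<^sub>F \<theta>"
    have p: "p \<in> H2" unfolding p_def by (intro H2_add fscale_H2 \<theta>H KH g)
    define k0 where "k0 = (\<lambda>z. 1 / D z) * p"
    have k0: "k0 \<in> H2" unfolding k0_def
    proof (rule H2_mult[OF _ _ p])
      show "(\<lambda>z. 1 / D z) holomorphic_on ball 0 1"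
        unfolding D_def using D(2) inner_holomorphic[OF inner]
        by (intro holomorphic_intros) (auto simp: D_def)
      show "cmod (1 / D z) \<le> 1 / (1 - cmod (\<theta> 0))" if "z \<in> ball 0 1" for z
        using D(1)[OF that] a1 by (simp add: norm_divide frac_le)
    qed
    \<comment> \<open>chosen so that the second condition holds with the constant \<open>c\<close>\<close>
    define k1 where "k1 = ?n *\<^sub>F (disc_const c - ?\<gamma> *\<^sub>F k0)"
    have k1: "k1 \<in> H2" unfolding k1_def by (intro fscale_H2 H2_diff disc_const_H2 k0)
    have n0: "?n \<noteq> 0" using nSv by simp
    have B: "?B k0 k1 = disc_const c"
      using n0 by (simp add: k1_def fscale_def fun_eq_iff)
    have A: "?A k0 k1 = g"
    proof
      fix z
      show "?A k0 k1 z = g z"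
      proof (cases "z \<in> ball 0 1")
        case True
        have k1z: "k1 z = ?n * (c - ?\<gamma> * k0 z)"
          using True by (simp add: k1_def fscale_def disc_const_def)
        \<comment> \<open>the coefficient of \<open>\<theta>\<close> that remains when \<open>k1\<close> has been eliminated\<close>
        have at: "?a * of_real t = ?a - v 0 * ?\<gamma>"
        proof -
          have "complex_of_real t = 1 - v 0 * cnj (v 0) / of_real ((H2_norm v)\<^sup>2)"
            unfolding t_def by (simp only: of_real_diff of_real_1 of_real_divide complex_norm_square)
          then show ?thesis by (simp only: right_diff_distrib complex_cnj_mult) simp
        qed
        have "?A k0 k1 z = k0 z - (?a * k0 z + v 0 / ?n * k1 z) * \<theta> z"
          by (simp add: fscale_def)
        also have "v 0 / ?n * k1 z = v 0 * (c - ?\<gamma> * k0 z)"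
          unfolding k1z using n0 by simp
        also have "k0 z - (?a * k0 z + v 0 * (c - ?\<gamma> * k0 z)) * \<theta> z
            = k0 z * (1 - (?a - v 0 * ?\<gamma>) * \<theta> z) - v 0 * c * \<theta> z"
          by (simp only: ring_distribs mult_ac) (simp add: algebra_simps)
        also have "1 - (?a - v 0 * ?\<gamma>) * \<theta> z = D z" unfolding D_def at ..
        also have "k0 z * D z = p z" using D(2)[OF True] by (simp add: k0_def)
        finally show ?thesis by (simp add: p_def fscale_def)
      next
        case False
        then show ?thesis
          using H2_outside[OF k0 False] H2_outside[OF k1 False] H2_outside[OF KH[OF g] False]
          by (simp add: fscale_def)
      qed
    qed
    have "(k0, k1) \<in> K" unfolding K using k0 k1 A B g by simp
    moreover have "f = ?A k0 k1 + ?B k0 k1 * (\<theta> * v)"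
      unfolding A B disc_const_mult f ..
    ultimately show "f \<in> {?A k0 k1 + ?B k0 k1 * (\<theta> * v) | k0 k1. (k0, k1) \<in> K}" by blast
  qed
  show ?thesis using C1 C2 C3 C4 C5 C6 C7 by blast
qed

end
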